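(* Let $G$ be a Cohen–Macaulay cactus graph and let $J(G)$ be its vertex cover ideal. Then for every integer $k\geq 1$, the ideal $J(G)^k$ is weakly polymatroidal, i.e. there is a total ordering $x_1>x_2>\cdots>x_n$ of the variables of $S$ such that $J(G)^k$ is weakly polymatroidal with respect to this ordering.
   Context: Let $G$ be a finite simple graph with vertex set $V(G)=\{x_1,\dots,x_n\}$, and let $S=K[x_1,\dots,x_n]$ be the polynomial ring over a field $K$, identifying vertices with variables. A vertex cover of $G$ is a subset $C\subseteq V(G)$ meeting every edge; it is minimal if no proper subset is a vertex cover. The vertex cover ideal is $J(G)=\big(\prod_{x\in C}x : C \text{ a minimal vertex cover of } G\big)\subseteq S$. The edge ideal is $I(G)=(x_ix_j:\{x_i,x_j\}\in E(G))$, and $G$ is Cohen–Macaulay if $S/I(G)$ is a Cohen–Macaulay ring. A cactus graph is a connected graph in which each edge belongs to at most one cycle. A monomial ideal $I$ generated in a single degree is weakly polymatroidal with respect to the ordering $x_1>\cdots>x_n$ if for any two minimal monomial generators $u=x_1^{a_1}\cdots x_n^{a_n}$ and $v=x_1^{b_1}\cdots x_n^{b_n}$ of $I$ such that there is an index $t$ with $a_1=b_1,\dots,a_{t-1}=b_{t-1}$ and $a_t>b_t$, there exists $j>t$ such that $x_t v/x_j\in I$. *)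

theory Defs
  imports Main "HOL-Library.Poly_Mapping" "HOL-Library.Extended_Nat"
begin

definition is_ideal :: "'r::comm_ring_1 set \<Rightarrow> bool" where
  "is_ideal I \<longleftrightarrow> 0 \<in> I \<and> (\<forall>a\<in>I. \<forall>b\<in>I. a + b \<in> I) \<and> (\<forall>a\<in>I. \<forall>r. r * a \<in> I)"

definition ideal_of :: "'r::comm_ring_1 set \<Rightarrow> 'r set" where
  "ideal_of A = \<Inter>{I. is_ideal I \<and> A \<subseteq> I}"

fun ideal_pow :: "'r::comm_ring_1 set \<Rightarrow> nat \<Rightarrow> 'r set" where
  "ideal_pow I 0 = UNIV"
| "ideal_pow I (Suc k) = ideal_of {a * b | a b. a \<in> ideal_pow I k \<and> b \<in> I}"

definition is_prime_ideal :: "'r::comm_ring_1 set \<Rightarrow> bool" where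
  "is_prime_ideal P \<longleftrightarrow> is_ideal P \<and> P \<noteq> UNIV \<and> (\<forall>a b. a * b \<in> P \<longrightarrow> a \<in> P \<or> b \<in> P)"

definition krull_dim_quot :: "'r::comm_ring_1 set \<Rightarrow> enat" where
  "krull_dim_quot I = Sup {enat d | d. \<exists>P :: nat \<Rightarrow> 'r set.
      (\<forall>i\<le>d. is_prime_ideal (P i) \<and> I \<subseteq> P i) \<and> (\<forall>i<d. P i \<subset> P (Suc i))}"

definition regular_seq :: "'r::comm_ring_1 set \<Rightarrow> 'r set \<Rightarrow> 'r list \<Rightarrow> bool" where
  "regular_seq I m fs \<longleftrightarrow> set fs \<subseteq> m \<and> ideal_of (I \<union> set fs) \<noteq> UNIV \<and>
     (\<forall>i<length fs. \<forall>g. g * fs ! i \<in> ideal_of (I \<union> set (take i fs))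
                        \<longrightarrow> g \<in> ideal_of (I \<union> set (take i fs)))"

definition depth_quot :: "'r::comm_ring_1 set \<Rightarrow> 'r set \<Rightarrow> enat" where
  "depth_quot m I = Sup {enat (length fs) | fs. regular_seq I m fs}"

type_synonym ('a, 'k) mpoly = "('a \<Rightarrow>\<^sub>0 nat) \<Rightarrow>\<^sub>0 'k"

definition monom :: "('a \<Rightarrow>\<^sub>0 nat) \<Rightarrow> ('a, 'k::comm_ring_1) mpoly" where
  "monom a = Poly_Mapping.single a 1"

definition var :: "'a \<Rightarrow> ('a, 'k::comm_ring_1) mpoly" where
  "var v = monom (Poly_Mapping.single v 1)"

definition max_ideal :: "('a, 'k::comm_ring_1) mpoly set" where
  "max_ideal = ideal_of (range var)"

text \<open>S/I is Cohen-Macaulay (graded setting): depth_m(S/I) = dim(S/I).\<close>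
definition cohen_macaulay_quot :: "('a, 'k::field) mpoly set \<Rightarrow> bool" where
  "cohen_macaulay_quot I \<longleftrightarrow> depth_quot max_ideal I = krull_dim_quot I"

definition simple_graph :: "'a set set \<Rightarrow> bool" where
  "simple_graph E \<longleftrightarrow> (\<forall>e\<in>E. card e = 2)"

definition adj :: "'a set set \<Rightarrow> 'a \<Rightarrow> 'a \<Rightarrow> bool" where
  "adj E u v \<longleftrightarrow> {u, v} \<in> E"

definition connected_graph :: "'a set set \<Rightarrow> bool" where
  "connected_graph E \<longleftrightarrow> (\<forall>u v. (adj E)\<^sup>*\<^sup>* u v)"

definition is_cycle :: "'a set set \<Rightarrow> 'a list \<Rightarrow> bool" where
  "is_cycle E vs \<longleftrightarrow> length vs \<ge> 3 \<and> distinct vs \<and>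
     (\<forall>i<length vs. adj E (vs ! i) (vs ! ((i + 1) mod length vs)))"

definition cycle_edges :: "'a list \<Rightarrow> 'a set set" where
  "cycle_edges vs = {{vs ! i, vs ! ((i + 1) mod length vs)} | i. i < length vs}"

definition cactus_graph :: "'a set set \<Rightarrow> bool" where
  "cactus_graph E \<longleftrightarrow> connected_graph E \<and>
     (\<forall>e\<in>E. \<forall>c1 c2. is_cycle E c1 \<and> is_cycle E c2 \<and> e \<in> cycle_edges c1 \<and> e \<in> cycle_edges c2
                 \<longrightarrow> cycle_edges c1 = cycle_edges c2)"

definition vertex_cover :: "'a set set \<Rightarrow> 'a set \<Rightarrow> bool" where
  "vertex_cover E C \<longleftrightarrow> (\<forall>e\<in>E. e \<inter> C \<noteq> {})"

definition minimal_vertex_cover :: "'a set set \<Rightarrow> 'a set \<Rightarrow> bool" where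
  "minimal_vertex_cover E C \<longleftrightarrow> vertex_cover E C \<and> (\<forall>D. D \<subset> C \<longrightarrow> \<not> vertex_cover E D)"

definition sqfree_exp :: "'a::finite set \<Rightarrow> 'a \<Rightarrow>\<^sub>0 nat" where
  "sqfree_exp C = (\<Sum>v\<in>C. Poly_Mapping.single v 1)"

definition edge_ideal :: "'a set set \<Rightarrow> ('a, 'k::comm_ring_1) mpoly set" where
  "edge_ideal E = ideal_of {var u * var v | u v. {u, v} \<in> E}"

definition cover_ideal :: "'a::finite set set \<Rightarrow> ('a, 'k::comm_ring_1) mpoly set" where
  "cover_ideal E = ideal_of {monom (sqfree_exp C) | C. minimal_vertex_cover E C}"

definition min_mon_gens :: "('a, 'k::comm_ring_1) mpoly set \<Rightarrow> ('a \<Rightarrow>\<^sub>0 nat) set" where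
  "min_mon_gens I = {a. monom a \<in> I \<and>
      (\<forall>b c. monom b \<in> I \<and> a = b + c \<longrightarrow> c = 0)}"

definition mdeg :: "('a::finite \<Rightarrow>\<^sub>0 nat) \<Rightarrow> nat" where
  "mdeg a = (\<Sum>v\<in>UNIV. Poly_Mapping.lookup a v)"

text \<open>Weakly polymatroidal w.r.t. the ordering xs!0 > xs!1 > ... > xs!(n-1),
  where xs lists all variables exactly once (I is required to be generated in
  a single degree).\<close>
definition weakly_polymatroidal_wrt ::
  "('a::finite, 'k::comm_ring_1) mpoly set \<Rightarrow> 'a list \<Rightarrow> bool" where
  "weakly_polymatroidal_wrt I xs \<longleftrightarrow>
     (\<exists>d. \<forall>a\<in>min_mon_gens I. mdeg a = d) \<and>
     (\<forall>a\<in>min_mon_gens I. \<forall>b\<in>min_mon_gens I. \<forall>t<length xs.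
        (\<forall>i<t. Poly_Mapping.lookup a (xs ! i) = Poly_Mapping.lookup b (xs ! i)) \<and> Poly_Mapping.lookup a (xs ! t) > Poly_Mapping.lookup b (xs ! t)
        \<longrightarrow> (\<exists>j. t < j \<and> j < length xs \<and>
               (\<exists>w. b + Poly_Mapping.single (xs ! t) 1 = w + Poly_Mapping.single (xs ! j) 1
                    \<and> monom w \<in> I)))"

definition weakly_polymatroidal :: "('a::finite, 'k::comm_ring_1) mpoly set \<Rightarrow> bool" where
  "weakly_polymatroidal I \<longleftrightarrow>
     (\<exists>xs. distinct xs \<and> set xs = UNIV \<and> weakly_polymatroidal_wrt I xs)"

end

theory Submission
  imports Defs
begin

text \<open>
  Below the depth of \<open>S/I(G)\<close>, the Koszul cohomology of \<open>S/I(G)\<close> with respect to the squares of the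
  variables vanishes. In the multidegree that is \<open>-1\<close> on an independent set \<open>F\<close> and \<open>0\<close> elsewhere it is the
  reduced cohomology of the link of \<open>F\<close> in the independence complex. Hence a Cohen-Macaulay graph is
  well-covered, and for no independent \<open>F\<close> is \<open>G - N[F]\<close> a 4-cycle or a 7-cycle.

  For a cactus these two facts suffice: an end block must be a vertex, an edge, a triangle or a 5-cycle, and
  removing end blocks one after the other (each is a closed neighbourhood \<open>N[D]\<close> with \<open>D\<close> independent)
  partitions the vertices into cliques containing a vertex with no neighbour outside the clique, 5-cycles in
  which only two non-adjacent vertices may have neighbours outside, and edges \<open>fp\<close> of a 4-cycle
  \<open>s f p q\<close> with \<open>f\<close> and \<open>p\<close> of degree two. A maximal independent set meets each piece in 1, 2 and 1
  vertices respectively. Order the variables such that in each piece the vertices with neighbours outside come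
  first, and the pieces of the last kind come after all others. Comparing how often the vertices of a
  piece are missed by the covers in two products of \<open>k\<close> covers then yields the required exchange.
\<close>

section \<open>Koszul cochains and regular sequences\<close>

text \<open>Squares of the variables make links visible: in the multidegree that is -1 on
  \<open>F\<close>, the exterior factor of \<open>F\<close> raises the exponent on \<open>F\<close>
  to -1 + 2 = 1. So \<open>F\<close> lies in the support of every monomial involved, but no square
  of a variable of \<open>F\<close> divides it. Plain variables would leave exponent 0 and lose
  \<open>F\<close>.

  Well-coveredness alone allows end cycles of length 3, 4, 5 and 7. The independence complexes of
  the 4-cycle (two disjoint edges) and the 7-cycle have cohomology below the top degree over every
  field, which excludes them as links.

  The obstacle in gluing an end block back is that its attaching vertex \<open>c\<close> may be
  adjacent to the free vertex \<open>f\<close> of a clique. The clique then survives as a piece of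
  the first kind through another free vertex, or it is an edge \<open>fp\<close> on a 4-cycle
  \<open>c f p q\<close>; this is the origin of the third kind. Whether \<open>f\<close> can be
  traded for \<open>p\<close> depends on \<open>q\<close>, which lies in a piece of another kind and
  must be compared earlier.\<close>

lemma is_idealD:
  assumes "is_ideal I"
  shows "0 \<in> I" "\<And>a b. a \<in> I \<Longrightarrow> b \<in> I \<Longrightarrow> a + b \<in> I" "\<And>a r. a \<in> I \<Longrightarrow> r * a \<in> I"
    "\<And>a. a \<in> I \<Longrightarrow> - a \<in> I" "\<And>a b. a \<in> I \<Longrightarrow> b \<in> I \<Longrightarrow> a - b \<in> I"
proof -
  show *: "0 \<in> I" "\<And>a b. a \<in> I \<Longrightarrow> b \<in> I \<Longrightarrow> a + b \<in> I" "\<And>a r. a \<in> I \<Longrightarrow> r * a \<in> I"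
    using assms by (auto simp: is_ideal_def)
  show **: "- a \<in> I" if "a \<in> I" for a
    using *(3)[OF that, of "- 1"] by simp
  show "a - b \<in> I" if "a \<in> I" "b \<in> I" for a b
    using *(2)[OF that(1) **[OF that(2)]] by simp
qed

lemma is_ideal_ideal_of: "is_ideal (ideal_of A)"
  unfolding ideal_of_def is_ideal_def by auto

lemma subset_ideal_of: "A \<subseteq> ideal_of A"
  unfolding ideal_of_def by auto

lemma ideal_of_least: "is_ideal I \<Longrightarrow> A \<subseteq> I \<Longrightarrow> ideal_of A \<subseteq> I"
  unfolding ideal_of_def by auto

lemma ideal_of_ideal: "is_ideal I \<Longrightarrow> ideal_of I = I"
  using ideal_of_least[of I I] subset_ideal_of[of I] by blast

lemma ideal_of_Un_ideal_of: "ideal_of (ideal_of A \<union> B) = ideal_of (A \<union> B)"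
proof
  have "A \<subseteq> ideal_of (A \<union> B)" "B \<subseteq> ideal_of (A \<union> B)"
    using subset_ideal_of[of "A \<union> B"] by auto
  then show "ideal_of (ideal_of A \<union> B) \<subseteq> ideal_of (A \<union> B)"
    by (intro ideal_of_least is_ideal_ideal_of Un_least)
  show "ideal_of (A \<union> B) \<subseteq> ideal_of (ideal_of A \<union> B)"
    by (intro ideal_of_least is_ideal_ideal_of)
      (use subset_ideal_of[of A] subset_ideal_of[of "ideal_of A \<union> B"] in blast)
qed

lemma ideal_of_insert_ideal:
  assumes "is_ideal I" "x \<in> ideal_of (insert f I)"
  obtains g where "x - f * g \<in> I"
proof -
  have "is_ideal {x. \<exists>g. x - f * g \<in> I}"
    unfolding is_ideal_def
  proof (intro conjI ballI allI; simp only: mem_Collect_eq)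
    show "\<exists>g. 0 - f * g \<in> I"
      using is_idealD(1)[OF assms(1)] by (intro exI[of _ 0]) simp
  next
    fix a b assume "\<exists>g. a - f * g \<in> I" "\<exists>g. b - f * g \<in> I"
    then obtain g h where "a - f * g \<in> I" "b - f * h \<in> I" by blast
    then show "\<exists>g. a + b - f * g \<in> I"
      using is_idealD(2)[OF assms(1), of "a - f * g" "b - f * h"]
      by (intro exI[of _ "g + h"]) (simp add: algebra_simps)
  next
    fix a r assume "\<exists>g. a - f * g \<in> I"
    then obtain g where "a - f * g \<in> I" by blast
    then show "\<exists>g. r * a - f * g \<in> I"
      using is_idealD(3)[OF assms(1), of "a - f * g" r]
      by (intro exI[of _ "r * g"]) (simp add: algebra_simps)
  qed
  moreover have "insert f I \<subseteq> {x. \<exists>g. x - f * g \<in> I}"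
  proof -
    have "f - f * 1 \<in> I" using is_idealD(1)[OF assms(1)] by simp
    moreover have "x - f * 0 \<in> I" if "x \<in> I" for x using that by simp
    ultimately show ?thesis by blast
  qed
  ultimately have "ideal_of (insert f I) \<subseteq> {x. \<exists>g. x - f * g \<in> I}"
    by (rule ideal_of_least)
  then show ?thesis using assms(2) that by blast
qed

lemma is_ideal_radical:
  assumes I: "is_ideal (I :: 'r::comm_ring_1 set)"
  shows "is_ideal {f. \<exists>n. f ^ n \<in> I}"
  unfolding is_ideal_def
proof (intro conjI ballI allI; simp only: mem_Collect_eq)
  show "\<exists>n. 0 ^ n \<in> I"
    using is_idealD(1)[OF I] by (intro exI[of _ 1]) simp
next
  fix a b :: 'r assume "\<exists>n. a ^ n \<in> I" "\<exists>n. b ^ n \<in> I"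
  then obtain m n where m: "a ^ m \<in> I" and n: "b ^ n \<in> I" by blast
  have sum_mem: "sum g S \<in> I" if "\<And>x. x \<in> S \<Longrightarrow> g x \<in> I" for g and S :: "nat set"
    using that by (induction S rule: infinite_finite_induct) (auto intro: is_idealD[OF I])
  have "(\<Sum>k\<le>m + n. of_nat ((m + n) choose k) * a ^ k * b ^ (m + n - k)) \<in> I"
  proof (rule sum_mem)
    fix k
    show "of_nat ((m + n) choose k) * a ^ k * b ^ (m + n - k) \<in> I"
    proof (cases "m \<le> k")
      case True
      then have "a ^ k = a ^ (k - m) * a ^ m" by (simp flip: power_add)
      then have "of_nat ((m + n) choose k) * a ^ k * b ^ (m + n - k) =
          (of_nat ((m + n) choose k) * a ^ (k - m) * b ^ (m + n - k)) * a ^ m"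
        by (simp add: algebra_simps)
      then show ?thesis using is_idealD(3)[OF I m] by simp
    next
      case False
      then have "b ^ (m + n - k) = b ^ (m - k) * b ^ n" by (simp flip: power_add)
      then have "of_nat ((m + n) choose k) * a ^ k * b ^ (m + n - k) =
          (of_nat ((m + n) choose k) * a ^ k * b ^ (m - k)) * b ^ n"
        by (simp add: algebra_simps)
      then show ?thesis using is_idealD(3)[OF I n] by simp
    qed
  qed
  then show "\<exists>n. (a + b) ^ n \<in> I"
    by (intro exI[of _ "m + n"]) (simp add: binomial_ring)
next
  fix a r :: 'r assume "\<exists>n. a ^ n \<in> I"
  then obtain n where "a ^ n \<in> I" by blast
  then show "\<exists>n. (r * a) ^ n \<in> I"
    by (intro exI[of _ n]) (simp add: power_mult_distrib is_idealD(3)[OF I])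
qed

text \<open>The alternating sum, over the positions of a list, of \<open>y\<close> at the deleted
  entry times \<open>z\<close> at the remaining list. Entries may repeat and \<open>z\<close> need
  not be alternating, so faces need no orientation. For constant \<open>y = 1\<close> this is the
  augmented simplicial coboundary; nothing maps into degree 0, hence the value at
  \<open>[]\<close>.\<close>

fun koszul_d :: "('a \<Rightarrow> 'r::comm_ring_1) \<Rightarrow> ('a list \<Rightarrow> 'r) \<Rightarrow> 'a list \<Rightarrow> 'r" where
  "koszul_d y z [] = 0"
| "koszul_d y z (v # vs) = y v * z vs - koszul_d y (\<lambda>ws. z (v # ws)) vs"

lemma koszul_d_add: "koszul_d y (\<lambda>ws. z ws + z' ws) vs = koszul_d y z vs + koszul_d y z' vs"
  by (induction vs arbitrary: z z') (simp_all add: algebra_simps)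

lemma koszul_d_diff: "koszul_d y (\<lambda>ws. z ws - z' ws) vs = koszul_d y z vs - koszul_d y z' vs"
  by (induction vs arbitrary: z z') (simp_all add: algebra_simps)

lemma koszul_d_scale: "koszul_d y (\<lambda>ws. c * z ws) vs = c * koszul_d y z vs"
  by (induction vs arbitrary: z) (simp_all add: algebra_simps)

lemma koszul_d_zero [simp]: "koszul_d y (\<lambda>ws. 0) vs = 0"
  by (induction vs) simp_all

lemma koszul_d_left_add: "koszul_d (\<lambda>v. y v + y' v) z vs = koszul_d y z vs + koszul_d y' z vs"
  by (induction vs arbitrary: z) (simp_all add: algebra_simps)

lemma koszul_d_left_scale: "koszul_d (\<lambda>v. c * y v) z vs = c * koszul_d y z vs"
  by (induction vs arbitrary: z) (simp_all add: algebra_simps)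

lemma koszul_d_left_zero: "\<forall>v\<in>set vs. y v = 0 \<Longrightarrow> koszul_d y z vs = 0"
  by (induction vs arbitrary: z) simp_all

lemma koszul_d_anticomm: "koszul_d y (koszul_d y' z) vs = - koszul_d y' (koszul_d y z) vs"
  by (induction vs arbitrary: z) (simp_all add: koszul_d_diff koszul_d_scale)

lemma koszul_d_square [simp]: "koszul_d y (koszul_d y z) vs = 0"
  by (induction vs arbitrary: z) (simp_all add: koszul_d_diff koszul_d_scale)

lemma koszul_d_mem:
  assumes "is_ideal I" "\<forall>vs. length vs = n \<longrightarrow> z vs \<in> I" "length vs = Suc n"
  shows "koszul_d y z vs \<in> I"
  using assms(2,3)
proof (induction vs arbitrary: n z)
  case (Cons v vs)
  show ?case
  proof (cases n)
    case 0
    then show ?thesis using Cons.prems is_idealD(3)[OF assms(1)] by simp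
  next
    case (Suc m)
    have "koszul_d y (\<lambda>ws. z (v # ws)) vs \<in> I"
      using Cons.prems Suc by (intro Cons.IH[of m]) auto
    then show ?thesis using Cons.prems Suc assms(1) by (auto intro!: is_idealD)
  qed
qed simp

text \<open>Regularity is peeled off from the front because the induction in
  \<open>koszul_exact\<close> passes from \<open>I\<close> to the ideal generated by
  \<open>I\<close> and the first element.\<close>

fun weak_regular :: "'r::comm_ring_1 set \<Rightarrow> 'r list \<Rightarrow> bool" where
  "weak_regular I [] \<longleftrightarrow> True"
| "weak_regular I (f # fs) \<longleftrightarrow> (\<forall>g. g * f \<in> I \<longrightarrow> g \<in> I) \<and> weak_regular (ideal_of (insert f I)) fs"

lemma weak_regular_of_nth:
  assumes "is_ideal I"
    and "\<forall>i<length fs. \<forall>g. g * fs ! i \<in> ideal_of (I \<union> set (take i fs)) \<longrightarrow>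
      g \<in> ideal_of (I \<union> set (take i fs))"
  shows "weak_regular I fs"
  using assms
proof (induction fs arbitrary: I)
  case (Cons f fs)
  have "\<forall>g. g * f \<in> I \<longrightarrow> g \<in> I"
    using Cons.prems(2)[rule_format, of 0] ideal_of_ideal[OF Cons.prems(1)] by simp
  moreover have "weak_regular (ideal_of (insert f I)) fs"
  proof (rule Cons.IH[OF is_ideal_ideal_of], intro allI impI)
    fix i g
    assume i: "i < length fs"
      and g: "g * fs ! i \<in> ideal_of (ideal_of (insert f I) \<union> set (take i fs))"
    have eq: "ideal_of (ideal_of (insert f I) \<union> set (take i fs)) =
        ideal_of (I \<union> set (take (Suc i) (f # fs)))"
      by (simp add: ideal_of_Un_ideal_of)
    show "g \<in> ideal_of (ideal_of (insert f I) \<union> set (take i fs))"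
      using Cons.prems(2)[rule_format, of "Suc i" g] i g unfolding eq by simp
  qed
  ultimately show ?case by simp
qed simp

text \<open>Two opposing facts. Prepending \<open>v\<close> to lists is a homotopy for
  multiplication by \<open>y v\<close>, so the ideal of the \<open>y v\<close>, and with it a power
  of \<open>f\<close>, kills all cohomology modulo \<open>I\<close>. But \<open>f\<close> acts
  injectively in degree \<open>i\<close>, by the induction hypothesis for \<open>(I, f)\<close> in
  degree \<open>i - 1\<close>. So every cocycle is a coboundary.\<close>

theorem koszul_exact:
  fixes I :: "'r::comm_ring_1 set" and y :: "'a \<Rightarrow> 'r"
  assumes "is_ideal I" "weak_regular I fs"
    and "\<forall>f\<in>set fs. \<exists>n. f ^ n \<in> ideal_of (range y)"
    and "i < length fs"
    and "\<forall>vs. length vs = Suc i \<longrightarrow> koszul_d y z vs \<in> I"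
  shows "\<exists>u. \<forall>vs. length vs = i \<longrightarrow> z vs - koszul_d y u vs \<in> I"
  using assms
proof (induction fs arbitrary: I i z)
  case (Cons f fs)
  note I = Cons.prems(1)
  have reg: "g \<in> I" if "f * g \<in> I" for g
    using Cons.prems(2) that by (simp add: mult.commute)
  \<comment> \<open>If \<open>f z\<close> is the coboundary of \<open>w\<close> modulo
    \<open>I\<close>, then \<open>w\<close> is a cocycle modulo \<open>(I, f)\<close>, hence a
    coboundary plus some \<open>f t\<close>; cancelling \<open>f\<close> leaves \<open>z\<close> as
    the coboundary of \<open>t\<close>.\<close>
  have inj: "\<exists>u. \<forall>vs. length vs = i \<longrightarrow> z vs - koszul_d y u vs \<in> I"
    if z: "\<forall>vs. length vs = i \<longrightarrow> f * z vs - koszul_d y w vs \<in> I" for z w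
  proof (cases i)
    case 0
    then show ?thesis using z reg by simp
  next
    case (Suc j)
    let ?I' = "ideal_of (insert f I)"
    have f: "f \<in> ?I'" and sub: "I \<subseteq> ?I'" using subset_ideal_of by blast+
    have "koszul_d y w vs \<in> ?I'" if "length vs = Suc j" for vs
    proof -
      have "f * z vs - koszul_d y w vs \<in> ?I'" using z that Suc sub by auto
      moreover have "f * z vs \<in> ?I'"
        using is_idealD(3)[OF is_ideal_ideal_of f, of "z vs"] by (simp add: mult.commute)
      ultimately have "f * z vs - (f * z vs - koszul_d y w vs) \<in> ?I'"
        using is_idealD(5)[OF is_ideal_ideal_of] by blast
      then show ?thesis by simp
    qed
    then have "\<exists>u. \<forall>vs. length vs = j \<longrightarrow> w vs - koszul_d y u vs \<in> ?I'"
      using Cons.prems Suc by (intro Cons.IH is_ideal_ideal_of) auto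
    then obtain u where u: "\<forall>vs. length vs = j \<longrightarrow> w vs - koszul_d y u vs \<in> ?I'" by blast
    have "\<forall>vs. \<exists>g. length vs = j \<longrightarrow> w vs - koszul_d y u vs - f * g \<in> I"
      using u ideal_of_insert_ideal[OF I] by metis
    then obtain t where t: "\<forall>vs. length vs = j \<longrightarrow> w vs - koszul_d y u vs - f * t vs \<in> I" by metis
    have "z vs - koszul_d y t vs \<in> I" if "length vs = i" for vs
    proof (rule reg)
      have "koszul_d y (\<lambda>vs. w vs - koszul_d y u vs - f * t vs) vs \<in> I"
        using koszul_d_mem[OF I t, of vs y] that Suc by simp
      then have "koszul_d y w vs - f * koszul_d y t vs \<in> I"
        by (simp add: koszul_d_diff koszul_d_scale)
      then have "(f * z vs - koszul_d y w vs) + (koszul_d y w vs - f * koszul_d y t vs) \<in> I"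
        using z that is_idealD(2)[OF I] by blast
      then show "f * (z vs - koszul_d y t vs) \<in> I" by (simp add: algebra_simps)
    qed
    then show ?thesis by blast
  qed
  \<comment> \<open>The annihilator of the class of \<open>z\<close>; the cocycle condition at
    \<open>v # vs\<close> puts every \<open>y v\<close> into it.\<close>
  let ?K = "{g. \<exists>w. \<forall>vs. length vs = i \<longrightarrow> g * z vs - koszul_d y w vs \<in> I}"
  have "is_ideal ?K"
    unfolding is_ideal_def
  proof (intro conjI ballI allI; simp only: mem_Collect_eq)
    show "\<exists>w. \<forall>vs. length vs = i \<longrightarrow> 0 * z vs - koszul_d y w vs \<in> I"
      using is_idealD(1)[OF I] by (intro exI[of _ "\<lambda>_. 0"]) simp
  next
    fix a b
    assume "\<exists>w. \<forall>vs. length vs = i \<longrightarrow> a * z vs - koszul_d y w vs \<in> I"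
      and "\<exists>w. \<forall>vs. length vs = i \<longrightarrow> b * z vs - koszul_d y w vs \<in> I"
    then obtain w w' where w: "\<forall>vs. length vs = i \<longrightarrow> a * z vs - koszul_d y w vs \<in> I"
      and w': "\<forall>vs. length vs = i \<longrightarrow> b * z vs - koszul_d y w' vs \<in> I" by blast
    have "(a + b) * z vs - koszul_d y (\<lambda>vs. w vs + w' vs) vs \<in> I" if "length vs = i" for vs
    proof -
      have "(a * z vs - koszul_d y w vs) + (b * z vs - koszul_d y w' vs) \<in> I"
        using w w' that is_idealD(2)[OF I] by blast
      then show ?thesis by (simp add: koszul_d_add algebra_simps)
    qed
    then show "\<exists>w. \<forall>vs. length vs = i \<longrightarrow> (a + b) * z vs - koszul_d y w vs \<in> I" by blast
  next
    fix a r
    assume "\<exists>w. \<forall>vs. length vs = i \<longrightarrow> a * z vs - koszul_d y w vs \<in> I"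
    then obtain w where w: "\<forall>vs. length vs = i \<longrightarrow> a * z vs - koszul_d y w vs \<in> I" by blast
    have "(r * a) * z vs - koszul_d y (\<lambda>vs. r * w vs) vs \<in> I" if "length vs = i" for vs
    proof -
      have "r * (a * z vs - koszul_d y w vs) \<in> I"
        using w that is_idealD(3)[OF I] by blast
      then show ?thesis by (simp add: koszul_d_scale algebra_simps)
    qed
    then show "\<exists>w. \<forall>vs. length vs = i \<longrightarrow> r * a * z vs - koszul_d y w vs \<in> I" by blast
  qed
  moreover have "range y \<subseteq> ?K"
  proof clarsimp
    fix v
    have "y v * z vs - koszul_d y (\<lambda>ws. z (v # ws)) vs \<in> I" if "length vs = i" for vs
      using Cons.prems(5)[rule_format, of "v # vs"] that by simp
    then show "\<exists>w. \<forall>vs. length vs = i \<longrightarrow> y v * z vs - koszul_d y w vs \<in> I" by blast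
  qed
  ultimately have "ideal_of (range y) \<subseteq> ?K" by (rule ideal_of_least)
  moreover obtain n where "f ^ n \<in> ideal_of (range y)" using Cons.prems(3) by auto
  ultimately obtain w where "\<forall>vs. length vs = i \<longrightarrow> f ^ n * z vs - koszul_d y w vs \<in> I" by blast
  then show ?case
  proof (induction n arbitrary: w)
    case 0
    then show ?case by auto
  next
    case (Suc n)
    then have "\<forall>vs. length vs = i \<longrightarrow> f * (f ^ n * z vs) - koszul_d y w vs \<in> I"
      by (simp add: mult.assoc)
    from inj[OF this] obtain u where "\<forall>vs. length vs = i \<longrightarrow> f ^ n * z vs - koszul_d y u vs \<in> I"
      by blast
    then show ?case by (rule Suc.IH)
  qed
qed simp

section \<open>Cohomology of links in the independence complex\<close>

abbreviation "lookup \<equiv> Poly_Mapping.lookup"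
abbreviation "keys \<equiv> Poly_Mapping.keys"

lemma lookup_monom_mult_add:
  "lookup (Poly_Mapping.single s c * g) (s + t) = c * lookup g (t :: 'a \<Rightarrow>\<^sub>0 nat)"
  for g :: "('a, 'k::comm_ring_1) mpoly"
  by (simp add: lookup_mult lookup_single when_mult)

lemma lookup_monom_mult_zero:
  "(\<And>t. m \<noteq> s + t) \<Longrightarrow> lookup (Poly_Mapping.single s c * g) m = 0"
  for g :: "('a, 'k::comm_ring_1) mpoly"
  by (simp add: lookup_mult lookup_single when_mult)

lemma is_ideal_keys_upward:
  assumes "\<And>a b. a \<in> U \<Longrightarrow> a + b \<in> U"
  shows "is_ideal {p :: ('a, 'k::comm_ring_1) mpoly. keys p \<subseteq> U}"
  unfolding is_ideal_def
proof (intro conjI ballI allI; simp only: mem_Collect_eq)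
  show "keys 0 \<subseteq> U" by simp
next
  fix p q :: "('a, 'k) mpoly" assume "keys p \<subseteq> U" "keys q \<subseteq> U"
  then show "keys (p + q) \<subseteq> U" using keys_add[of p q] by blast
next
  fix p r :: "('a, 'k) mpoly" assume p: "keys p \<subseteq> U"
  show "keys (r * p) \<subseteq> U"
  proof
    fix m assume "m \<in> keys (r * p)"
    then obtain a b where "m = a + b" "b \<in> keys p" using keys_mult[of r p] by blast
    then show "m \<in> U" using p assms[of b a] by (auto simp: add.commute)
  qed
qed

lemma var_power: "var v ^ n = (monom (Poly_Mapping.single v n) :: ('a, 'k::comm_ring_1) mpoly)"
proof (induction n)
  case 0
  then show ?case by (simp add: monom_def)
next
  case (Suc n)
  then show ?case by (simp add: monom_def var_def mult_single flip: single_add)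
qed

lemma max_ideal_power_mem:
  assumes "f \<in> (max_ideal :: ('a, 'k::comm_ring_1) mpoly set)"
  shows "\<exists>n. f ^ n \<in> ideal_of (range (\<lambda>v. monom (Poly_Mapping.single v 2)))"
proof -
  let ?J = "ideal_of (range (\<lambda>v. monom (Poly_Mapping.single v 2))) :: ('a, 'k) mpoly set"
  have "range var \<subseteq> {f. \<exists>n. f ^ n \<in> ?J}"
  proof clarsimp
    fix v :: 'a
    have "var v ^ 2 \<in> ?J" unfolding var_power using subset_ideal_of by fastforce
    then show "\<exists>n. var v ^ n \<in> ?J" by blast
  qed
  then have "max_ideal \<subseteq> {f. \<exists>n. f ^ n \<in> ?J}"
    unfolding max_ideal_def by (intro ideal_of_least is_ideal_radical is_ideal_ideal_of)
  then show ?thesis using assms by blast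
qed

definition indep :: "'a set set \<Rightarrow> 'a set \<Rightarrow> bool" where
  "indep E F \<longleftrightarrow> (\<forall>u\<in>F. \<forall>v\<in>F. \<not> adj E u v)"

text \<open>Together with \<open>single_mem_edge_ideal\<close>: the monomials that survive modulo
  the edge ideal are those supported on faces of the independence complex.\<close>

lemma edge_ideal_subset:
  "edge_ideal E \<subseteq> {p :: ('a, 'k::comm_ring_1) mpoly. keys p \<subseteq> {m. \<not> indep E (keys m)}}"
  unfolding edge_ideal_def
proof (rule ideal_of_least[OF is_ideal_keys_upward])
  fix a b :: "'a \<Rightarrow>\<^sub>0 nat"
  have "keys a \<subseteq> keys (a + b)" by (auto simp: in_keys_iff lookup_add)
  then show "a \<in> {m. \<not> indep E (keys m)} \<Longrightarrow> a + b \<in> {m. \<not> indep E (keys m)}"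
    unfolding indep_def by blast
next
  have "\<not> indep E (keys (Poly_Mapping.single u 1 + Poly_Mapping.single v (1::nat)))"
    if "{u, v} \<in> E" for u v
  proof -
    have "u \<in> keys (Poly_Mapping.single u 1 + Poly_Mapping.single v (1::nat))"
      "v \<in> keys (Poly_Mapping.single u 1 + Poly_Mapping.single v (1::nat))"
      by (simp_all add: in_keys_iff lookup_add)
    then show ?thesis using that unfolding indep_def adj_def by blast
  qed
  then show "{var u * var v |u v. {u, v} \<in> E} \<subseteq> {p :: ('a, 'k) mpoly. keys p \<subseteq> {m. \<not> indep E (keys m)}}"
    by (auto simp: var_def monom_def mult_single)
qed

lemma single_mem_edge_ideal:
  assumes "simple_graph E" "\<not> indep E (keys m)"
  shows "Poly_Mapping.single m c \<in> (edge_ideal E :: ('a, 'k::comm_ring_1) mpoly set)"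
proof -
  obtain u v where uv: "u \<in> keys m" "v \<in> keys m" "{u, v} \<in> E"
    using assms(2) by (auto simp: indep_def adj_def)
  then have "u \<noteq> v" using assms(1) by (auto simp: simple_graph_def)
  define t where "t = m - Poly_Mapping.single u 1 - Poly_Mapping.single v 1"
  have "m = t + (Poly_Mapping.single u 1 + Poly_Mapping.single v 1)"
    using uv \<open>u \<noteq> v\<close> unfolding t_def
    by (intro poly_mapping_eqI) (auto simp: lookup_add lookup_minus lookup_single when_def in_keys_iff)
  then have "Poly_Mapping.single m c = Poly_Mapping.single t c * (var u * var v :: ('a, 'k) mpoly)"
    by (simp add: var_def monom_def mult_single)
  moreover have "var u * var v \<in> (edge_ideal E :: ('a, 'k) mpoly set)"
    unfolding edge_ideal_def using uv(3) by (intro subsetD[OF subset_ideal_of]) blast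
  ultimately show ?thesis
    unfolding edge_ideal_def by (simp add: is_idealD(3)[OF is_ideal_ideal_of])
qed

text \<open>Exterior multiplication by the basis vectors of \<open>Fs\<close>, written as Koszul differentials of indicator
  functions, so that no explicit signs of permutations are needed.\<close>

definition wedge :: "'a list \<Rightarrow> ('a list \<Rightarrow> 'r::comm_ring_1) \<Rightarrow> 'a list \<Rightarrow> 'r" where
  "wedge Fs c = foldr (\<lambda>f. koszul_d (\<lambda>v. of_bool (v = f))) Fs c"

lemma wedge_simps [simp]:
  "wedge [] c = c"
  "wedge (f # Fs) c = koszul_d (\<lambda>v. of_bool (v = f)) (wedge Fs c)"
  by (simp_all add: wedge_def)

lemma koszul_d_wedge: "koszul_d y (wedge Fs c) vs = (- 1) ^ length Fs * wedge Fs (koszul_d y c) vs"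
proof (induction Fs arbitrary: vs)
  case (Cons f Fs)
  have "koszul_d y (wedge (f # Fs) c) vs =
      - koszul_d (\<lambda>v. of_bool (v = f)) (koszul_d y (wedge Fs c)) vs"
    by (simp add: koszul_d_anticomm[of y])
  also have "koszul_d y (wedge Fs c) = (\<lambda>vs. (- 1) ^ length Fs * wedge Fs (koszul_d y c) vs)"
    using Cons.IH by (rule ext)
  finally show ?case by (simp add: koszul_d_scale)
qed simp

text \<open>A repeated exterior factor gives 0. The component of \<open>y\<close> at
  \<open>f\<close> dies by \<open>koszul_d_square\<close>; the others pass \<open>f\<close> by
  anticommutation and die by induction.\<close>

lemma koszul_d_wedge_support:
  assumes "\<forall>v. v \<notin> set Fs \<longrightarrow> y v = 0"
  shows "koszul_d y (wedge Fs c) vs = 0"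
  using assms
proof (induction Fs arbitrary: y vs)
  case Nil
  then show ?case by (auto intro: koszul_d_left_zero)
next
  case (Cons f Fs)
  let ?d = "\<lambda>v. of_bool (v = f)"
  define y' where "y' v = (if v \<in> set Fs then y v else 0)" for v
  define a where "a = (if f \<in> set Fs then 0 else y f)"
  have y: "y = (\<lambda>v. a * ?d v + y' v)"
    using Cons.prems by (auto simp: y'_def a_def fun_eq_iff)
  have "koszul_d y' (wedge Fs c) = (\<lambda>vs. 0)"
    by (intro ext Cons.IH) (simp add: y'_def)
  then have "koszul_d y' (koszul_d ?d (wedge Fs c)) vs = 0"
    by (subst koszul_d_anticomm) simp
  moreover have "koszul_d y (wedge (f # Fs) c) vs =
      a * koszul_d ?d (koszul_d ?d (wedge Fs c)) vs + koszul_d y' (koszul_d ?d (wedge Fs c)) vs"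
    unfolding y koszul_d_left_add koszul_d_left_scale wedge_simps ..
  ultimately show ?case by simp
qed

lemma wedge_mem:
  assumes "is_ideal I" "\<forall>ws. length ws = n \<longrightarrow> c ws \<in> I" "length vs = length Fs + n"
  shows "wedge Fs c vs \<in> I"
  using assms(3)
proof (induction Fs arbitrary: vs)
  case (Cons f Fs)
  then show ?case by (auto intro!: koszul_d_mem[OF assms(1), where n = "length Fs + n"])
qed (use assms in simp)

text \<open>Only the deletion of the leading entry contributes, since no later entry equals it;
  hence no sign.\<close>

lemma wedge_eval:
  "distinct Fs \<Longrightarrow> set ws \<inter> set Fs = {} \<Longrightarrow> wedge Fs c (Fs @ ws) = c ws"
proof (induction Fs)
  case (Cons f Fs)
  have "koszul_d (\<lambda>v. of_bool (v = f)) (\<lambda>us. wedge Fs c (f # us)) (Fs @ ws) = 0"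
    using Cons.prems by (intro koszul_d_left_zero) auto
  then show ?case using Cons by simp
qed simp

section \<open>Cochains concentrated in a single multidegree\<close>

definition sq_exp :: "'a list \<Rightarrow> 'a \<Rightarrow>\<^sub>0 nat" where
  "sq_exp ws = (\<Sum>w\<leftarrow>ws. Poly_Mapping.single w 2)"

lemma sq_exp_simps [simp]: "sq_exp [] = 0" "sq_exp (w # ws) = Poly_Mapping.single w 2 + sq_exp ws"
  by (simp_all add: sq_exp_def)

lemma keys_sq_exp: "keys (sq_exp ws) = set ws"
proof -
  have "lookup (sq_exp ws) v = 2 * count_list ws v" for v
    by (induction ws) (auto simp: lookup_add lookup_single when_def)
  then show ?thesis by (auto simp: in_keys_iff count_list_0_iff)
qed

text \<open>Deleting \<open>v\<close> lowers the exponent at \<open>v\<close> by 2 and the square of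
  the variable restores it, so the differential acts on coefficients as the simplicial
  coboundary.\<close>

lemma koszul_d_monomials:
  fixes g :: "'a list \<Rightarrow> 'k::comm_ring_1" and F :: "'a set"
  defines "y' \<equiv> \<lambda>v. if v \<in> F then 0 else (monom (Poly_Mapping.single v 2) :: ('a, 'k) mpoly)"
  shows "koszul_d y' (\<lambda>ws. if set ws \<inter> F = {} then Poly_Mapping.single (a + sq_exp ws) (g ws) else 0) ws =
    (if set ws \<inter> F = {} then Poly_Mapping.single (a + sq_exp ws) (koszul_d (\<lambda>_. 1) g ws) else 0)"
proof (induction ws arbitrary: a g)
  case (Cons v ws)
  show ?case
  proof (cases "v \<in> F")
    case True
    then show ?thesis by (simp add: y'_def)
  next
    case False
    have "(\<lambda>ws. if set (v # ws) \<inter> F = {} then Poly_Mapping.single (a + sq_exp (v # ws)) (g (v # ws)) else 0) =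
        (\<lambda>ws. if set ws \<inter> F = {} then Poly_Mapping.single ((a + Poly_Mapping.single v 2) + sq_exp ws) (g (v # ws)) else 0)"
      using False by (auto simp: add.assoc)
    then have "koszul_d y' (\<lambda>ws. if set (v # ws) \<inter> F = {} then Poly_Mapping.single (a + sq_exp (v # ws)) (g (v # ws)) else 0) ws =
        (if set ws \<inter> F = {} then Poly_Mapping.single (a + Poly_Mapping.single v 2 + sq_exp ws) (koszul_d (\<lambda>_. 1) (\<lambda>ws. g (v # ws)) ws) else 0)"
      by (simp only: Cons.IH)
    then show ?thesis using False
      by (simp only: koszul_d.simps) (auto simp: y'_def monom_def mult_single single_diff ac_simps)
  qed
qed simp

text \<open>Deleting an entry \<open>f\<close> of \<open>Fs\<close> yields a multiple of the square
  of its variable, in which \<open>m\<close> cannot occur. The deletions behind \<open>Fs\<close>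
  remain, with the sign for passing \<open>Fs\<close>.\<close>

lemma lookup_koszul_d_append:
  fixes u :: "'a list \<Rightarrow> ('a, 'k::comm_ring_1) mpoly"
  defines "y \<equiv> \<lambda>v. monom (Poly_Mapping.single v 2)"
  assumes "\<forall>f\<in>set Fs. lookup m f < 2"
  shows "lookup (koszul_d y u (Fs @ ws)) m =
    (- 1) ^ length Fs * lookup (koszul_d y (\<lambda>vs. u (Fs @ vs)) ws) m"
  using assms(2)
proof (induction Fs arbitrary: u)
  case (Cons f Fs)
  have "lookup (y f * u (Fs @ ws)) m = 0"
    unfolding y_def monom_def
  proof (rule lookup_monom_mult_zero)
    show "m \<noteq> Poly_Mapping.single f 2 + t" for t
      using Cons.prems by (auto simp: lookup_add)
  qed
  then show ?case using Cons by (simp add: lookup_minus)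
qed simp

lemma lookup_koszul_d_sq_exp:
  fixes u :: "'a list \<Rightarrow> ('a, 'k::comm_ring_1) mpoly"
  shows "lookup (koszul_d (\<lambda>v. monom (Poly_Mapping.single v 2)) u ws) (a + sq_exp ws) =
    koszul_d (\<lambda>_. 1) (\<lambda>vs. lookup (u vs) (a + sq_exp vs)) ws"
proof (induction ws arbitrary: a u)
  case (Cons w ws)
  have eq: "a + sq_exp (w # ws) = Poly_Mapping.single w 2 + (a + sq_exp ws)"
    "a + sq_exp (w # ws) = (a + Poly_Mapping.single w 2) + sq_exp ws"
    by (simp_all add: ac_simps)
  have "lookup (monom (Poly_Mapping.single w 2) * u ws) (a + sq_exp (w # ws)) = lookup (u ws) (a + sq_exp ws)"
    unfolding eq(1) monom_def lookup_monom_mult_add by simp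
  moreover have "lookup (koszul_d (\<lambda>v. monom (Poly_Mapping.single v 2)) (\<lambda>vs. u (w # vs)) ws) (a + sq_exp (w # ws)) =
      koszul_d (\<lambda>_. 1) (\<lambda>vs. lookup (u (w # vs)) ((a + Poly_Mapping.single w 2) + sq_exp vs)) ws"
    unfolding eq(2) by (rule Cons.IH)
  ultimately show ?case by (simp add: lookup_minus add.assoc)
qed simp

text \<open>One half of Reisner's criterion. Cochains are functions on lists of vertices that need not be
  alternating.\<close>

theorem link_cocycle_is_coboundary:
  fixes E :: "'a::finite set set" and g :: "'a list \<Rightarrow> 'k::field"
  assumes "simple_graph E" "regular_seq (edge_ideal E :: ('a, 'k) mpoly set) max_ideal fs"
    and "indep E F" "card F + j < length fs"
    and cocycle: "\<And>ws. length ws = Suc j \<Longrightarrow> set ws \<inter> F = {} \<Longrightarrow> indep E (F \<union> set ws) \<Longrightarrow>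
      koszul_d (\<lambda>_. 1) g ws = 0"
  obtains h where "\<And>ws. length ws = j \<Longrightarrow> set ws \<inter> F = {} \<Longrightarrow> indep E (F \<union> set ws) \<Longrightarrow>
      g ws = koszul_d (\<lambda>_. 1) h ws"
proof -
  let ?I = "edge_ideal E :: ('a, 'k) mpoly set"
  have I: "is_ideal ?I" unfolding edge_ideal_def by (rule is_ideal_ideal_of)
  define y :: "'a \<Rightarrow> ('a, 'k) mpoly" where "y = (\<lambda>v. monom (Poly_Mapping.single v 2))"
  obtain Fs where Fs: "set Fs = F" "distinct Fs" using finite_distinct_list[of F] by auto
  then have len: "length Fs = card F" using distinct_card by force
  \<comment> \<open>Multidegree -1 on \<open>F\<close> plus 2 from the exterior factors.\<close>
  define a :: "'a \<Rightarrow>\<^sub>0 nat" where "a = (\<Sum>f\<in>F. Poly_Mapping.single f 1)"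
  have lookup_a: "lookup a v = of_bool (v \<in> F)" for v
    by (simp add: a_def lookup_sum lookup_single when_def of_bool_def)
  have keys_a: "keys (a + sq_exp ws) = F \<union> set ws" for ws
    using keys_sq_exp[of ws] by (auto simp: in_keys_iff lookup_add lookup_a set_eq_iff)
  define c where "c ws = (if set ws \<inter> F = {} then Poly_Mapping.single (a + sq_exp ws) (g ws) else 0)" for ws
  define y' where "y' v = (if v \<in> F then 0 else y v)" for v
  define z where "z = wedge Fs c"
  \<comment> \<open>The part of \<open>y\<close> on \<open>F\<close> is killed by the exterior
    factors, so only \<open>y'\<close> acts on \<open>c\<close>.\<close>
  have y_split: "y = (\<lambda>v. (if v \<in> F then y v else 0) + y' v)" by (auto simp: y'_def)
  have "koszul_d y z vs \<in> ?I" if "length vs = Suc (card F + j)" for vs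
  proof -
    have "koszul_d y z vs = koszul_d y' z vs"
      by (subst y_split)
        (simp add: koszul_d_left_add z_def koszul_d_wedge_support Fs(1))
    also have "\<dots> = (- 1) ^ length Fs * wedge Fs (koszul_d y' c) vs"
      by (simp add: z_def koszul_d_wedge)
    also have "\<dots> \<in> ?I"
    proof (intro is_idealD(3)[OF I] wedge_mem[OF I, of "Suc j"] allI impI)
      fix ws :: "'a list" assume ws: "length ws = Suc j"
      have "koszul_d y' c ws = (if set ws \<inter> F = {} then Poly_Mapping.single (a + sq_exp ws) (koszul_d (\<lambda>_. 1) g ws) else 0)"
        using koszul_d_monomials[of F a g ws] unfolding y'_def y_def c_def by simp
      moreover have "Poly_Mapping.single (a + sq_exp ws) (koszul_d (\<lambda>_. 1) g ws) \<in> ?I" if "set ws \<inter> F = {}"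
      proof (cases "indep E (F \<union> set ws)")
        case True
        then show ?thesis using cocycle[OF ws that] is_idealD(1)[OF I] by simp
      next
        case False
        then show ?thesis using single_mem_edge_ideal[OF assms(1)] keys_a by metis
      qed
      ultimately show "koszul_d y' c ws \<in> ?I" using is_idealD(1)[OF I] by simp
    qed (use that len in simp)
    finally show ?thesis .
  qed
  moreover have "weak_regular ?I fs"
    using assms(2) by (intro weak_regular_of_nth[OF I]) (simp add: regular_seq_def)
  moreover have "\<forall>f\<in>set fs. \<exists>n. f ^ n \<in> ideal_of (range y)"
    using assms(2) max_ideal_power_mem unfolding regular_seq_def y_def by blast
  ultimately obtain u where u: "\<And>vs. length vs = card F + j \<Longrightarrow> z vs - koszul_d y u vs \<in> ?I"
    using koszul_exact[OF I, of fs y "card F + j" z] assms(4) by blast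
  \<comment> \<open>The coefficient of \<open>u\<close> in the same multidegree; the sign undoes the
    one from moving the differential past \<open>Fs\<close>.\<close>
  define h where "h ws = (- 1) ^ card F * lookup (u (Fs @ ws)) (a + sq_exp ws)" for ws
  have "g ws = koszul_d (\<lambda>_. 1) h ws"
    if ws: "length ws = j" "set ws \<inter> F = {}" "indep E (F \<union> set ws)" for ws
  proof -
    let ?m = "a + sq_exp ws"
    have z: "z (Fs @ ws) = Poly_Mapping.single ?m (g ws)"
      using wedge_eval[OF Fs(2), of ws c] ws(2) Fs(1) by (simp add: z_def c_def)
    \<comment> \<open>The support of \<open>?m\<close> is a face, so \<open>?m\<close> occurs in no
      member of the ideal, and the congruence becomes an equality of coefficients.\<close>
    have "?m \<notin> keys (z (Fs @ ws) - koszul_d y u (Fs @ ws))"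
      using u[of "Fs @ ws"] edge_ideal_subset[of E] ws len keys_a[of ws] by (auto dest!: subsetD)
    then have "g ws = lookup (koszul_d y u (Fs @ ws)) ?m"
      using z by (simp add: in_keys_iff lookup_minus)
    also have "\<dots> = (- 1) ^ card F * lookup (koszul_d y (\<lambda>vs. u (Fs @ vs)) ws) ?m"
    proof -
      have "lookup (sq_exp ws) f = 0" if "f \<in> F" for f
        using keys_sq_exp[of ws] ws(2) that by (auto simp: in_keys_iff set_eq_iff)
      then have "\<forall>f\<in>set Fs. lookup ?m f < 2" using Fs by (simp add: lookup_add lookup_a)
      then show ?thesis unfolding y_def using lookup_koszul_d_append[of Fs ?m u ws] len by simp
    qed
    also have "\<dots> = koszul_d (\<lambda>_. 1) h ws"
      unfolding h_def y_def by (simp add: lookup_koszul_d_sq_exp koszul_d_scale)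
    finally show ?thesis .
  qed
  then show ?thesis by (rule that)
qed

section \<open>Consequences of Cohen-Macaulayness\<close>

text \<open>Maximise one coordinate after another in both sets: a sum of the two maxima forces each
  summand to attain its own. This plays the role of leading terms in the proof that coordinate
  ideals are prime.\<close>

lemma unique_sum_pair:
  fixes A B :: "('a \<Rightarrow>\<^sub>0 nat) set"
  assumes "finite V" "finite A" "A \<noteq> {}" "finite B" "B \<noteq> {}"
  shows "\<exists>a\<in>A. \<exists>b\<in>B. \<forall>a'\<in>A. \<forall>b'\<in>B. a' + b' = a + b \<longrightarrow>
    (\<forall>v\<in>V. lookup a' v = lookup a v \<and> lookup b' v = lookup b v)"
  using assms
proof (induction V arbitrary: A B)
  case empty
  then show ?case by auto
next
  case (insert v V)
  define m where "m = Max ((\<lambda>a. lookup a v) ` A)"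
  define n where "n = Max ((\<lambda>b. lookup b v) ` B)"
  define A' where "A' = {a \<in> A. lookup a v = m}"
  define B' where "B' = {b \<in> B. lookup b v = n}"
  have "m \<in> (\<lambda>a. lookup a v) ` A" "n \<in> (\<lambda>b. lookup b v) ` B"
    unfolding m_def n_def using insert.prems by (auto intro!: Max_in)
  then have "A' \<noteq> {}" "B' \<noteq> {}" by (auto simp: A'_def B'_def)
  moreover have "finite A'" "finite B'" using insert.prems by (auto simp: A'_def B'_def)
  ultimately obtain a b where ab: "a \<in> A'" "b \<in> B'" "\<And>a' b'. a' \<in> A' \<Longrightarrow> b' \<in> B' \<Longrightarrow> a' + b' = a + b \<Longrightarrow>
      (\<forall>v\<in>V. lookup a' v = lookup a v \<and> lookup b' v = lookup b v)"
    using insert.IH[of A' B'] by blast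
  have "\<forall>w\<in>insert v V. lookup a' w = lookup a w \<and> lookup b' w = lookup b w"
    if a': "a' \<in> A" and b': "b' \<in> B" and eq: "a' + b' = a + b" for a' b'
  proof -
    have "lookup a' v \<le> m" "lookup b' v \<le> n"
      unfolding m_def n_def using insert.prems a' b' by auto
    moreover have "lookup a' v + lookup b' v = m + n"
      using arg_cong[OF eq, of "\<lambda>x. lookup x v"] ab(1,2) by (simp add: lookup_add A'_def B'_def)
    ultimately have "lookup a' v = m" "lookup b' v = n" by auto
    moreover from this have "a' \<in> A'" "b' \<in> B'" using a' b' by (auto simp: A'_def B'_def)
    then have "\<forall>v\<in>V. lookup a' v = lookup a v \<and> lookup b' v = lookup b v"
      using ab(3) eq by blast
    moreover have "lookup a v = m" "lookup b v = n" using ab(1,2) by (simp_all add: A'_def B'_def)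
    ultimately show ?thesis by simp
  qed
  moreover have "a \<in> A" "b \<in> B" using ab(1,2) by (simp_all add: A'_def B'_def)
  ultimately show ?case by blast
qed

lemma lookup_mult_unique:
  fixes p q :: "('a, 'k::comm_ring_1) mpoly"
  assumes "\<And>a' b'. a' \<in> keys p \<Longrightarrow> b' \<in> keys q \<Longrightarrow> a' + b' = a + b \<Longrightarrow> a' = a"
  shows "lookup (p * q) (a + b) = lookup p a * lookup q b"
proof -
  have "lookup p l * (\<Sum>r. lookup q r when a + b = l + r) =
      (lookup p a * lookup q b when l = a)" for l
  proof (cases "l = a")
    case True
    then show ?thesis by simp
  next
    case False
    then have "lookup p l = 0 \<or> (\<forall>r. (lookup q r when a + b = l + r) = 0)"
      using assms[of l] by (auto simp: when_def in_keys_iff) metis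
    then show ?thesis using False by auto
  qed
  then show ?thesis by (simp add: lookup_mult)
qed

text \<open>The prime ideal generated by the variables outside \<open>W\<close>, described by the
  monomials that may occur in its members.\<close>

definition coord_ideal :: "'a set \<Rightarrow> ('a, 'k::comm_ring_1) mpoly set" where
  "coord_ideal W = {p. keys p \<subseteq> {m. \<not> keys m \<subseteq> W}}"

lemma keys_add_nat: "keys (a + b) = keys a \<union> keys (b :: 'a \<Rightarrow>\<^sub>0 nat)"
  by (auto simp: in_keys_iff lookup_add)

lemma is_prime_coord_ideal: "is_prime_ideal (coord_ideal W :: ('a::finite, 'k::field) mpoly set)"
  unfolding is_prime_ideal_def
proof (intro conjI allI impI)
  show I: "is_ideal (coord_ideal W :: ('a, 'k) mpoly set)"
    unfolding coord_ideal_def by (rule is_ideal_keys_upward) (auto simp: keys_add_nat)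
  have "1 \<notin> (coord_ideal W :: ('a, 'k) mpoly set)" by (simp add: coord_ideal_def)
  then show "coord_ideal W \<noteq> (UNIV :: ('a, 'k) mpoly set)" by blast
  fix p q :: "('a, 'k) mpoly"
  assume pq: "p * q \<in> coord_ideal W"
  show "p \<in> coord_ideal W \<or> q \<in> coord_ideal W"
  proof (rule ccontr)
    assume "\<not> ?thesis"
    then have "{a \<in> keys p. keys a \<subseteq> W} \<noteq> {}" "{a \<in> keys q. keys a \<subseteq> W} \<noteq> {}"
      by (auto simp: coord_ideal_def)
    then obtain a b where a: "a \<in> keys p" "keys a \<subseteq> W" and b: "b \<in> keys q" "keys b \<subseteq> W"
      and ab: "\<forall>a'\<in>{a \<in> keys p. keys a \<subseteq> W}. \<forall>b'\<in>{a \<in> keys q. keys a \<subseteq> W}. a' + b' = a + b \<longrightarrow>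
        (\<forall>v\<in>UNIV. lookup a' v = lookup a v \<and> lookup b' v = lookup b v)"
      using unique_sum_pair[of UNIV "{a \<in> keys p. keys a \<subseteq> W}" "{a \<in> keys q. keys a \<subseteq> W}"] by auto
    have "lookup (p * q) (a + b) = lookup p a * lookup q b"
    proof (rule lookup_mult_unique)
      fix a' b' assume *: "a' \<in> keys p" "b' \<in> keys q" "a' + b' = a + b"
      then have "keys a' \<subseteq> W" "keys b' \<subseteq> W"
        using a(2) b(2) keys_add_nat[of a b] keys_add_nat[of a' b'] by auto
      then show "a' = a" using ab * by (intro poly_mapping_eqI) auto
    qed
    then have "a + b \<in> keys (p * q)" using a b by (simp add: in_keys_iff)
    then show False using pq a(2) b(2) keys_add_nat[of a b] by (auto simp: coord_ideal_def)
  qed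
qed

lemma coord_ideal_strict_anti:
  assumes "W \<subset> W'"
  shows "coord_ideal W' \<subset> (coord_ideal W :: ('a, 'k::comm_ring_1) mpoly set)"
proof -
  obtain v where v: "v \<in> W'" "v \<notin> W" using assms by blast
  have "var v \<in> coord_ideal W" "var v \<notin> (coord_ideal W' :: ('a, 'k) mpoly set)"
    using v by (auto simp: coord_ideal_def var_def monom_def)
  moreover have "{m :: 'a \<Rightarrow>\<^sub>0 nat. \<not> keys m \<subseteq> W'} \<subseteq> {m. \<not> keys m \<subseteq> W}" using assms by auto
  ultimately show ?thesis unfolding coord_ideal_def by blast
qed

lemma edge_ideal_subset_coord_ideal:
  assumes "indep E W"
  shows "edge_ideal E \<subseteq> (coord_ideal W :: ('a, 'k::comm_ring_1) mpoly set)"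
proof -
  have "{m :: 'a \<Rightarrow>\<^sub>0 nat. \<not> indep E (keys m)} \<subseteq> {m. \<not> keys m \<subseteq> W}"
    using assms by (auto simp: indep_def)
  then have "{p :: ('a, 'k) mpoly. keys p \<subseteq> {m. \<not> indep E (keys m)}} \<subseteq> coord_ideal W"
    unfolding coord_ideal_def by (intro Collect_mono impI) (rule subset_trans)
  then show ?thesis using edge_ideal_subset by (rule subset_trans[rotated])
qed

text \<open>Dropping the vertices of \<open>F\<close> one by one gives a chain of coordinate primes
  with \<open>card F\<close> strict steps; all contain the edge ideal because subsets of
  \<open>F\<close> are independent.\<close>

lemma krull_dim_edge_ideal_ge:
  fixes E :: "'a::finite set set"
  assumes "indep E F"
  shows "enat (card F) \<le> krull_dim_quot (edge_ideal E :: ('a, 'k::field) mpoly set)"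
proof -
  obtain fs where fs: "set fs = F" "distinct fs" using finite_distinct_list[of F] by auto
  define P :: "nat \<Rightarrow> ('a, 'k) mpoly set" where "P i = coord_ideal (set (drop i fs))" for i
  have "is_prime_ideal (P i) \<and> edge_ideal E \<subseteq> P i" for i
  proof -
    have "indep E (set (drop i fs))"
      using assms fs set_drop_subset[of i fs] unfolding indep_def by blast
    then show ?thesis unfolding P_def using is_prime_coord_ideal edge_ideal_subset_coord_ideal by blast
  qed
  moreover have "P i \<subset> P (Suc i)" if "i < card F" for i
    unfolding P_def
  proof (rule coord_ideal_strict_anti)
    have "drop i fs = fs ! i # drop (Suc i) fs"
      using that fs distinct_card[of fs] by (simp add: Cons_nth_drop_Suc)
    moreover have "distinct (drop i fs)" using fs by simp
    ultimately show "set (drop (Suc i) fs) \<subset> set (drop i fs)" by auto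
  qed
  ultimately show ?thesis
    unfolding krull_dim_quot_def by (intro Sup_upper) blast
qed

text \<open>\<open>F'\<close> bounds the dimension from below, and Cohen-Macaulayness turns this
  into a regular sequence longer than \<open>card F + j\<close>.\<close>

corollary cohen_macaulay_link_exact:
  fixes E :: "'a::finite set set" and g :: "'a list \<Rightarrow> 'k::field"
  assumes "simple_graph E" "cohen_macaulay_quot (edge_ideal E :: ('a, 'k) mpoly set)"
    and "indep E F" "indep E F'" "card F + j < card F'"
    and "\<And>ws. length ws = Suc j \<Longrightarrow> set ws \<inter> F = {} \<Longrightarrow> indep E (F \<union> set ws) \<Longrightarrow>
      koszul_d (\<lambda>_. 1) g ws = 0"
  obtains h where "\<And>ws. length ws = j \<Longrightarrow> set ws \<inter> F = {} \<Longrightarrow> indep E (F \<union> set ws) \<Longrightarrow>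
      g ws = koszul_d (\<lambda>_. 1) h ws"
proof -
  have "enat (card F + j) < enat (card F')" using assms(5) by simp
  also have "\<dots> \<le> depth_quot max_ideal (edge_ideal E :: ('a, 'k) mpoly set)"
    using krull_dim_edge_ideal_ge[OF assms(4), where 'k = 'k] assms(2)
    by (simp add: cohen_macaulay_quot_def)
  finally obtain fs where "regular_seq (edge_ideal E :: ('a, 'k) mpoly set) max_ideal fs"
    and "card F + j < length fs"
    unfolding depth_quot_def less_Sup_iff by auto
  then show ?thesis
    using link_cocycle_is_coboundary[OF assms(1) _ assms(3), of fs j g] assms(6) that by blast
qed

text \<open>The link of a maximal \<open>F\<close> has only the empty face, so its reduced
  cohomology in degree -1 is nonzero: the constant 1 is a cocycle for want of vertices, but every
  coboundary is 0 at \<open>[]\<close>.\<close>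

lemma cohen_macaulay_unmixed:
  fixes E :: "'a::finite set set"
  assumes "simple_graph E" "cohen_macaulay_quot (edge_ideal E :: ('a, 'k::field) mpoly set)"
    and "indep E F" "\<And>v. v \<notin> F \<Longrightarrow> \<not> indep E (insert v F)" "indep E F'"
  shows "card F' \<le> card F"
proof (rule ccontr)
  assume *: "\<not> card F' \<le> card F"
  define g where "g ws = (1 :: 'k)" for ws :: "'a list"
  obtain h :: "'a list \<Rightarrow> 'k" where h: "\<And>ws. length ws = 0 \<Longrightarrow> set ws \<inter> F = {} \<Longrightarrow> indep E (F \<union> set ws) \<Longrightarrow>
      g ws = koszul_d (\<lambda>_. 1) h ws"
  proof (rule cohen_macaulay_link_exact[OF assms(1,2,3,5)])
    show "card F + 0 < card F'" using * by simp
    fix ws :: "'a list"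
    assume ws: "length ws = Suc 0" "set ws \<inter> F = {}" "indep E (F \<union> set ws)"
    then obtain w where "ws = [w]" by (cases ws) auto
    then show "koszul_d (\<lambda>_. 1) g ws = 0" using ws assms(4)[of w] by auto
  qed blast
  show False using h[of "[]"] assms(3) by (simp add: g_def)
qed

section \<open>Links that are cycles of length 4 or 7\<close>

definition induced_cycle :: "'a set set \<Rightarrow> nat \<Rightarrow> (nat \<Rightarrow> 'a) \<Rightarrow> bool" where
  "induced_cycle E n c \<longleftrightarrow> inj_on c {..<n} \<and>
    (\<forall>i<n. \<forall>j<n. adj E (c i) (c j) \<longleftrightarrow> j = Suc i mod n \<or> i = Suc j mod n)"

definition closed_nbhd :: "'a set set \<Rightarrow> 'a set \<Rightarrow> 'a set" where
  "closed_nbhd E F = F \<union> {v. \<exists>u\<in>F. adj E u v}"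

lemma indep_Un_not_closed_nbhd:
  "indep E (F \<union> A) \<Longrightarrow> A \<inter> F = {} \<Longrightarrow> A \<inter> closed_nbhd E F = {}"
  unfolding indep_def closed_nbhd_def by auto

lemma link_cycle_indep:
  assumes "indep E F" "induced_cycle E n c" "- closed_nbhd E F = c ` {..<n}" "A \<subseteq> {..<n}"
    and "\<And>i j. i \<in> A \<Longrightarrow> j \<in> A \<Longrightarrow> j \<noteq> Suc i mod n"
  shows "c ` A \<inter> F = {}" "indep E (F \<union> c ` A)"
proof -
  have out: "c i \<notin> F" "\<And>u. u \<in> F \<Longrightarrow> \<not> adj E u (c i)" "\<And>u. u \<in> F \<Longrightarrow> \<not> adj E (c i) u" if "i \<in> A" for i
  proof -
    have "c i \<notin> closed_nbhd E F" using assms(3,4) that by blast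
    then show "c i \<notin> F" "\<And>u. u \<in> F \<Longrightarrow> \<not> adj E u (c i)" "\<And>u. u \<in> F \<Longrightarrow> \<not> adj E (c i) u"
      using that by (auto simp: closed_nbhd_def adj_def insert_commute)
  qed
  have "\<not> adj E (c i) (c j)" if "i \<in> A" "j \<in> A" for i j
    using assms(2,4) assms(5)[of i j] assms(5)[of j i] that unfolding induced_cycle_def by blast
  then show "indep E (F \<union> c ` A)" using out assms(1) unfolding indep_def by auto
  show "c ` A \<inter> F = {}" using out(1) by auto
qed

text \<open>The independence complex of a 4-cycle is two disjoint edges. The indicator of one of
  them is a cocycle on vertices, but coboundaries in this degree are constant.\<close>

lemma cohen_macaulay_no_link_C4:
  fixes E :: "'a::finite set set"
  assumes "simple_graph E" "cohen_macaulay_quot (edge_ideal E :: ('a, 'k::field) mpoly set)"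
    and F: "indep E F" and "induced_cycle E 4 c" "- closed_nbhd E F = c ` {..<4}"
  shows False
proof -
  have inj: "c i = c j \<longleftrightarrow> i = j" if "i < 4" "j < 4" for i j
    using assms(4) that by (auto simp: induced_cycle_def inj_on_def)
  have adj: "adj E (c i) (c j) \<longleftrightarrow> j = Suc i mod 4 \<or> i = Suc j mod 4" if "i < 4" "j < 4" for i j
    using assms(4) that by (auto simp: induced_cycle_def)
  note ind = link_cycle_indep[OF F assms(4,5)]
  have c02: "indep E (F \<union> c ` {0, 2})" "c ` {0, 2} \<inter> F = {}" by (rule ind; auto)+
  define g where "g ws = (of_bool (hd ws \<in> {c 0, c 2}) :: 'k)" for ws
  obtain h :: "'a list \<Rightarrow> 'k" where h: "\<And>ws. length ws = 1 \<Longrightarrow> set ws \<inter> F = {} \<Longrightarrow> indep E (F \<union> set ws) \<Longrightarrow>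
      g ws = koszul_d (\<lambda>_. 1) h ws"
  proof (rule cohen_macaulay_link_exact[OF assms(1,2) F c02(1)])
    have "c 0 \<noteq> c 2" using inj by simp
    then show "card F + 1 < card (F \<union> c ` {0, 2})"
      using c02(2) by (subst card_Un_disjoint) auto
    fix ws :: "'a list"
    assume ws: "length ws = Suc 1" "set ws \<inter> F = {}" "indep E (F \<union> set ws)"
    then obtain v w where vw: "ws = [v, w]" by (auto simp: length_Suc_conv)
    have "set ws \<subseteq> c ` {..<4}"
      using indep_Un_not_closed_nbhd[OF ws(3,2)] assms(5) by blast
    then obtain i j where ij: "v = c i" "w = c j" "i < 4" "j < 4" using vw by auto
    then have "\<not> adj E (c i) (c j)" using ws vw by (auto simp: indep_def)
    moreover have "i = 0 \<or> i = 1 \<or> i = 2 \<or> i = 3" "j = 0 \<or> j = 1 \<or> j = 2 \<or> j = 3" using ij by auto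
    ultimately have "i \<in> {0, 2} \<longleftrightarrow> j \<in> {0, 2}" using adj[OF ij(3,4)] by auto
    then have "v \<in> {c 0, c 2} \<longleftrightarrow> w \<in> {c 0, c 2}" using ij inj by simp
    then show "koszul_d (\<lambda>_. 1) g ws = 0" using vw by (simp add: g_def)
  qed blast
  have "g [c i] = h []" if "i < 4" for i
    using h[of "[c i]"] ind[of "{i}"] that by (auto simp: mod_Suc)
  from this[of 0] this[of 1] have "g [c 0] = g [c 1]" by simp
  moreover have "g [c 0] = 1" "g [c 1] = 0" using inj by (auto simp: g_def)
  ultimately show False by simp
qed

text \<open>The complex of independent sets of a 7-cycle is a Moebius strip; the
  cocycle has sum 1 around its core, the cycle 0, 2, 4, 6, 1, 3, 5.\<close>

definition C7_cocycle :: "nat \<Rightarrow> nat \<Rightarrow> int" where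
  "C7_cocycle i j = (if (i, j) \<in> {(0, 2), (0, 4), (5, 2)} then 1
     else if (i, j) \<in> {(2, 0), (4, 0), (2, 5)} then - 1 else 0)"

text \<open>Cochains live on lists, so triples with repeated vertices are tested too; the
  antisymmetry of the table settles them.\<close>

lemma C7_cocycle:
  assumes "i < 7" "j < 7" "k < 7"
    and "\<not> (j = Suc i mod 7 \<or> i = Suc j mod 7)" "\<not> (k = Suc i mod 7 \<or> i = Suc k mod 7)"
      "\<not> (k = Suc j mod 7 \<or> j = Suc k mod 7)"
  shows "C7_cocycle j k - C7_cocycle i k + C7_cocycle i j = 0"
proof -
  have "\<forall>i\<in>set [0..<7]. \<forall>j\<in>set [0..<7]. \<forall>k\<in>set [0..<7].
    \<not> (j = Suc i mod 7 \<or> i = Suc j mod 7) \<longrightarrow> \<not> (k = Suc i mod 7 \<or> i = Suc k mod 7) \<longrightarrow>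
    \<not> (k = Suc j mod 7 \<or> j = Suc k mod 7) \<longrightarrow> C7_cocycle j k - C7_cocycle i k + C7_cocycle i j = 0"
    by code_simp
  then show ?thesis using assms by simp
qed

lemma cohen_macaulay_no_link_C7:
  fixes E :: "'a::finite set set"
  assumes "simple_graph E" "cohen_macaulay_quot (edge_ideal E :: ('a, 'k::field) mpoly set)"
    and F: "indep E F" and "induced_cycle E 7 c" "- closed_nbhd E F = c ` {..<7}"
  shows False
proof -
  have inj: "inj_on c {..<7}" using assms(4) by (simp add: induced_cycle_def)
  have adj: "adj E (c i) (c j) \<longleftrightarrow> j = Suc i mod 7 \<or> i = Suc j mod 7" if "i < 7" "j < 7" for i j
    using assms(4) that by (auto simp: induced_cycle_def)
  note ind = link_cycle_indep[OF F assms(4,5)]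
  have c024: "indep E (F \<union> c ` {0, 2, 4})" "c ` {0, 2, 4} \<inter> F = {}" by (rule ind; auto)+
  define d where "d v = the_inv_into {..<7} c v" for v
  have d: "d (c i) = i" if "i < 7" for i
    unfolding d_def using that by (simp add: the_inv_into_f_f[OF inj])
  define g where "g ws = (of_int (C7_cocycle (d (ws ! 0)) (d (ws ! 1))) :: 'k)" for ws
  obtain h :: "'a list \<Rightarrow> 'k" where h: "\<And>ws. length ws = 2 \<Longrightarrow> set ws \<inter> F = {} \<Longrightarrow> indep E (F \<union> set ws) \<Longrightarrow>
      g ws = koszul_d (\<lambda>_. 1) h ws"
  proof (rule cohen_macaulay_link_exact[OF assms(1,2) F c024(1)])
    have "card (c ` {0, 2, 4}) = 3"
      by (rule trans[OF card_image[OF inj_on_subset[OF inj]]]) auto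
    then show "card F + 2 < card (F \<union> c ` {0, 2, 4})"
      using c024(2) by (subst card_Un_disjoint) auto
    fix ws :: "'a list"
    assume ws: "length ws = Suc 2" "set ws \<inter> F = {}" "indep E (F \<union> set ws)"
    then obtain u v w where uvw: "ws = [u, v, w]" by (auto simp: length_Suc_conv numeral_eq_Suc)
    have "set ws \<subseteq> c ` {..<7}"
      using indep_Un_not_closed_nbhd[OF ws(3,2)] assms(5) by blast
    then obtain i j k where ijk: "u = c i" "v = c j" "w = c k" "i < 7" "j < 7" "k < 7"
      using uvw by auto
    then have "\<not> adj E (c i) (c j)" "\<not> adj E (c i) (c k)" "\<not> adj E (c j) (c k)"
      using ws uvw by (auto simp: indep_def)
    then have "C7_cocycle j k - C7_cocycle i k + C7_cocycle i j = 0"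
      using ijk by (intro C7_cocycle) (simp_all add: adj)
    then have "of_int (C7_cocycle j k - C7_cocycle i k + C7_cocycle i j) = (0 :: 'k)" by simp
    then show "koszul_d (\<lambda>_. 1) g ws = 0"
      using uvw ijk by (simp add: g_def d algebra_simps)
  qed blast
  have step: "of_int (C7_cocycle i j) = h [c j] - h [c i]"
    if "i < 7" "j < 7" "j \<noteq> Suc i mod 7" "i \<noteq> Suc j mod 7" for i j
  proof -
    have "indep E (F \<union> c ` {i, j})" "c ` {i, j} \<inter> F = {}"
      by (rule ind; use that in \<open>auto simp: mod_Suc\<close>)+
    then have "g [c i, c j] = koszul_d (\<lambda>_. 1) h [c i, c j]"
      using that by (intro h) auto
    then show ?thesis using that by (simp add: g_def d)
  qed
  \<comment> \<open>Around the core the differences of \<open>h\<close> telescope to 0, while the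
    table adds up to 1, nonzero in every field.\<close>
  show False
    using step[of 0 2] step[of 2 4] step[of 4 6] step[of 6 1] step[of 1 3] step[of 3 5] step[of 5 0]
    by (simp add: C7_cocycle_def)
qed

section \<open>Paths and cycles in a cactus\<close>

lemma adj_sym: "adj E u v \<Longrightarrow> adj E v u"
  by (simp add: adj_def insert_commute)

lemma adj_commute: "adj E u v \<longleftrightarrow> adj E v u"
  by (auto simp: adj_def insert_commute)

definition path_between :: "'a set set \<Rightarrow> 'a \<Rightarrow> 'a list \<Rightarrow> 'a \<Rightarrow> bool" where
  "path_between E u P v \<longleftrightarrow> successively (adj E) (u # P @ [v])"

lemma path_between_simps [simp]:
  "path_between E u [] v \<longleftrightarrow> adj E u v"
  "path_between E u (x # P) v \<longleftrightarrow> adj E u x \<and> path_between E x P v"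
  by (simp_all add: path_between_def)

lemma successively_adj_rev: "successively (adj E) (rev xs) \<longleftrightarrow> successively (adj E) xs"
proof -
  have "(\<lambda>x y. adj E y x) = adj E" by (intro ext adj_commute)
  then show ?thesis unfolding successively_rev by (rule arg_cong)
qed

lemma path_between_rev: "path_between E u (rev P) v \<longleftrightarrow> path_between E v P u"
proof -
  have "u # rev P @ [v] = rev (v # P @ [u])" by simp
  then show ?thesis unfolding path_between_def by (simp only: successively_adj_rev)
qed

lemma is_cycleI:
  assumes "length vs \<ge> 3" "distinct vs" "successively (adj E) vs" "adj E (last vs) (hd vs)"
  shows "is_cycle E vs"
  unfolding is_cycle_def
proof (intro conjI allI impI assms)
  fix i assume i: "i < length vs"
  show "adj E (vs ! i) (vs ! ((i + 1) mod length vs))"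
  proof (cases "Suc i < length vs")
    case True
    then show ?thesis using successively_nth[OF assms(3)] by simp
  next
    case False
    then have "i + 1 = length vs" "i = length vs - 1" "vs \<noteq> []" using i by auto
    then have "vs ! i = last vs" "vs ! ((i + 1) mod length vs) = hd vs"
      by (simp_all add: last_conv_nth hd_conv_nth)
    then show ?thesis using assms(4) by simp
  qed
qed

lemma cycle_edge_first: "is_cycle E (u # x # xs) \<Longrightarrow> {u, x} \<in> cycle_edges (u # x # xs)"
  unfolding is_cycle_def cycle_edges_def by (rule CollectI, rule exI[of _ 0]) simp

lemma cycle_edge_last:
  assumes "vs \<noteq> []"
  shows "{last vs, hd vs} \<in> cycle_edges vs"
proof -
  have "length vs - 1 + 1 = length vs" using assms by (simp add: Suc_le_eq)
  then show ?thesis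
    unfolding cycle_edges_def last_conv_nth[OF assms] hd_conv_nth[OF assms] using assms
    by (intro CollectI exI[of _ "length vs - 1"]) simp
qed

lemma cycle_edge_subset:
  assumes "e \<in> cycle_edges vs"
  shows "e \<subseteq> set vs"
proof -
  obtain i where i: "i < length vs" "e = {vs ! i, vs ! ((i + 1) mod length vs)}"
    using assms by (auto simp: cycle_edges_def)
  then have "(i + 1) mod length vs < length vs" by (intro mod_less_divisor) auto
  then show ?thesis using i by auto
qed

text \<open>The cycle through \<open>P\<close> and \<open>Q\<close> and the one through
  \<open>P\<close> and \<open>R\<close> share the first edge of the path via \<open>P\<close>, so
  they have the same edges in a cactus. But the first vertex of \<open>Q\<close> is not on the
  second cycle.\<close>

lemma cactus_no_theta_aux:
  assumes "cactus_graph E" "distinct (u # v # P @ Q @ R)"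
    and "path_between E u P v" "path_between E u Q v" "path_between E u R v"
    and "Q \<noteq> []" "P \<noteq> [] \<or> R \<noteq> []"
  shows False
proof -
  have cyc: "is_cycle E (u # P @ v # rev X)"
    if "path_between E u X v" "distinct (u # v # P @ X)" "P \<noteq> [] \<or> X \<noteq> []" for X
  proof (rule is_cycleI)
    show "3 \<le> length (u # P @ v # rev X)" using that(3) by (cases P; cases X) auto
    show "distinct (u # P @ v # rev X)" using that(2) by auto
    have 1: "path_between E v (rev X) u" using that(1) path_between_rev by fast
    have "successively (adj E) ((v # rev X) @ [u])" using 1 by (simp add: path_between_def)
    then have "successively (adj E) (v # rev X)" "adj E (last (v # rev X)) u"
      unfolding successively_append_iff by auto
    moreover have "successively (adj E) ((u # P) @ [v])" using assms(3) by (simp add: path_between_def)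
    then have "successively (adj E) (u # P)" "adj E (last (u # P)) v"
      unfolding successively_append_iff by auto
    ultimately show "adj E (last (u # P @ v # rev X)) (hd (u # P @ v # rev X))"
      and "successively (adj E) (u # P @ v # rev X)"
      using successively_append_iff[of "adj E" "u # P" "v # rev X"] by auto
  qed
  let ?c1 = "u # P @ v # rev Q" and ?c2 = "u # P @ v # rev R"
  have c1: "is_cycle E ?c1" and c2: "is_cycle E ?c2"
    by (rule cyc; use assms in auto)+
  obtain x xs where x: "P @ [v] = x # xs" by (cases P) auto
  then have eq: "?c1 = u # x # xs @ rev Q" "?c2 = u # x # xs @ rev R"
    using append_assoc[of P "[v]"] by (metis append_Cons append_Nil)+
  have "{u, x} \<in> cycle_edges ?c1" "{u, x} \<in> cycle_edges ?c2"
    using cycle_edge_first c1 c2 unfolding eq by fast+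
  moreover have "{u, x} \<in> E"
    using assms(3) x by (cases P) (auto simp: adj_def)
  ultimately have "cycle_edges ?c1 = cycle_edges ?c2"
    using assms(1) c1 c2 unfolding cactus_graph_def by blast
  moreover have "{hd Q, u} \<in> cycle_edges ?c1"
    using cycle_edge_last[of ?c1] assms(6) by (simp add: last_rev)
  ultimately have "hd Q \<in> set ?c2" using cycle_edge_subset by blast
  moreover have "hd Q \<in> set Q" using assms(6) by simp
  ultimately show False using assms(2) by auto
qed

text \<open>At most one of the three paths is a single edge, so a reordering gives the middle path
  an interior vertex.\<close>

lemma cactus_no_theta:
  assumes "cactus_graph E" "distinct (u # v # P @ Q @ R)"
    and "path_between E u P v" "path_between E u Q v" "path_between E u R v"
    and "P \<noteq> [] \<or> Q \<noteq> []" "Q \<noteq> [] \<or> R \<noteq> []" "P \<noteq> [] \<or> R \<noteq> []"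
  shows False
proof (cases "Q = []")
  case True
  then show False
    using assms by (intro cactus_no_theta_aux[OF assms(1), of u v P R Q]) auto
next
  case False
  then show False
    using assms by (intro cactus_no_theta_aux[OF assms(1), of u v P Q R]) auto
qed

text \<open>Only the vertices after \<open>a\<close> must lie in \<open>S\<close>, so
  \<open>a\<close> may be a cycle vertex at which a part outside the cycle is attached.\<close>

definition reach_in :: "'a set set \<Rightarrow> 'a set \<Rightarrow> 'a \<Rightarrow> 'a set" where
  "reach_in E S a = {b. (\<lambda>x y. adj E x y \<and> y \<in> S)\<^sup>*\<^sup>* a b}"

lemma reach_in_self: "a \<in> reach_in E S a"
  by (simp add: reach_in_def)

lemma reach_in_step: "b \<in> reach_in E S a \<Longrightarrow> adj E b d \<Longrightarrow> d \<in> S \<Longrightarrow> d \<in> reach_in E S a"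
  unfolding reach_in_def 
  by (simp add: rtranclp.rtrancl_into_rtrancl)

lemma reach_in_subset: "reach_in E S a \<subseteq> insert a S"
proof
  fix b assume "b \<in> reach_in E S a"
  then have "(\<lambda>x y. adj E x y \<and> y \<in> S)\<^sup>*\<^sup>* a b" by (simp add: reach_in_def)
  then show "b \<in> insert a S" by cases auto
qed

lemma reach_in_path:
  assumes "b \<in> reach_in E S a"
  obtains p where "p \<noteq> []" "hd p = a" "last p = b" "distinct p" "set p \<subseteq> insert a S" "successively (adj E) p"
proof -
  have "(\<lambda>x y. adj E x y \<and> y \<in> S)\<^sup>*\<^sup>* a b" using assms by (simp add: reach_in_def)
  then have "\<exists>p. p \<noteq> [] \<and> hd p = a \<and> last p = b \<and> distinct p \<and> set p \<subseteq> insert a S \<and> successively (adj E) p"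
  proof (induction rule: converse_rtranclp_induct)
    case base
    then show ?case by (intro exI[of _ "[b]"]) auto
  next
    case (step x y)
    then obtain p where p: "p \<noteq> []" "hd p = y" "last p = b" "distinct p" "set p \<subseteq> insert y S" "successively (adj E) p"
      by blast
    show ?case
    proof (cases "x \<in> set p")
      case True
      then obtain p1 p2 where "p = p1 @ x # p2" by (meson split_list)
      then show ?thesis using p step by (intro exI[of _ "x # p2"]) (auto simp: successively_append_iff)
    next
      case False
      then show ?thesis using p step by (intro exI[of _ "x # p"]) (auto simp: successively_Cons)
    qed
  qed
  then show ?thesis using that by blast
qed

lemma reach_in_trans: "b \<in> reach_in E S a \<Longrightarrow> d \<in> reach_in E S b \<Longrightarrow> d \<in> reach_in E S a"
  unfolding reach_in_def by auto

lemma reach_in_sym: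
  assumes "b \<in> reach_in E S a" "a \<in> S"
  shows "a \<in> reach_in E S b"
proof -
  have "(\<lambda>x y. adj E x y \<and> y \<in> S)\<^sup>*\<^sup>* a b" using assms by (simp add: reach_in_def)
  then have "a \<in> reach_in E S b \<and> b \<in> S"
  proof (induction rule: rtranclp_induct)
    case base
    then show ?case using assms reach_in_self by fast
  next
    case (step y z)
    then have "y \<in> reach_in E S z" using reach_in_step[OF reach_in_self, of E z y S] adj_sym by fast
    then show ?case using step reach_in_trans by fast
  qed
  then show ?thesis by blast
qed

text \<open>The two arcs of the cycle. Knowing which arc is a single edge is what turns the absence
  of theta graphs into the absence of chords.\<close>

lemma cycle_two_paths:
  assumes "distinct vs" "successively (adj E) vs" "adj E (last vs) (hd vs)" "i < j" "j < length vs"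
  obtains X Y where "path_between E (vs ! i) X (vs ! j)" "path_between E (vs ! i) Y (vs ! j)"
    "distinct (vs ! i # vs ! j # X @ Y)" "set (vs ! i # vs ! j # X @ Y) = set vs"
    "X = [] \<longleftrightarrow> j = Suc i" "Y = [] \<longleftrightarrow> i = 0 \<and> Suc j = length vs"
proof -
  define A where "A = take i vs"
  define X where "X = take (j - Suc i) (drop (Suc i) vs)"
  define B where "B = drop (Suc j) vs"
  have "drop (Suc i) vs = X @ drop (j - Suc i) (drop (Suc i) vs)"
    unfolding X_def by (rule append_take_drop_id[symmetric])
  also have "drop (j - Suc i) (drop (Suc i) vs) = drop j vs" using assms(4) by simp
  also have "\<dots> = vs ! j # B" using assms(5) by (simp add: B_def Cons_nth_drop_Suc)
  finally have "vs = A @ vs ! i # X @ vs ! j # B"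
    using id_take_nth_drop[of i vs] assms(4,5) by (simp add: A_def)
  then obtain u v where vs: "vs = A @ u # X @ v # B" and uv: "u = vs ! i" "v = vs ! j" by blast
  have split: "vs = A @ (u # X @ [v]) @ B" "vs = (A @ [u]) @ X @ v # B" "vs = (A @ u # X) @ (v # B)"
    using vs by simp_all
  have X: "path_between E u X v"
    using assms(2) unfolding split(1) path_between_def successively_append_iff[of _ A]
      successively_append_iff[of _ "u # X @ [v]"] by blast
  have "successively (adj E) (A @ [u])"
    using assms(2) unfolding split(2) successively_append_iff[of _ "A @ [u]"] by blast
  moreover have "successively (adj E) (v # B)"
    using assms(2) unfolding split(3) successively_append_iff[of _ "A @ u # X"] by blast
  moreover have "last vs = last (v # B)" unfolding split(3) by simp
  moreover have "hd vs = hd (A @ [u])" unfolding split(2) by (simp add: hd_append)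
  ultimately have "successively (adj E) ((v # B) @ (A @ [u]))"
    unfolding successively_append_iff[of _ "v # B"] using assms(3) by metis
  then have "path_between E v (B @ A) u" unfolding path_between_def by simp
  then have Y: "path_between E u (rev (B @ A)) v" using path_between_rev by fast
  have "X = [] \<longleftrightarrow> j = Suc i" using assms(4,5) by (auto simp: X_def)
  moreover have "rev (B @ A) = [] \<longleftrightarrow> i = 0 \<and> Suc j = length vs"
    using assms(4,5) by (auto simp: A_def B_def)
  moreover have "distinct (u # v # X @ rev (B @ A))" using assms(1) unfolding vs by auto
  moreover have "set (u # v # X @ rev (B @ A)) = set vs" unfolding vs by auto
  ultimately show ?thesis using that[of X "rev (B @ A)"] X Y unfolding uv by blast
qed

lemma cycle_two_paths_vertices:
  assumes "distinct vs" "successively (adj E) vs" "adj E (last vs) (hd vs)" "length vs \<ge> 3"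
    and "u \<in> set vs" "v \<in> set vs" "u \<noteq> v"
  obtains X Y where "path_between E u X v" "path_between E u Y v"
    "distinct (u # v # X @ Y)" "set (u # v # X @ Y) = set vs" "X \<noteq> [] \<or> Y \<noteq> []"
proof -
  obtain i j where ij: "i < length vs" "j < length vs" "vs ! i = u" "vs ! j = v"
    using assms(5,6) by (metis in_set_conv_nth)
  with assms(7) have "i < j \<or> j < i" by (metis nat_neq_iff)
  then show ?thesis
  proof
    assume "i < j"
    obtain X Y where "path_between E (vs ! i) X (vs ! j)" "path_between E (vs ! i) Y (vs ! j)"
      "distinct (vs ! i # vs ! j # X @ Y)" "set (vs ! i # vs ! j # X @ Y) = set vs"
      "X = [] \<longleftrightarrow> j = Suc i" "Y = [] \<longleftrightarrow> i = 0 \<and> Suc j = length vs"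
      by (rule cycle_two_paths[OF assms(1-3) \<open>i < j\<close> ij(2)])
    then show ?thesis using that[of X Y] ij assms(4) by auto
  next
    assume "j < i"
    obtain X Y where "path_between E (vs ! j) X (vs ! i)" "path_between E (vs ! j) Y (vs ! i)"
      "distinct (vs ! j # vs ! i # X @ Y)" "set (vs ! j # vs ! i # X @ Y) = set vs"
      "X = [] \<longleftrightarrow> i = Suc j" "Y = [] \<longleftrightarrow> j = 0 \<and> Suc i = length vs"
      by (rule cycle_two_paths[OF assms(1-3) \<open>j < i\<close> ij(1)])
    then have "path_between E u (rev X) v" "path_between E u (rev Y) v" "distinct (u # v # rev X @ rev Y)"
      "set (u # v # rev X @ rev Y) = set vs" "rev X \<noteq> [] \<or> rev Y \<noteq> []"
      using ij assms(4) by (auto simp: path_between_rev)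
    then show ?thesis by (rule that)
  qed
qed

section \<open>Pieces of a well-covered cactus\<close>

definition nb :: "'a set set \<Rightarrow> 'a set \<Rightarrow> 'a \<Rightarrow> 'a set" where
  "nb E W v = {u \<in> W. adj E v u}"

definition maxindep :: "'a set set \<Rightarrow> 'a set \<Rightarrow> 'a set \<Rightarrow> bool" where
  "maxindep E W I \<longleftrightarrow> I \<subseteq> W \<and> indep E I \<and> (\<forall>v\<in>W - I. \<exists>u\<in>I. adj E u v)"

definition well_covered :: "'a set set \<Rightarrow> 'a set \<Rightarrow> bool" where
  "well_covered E W \<longleftrightarrow> (\<forall>I J. maxindep E W I \<longrightarrow> J \<subseteq> W \<longrightarrow> indep E J \<longrightarrow> card J \<le> card I)"

text \<open>Lengths 4 and 7 are those that \<open>end_cycle_length\<close> leaves open besides the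
  harmless 3 and 5.\<close>

definition no_cycle_link :: "'a set set \<Rightarrow> 'a set \<Rightarrow> bool" where
  "no_cycle_link E W \<longleftrightarrow> (\<forall>F n c. n \<in> {4, 7} \<longrightarrow> F \<subseteq> W \<longrightarrow> indep E F \<longrightarrow> induced_cycle E n c \<longrightarrow>
     W - closed_nbhd E F \<noteq> c ` {..<n})"

locale cactus =
  fixes E :: "'a::finite set set"
  assumes simple: "simple_graph E" and cactus: "cactus_graph E"
begin

lemma irrefl [simp]: "\<not> adj E v v"
  using simple by (auto simp: simple_graph_def adj_def)

lemmas no_theta = cactus_no_theta[OF cactus]

lemma indep_insert: "indep E (insert v I) \<longleftrightarrow> indep E I \<and> (\<forall>u\<in>I. \<not> adj E u v)"
  unfolding indep_def using adj_commute[of E] by auto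

lemma indep_Un: "indep E (I \<union> J) \<longleftrightarrow> indep E I \<and> indep E J \<and> (\<forall>u\<in>I. \<forall>v\<in>J. \<not> adj E u v)"
proof
  show "indep E (I \<union> J)" if "indep E I \<and> indep E J \<and> (\<forall>u\<in>I. \<forall>v\<in>J. \<not> adj E u v)"
  proof -
    have "\<forall>u\<in>J. \<forall>v\<in>I. \<not> adj E u v" using that adj_sym[of E] by blast
    then show ?thesis using that unfolding indep_def ball_Un by blast
  qed
qed (auto simp: indep_def)

lemma indep_empty [simp]: "indep E {}"
  by (simp add: indep_def)

lemma indep_mono: "indep E I \<Longrightarrow> J \<subseteq> I \<Longrightarrow> indep E J"
  unfolding indep_def by blast

section \<open>Maximal independent sets and passage to links\<close>

lemma extend_maxindep:
  assumes "J \<subseteq> W" "indep E J"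
  obtains I where "maxindep E W I" "J \<subseteq> I"
proof -
  let ?P = "\<lambda>I. J \<subseteq> I \<and> I \<subseteq> W \<and> indep E I"
  have "?P J" using assms by simp
  moreover have "\<forall>I. ?P I \<longrightarrow> card I < Suc (card (UNIV :: 'a set))"
    by (simp add: card_mono less_Suc_eq_le)
  ultimately obtain I where I: "?P I" "\<And>I'. ?P I' \<Longrightarrow> card I' \<le> card I"
    using ex_has_greatest_nat[of ?P J card "Suc (card (UNIV :: 'a set))"] by metis
  have "\<exists>u\<in>I. adj E u v" if "v \<in> W - I" for v
  proof (rule ccontr)
    assume "\<not> ?thesis"
    then have "?P (insert v I)" using I(1) that by (auto simp: indep_insert)
    then have "card (insert v I) \<le> card I" by (rule I(2))
    then show False using that by simp
  qed
  then have "maxindep E W I" using I(1) by (auto simp: maxindep_def)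
  then show ?thesis using that I(1) by blast
qed

text \<open>\<open>D\<close> can be added to every independent set avoiding its closed
  neighbourhood, and preserves maximality; so size comparisons carry over.\<close>

lemma well_covered_link:
  assumes "well_covered E W" "D \<subseteq> W" "indep E D"
  shows "well_covered E (W - closed_nbhd E D)"
  unfolding well_covered_def
proof (intro allI impI)
  fix I J assume I: "maxindep E (W - closed_nbhd E D) I" and J: "J \<subseteq> W - closed_nbhd E D" "indep E J"
  have "maxindep E W (I \<union> D)"
    unfolding maxindep_def
  proof (intro conjI ballI)
    show "I \<union> D \<subseteq> W" using I assms(2) by (auto simp: maxindep_def)
    show "indep E (I \<union> D)" using I assms(3) adj_sym by (fastforce simp: maxindep_def indep_Un closed_nbhd_def)
    fix v assume "v \<in> W - (I \<union> D)"
    then show "\<exists>u\<in>I \<union> D. adj E u v" using I unfolding maxindep_def closed_nbhd_def by auto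
  qed
  moreover have "indep E (J \<union> D)" using J assms(3) adj_sym by (fastforce simp: indep_Un closed_nbhd_def)
  moreover have "J \<union> D \<subseteq> W" using J assms(2) by auto
  ultimately have "card (J \<union> D) \<le> card (I \<union> D)" using assms(1) by (auto simp: well_covered_def)
  moreover have "J \<inter> D = {}" "I \<inter> D = {}" using J I by (auto simp: maxindep_def closed_nbhd_def)
  ultimately show "card J \<le> card I" by (simp add: card_Un_disjoint)
qed

lemma no_cycle_link_link:
  assumes "no_cycle_link E W" "D \<subseteq> W" "indep E D"
  shows "no_cycle_link E (W - closed_nbhd E D)"
  unfolding no_cycle_link_def
proof (intro allI impI)
  fix F n c
  assume *: "n \<in> {4, 7}" "F \<subseteq> W - closed_nbhd E D" "indep E F" "induced_cycle E n c"
  have "indep E (F \<union> D)" using * assms(3) adj_sym by (fastforce simp: indep_Un closed_nbhd_def)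
  moreover have "F \<union> D \<subseteq> W" using * assms(2) by auto
  ultimately have "W - closed_nbhd E (F \<union> D) \<noteq> c ` {..<n}"
    using assms(1) *(1,4) unfolding no_cycle_link_def by blast
  moreover have "W - closed_nbhd E (F \<union> D) = W - closed_nbhd E D - closed_nbhd E F"
    by (auto simp: closed_nbhd_def)
  ultimately show "W - closed_nbhd E D - closed_nbhd E F \<noteq> c ` {..<n}" by simp
qed

definition clique_piece :: "'a set \<Rightarrow> 'a set \<Rightarrow> 'a \<Rightarrow> bool" where
  "clique_piece W P f \<longleftrightarrow> P \<subseteq> W \<and> f \<in> P \<and> nb E W f = P - {f} \<and> (\<forall>u\<in>P. \<forall>v\<in>P. u \<noteq> v \<longrightarrow> adj E u v)"

definition pent_piece :: "'a set \<Rightarrow> 'a set \<Rightarrow> 'a \<Rightarrow> 'a \<Rightarrow> 'a \<Rightarrow> 'a \<Rightarrow> 'a \<Rightarrow> bool" where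
  "pent_piece W P a b c d e \<longleftrightarrow> P = {a, b, c, d, e} \<and> P \<subseteq> W \<and> distinct [a, b, c, d, e] \<and>
    adj E a b \<and> adj E b c \<and> adj E c d \<and> adj E d e \<and> adj E e a \<and>
    nb E W b = {a, c} \<and> nb E W d = {c, e} \<and> nb E W e = {d, a}"

text \<open>The vertices \<open>s\<close> and \<open>q\<close> of the 4-cycle belong to other
  pieces. The last clause gives \<open>s\<close> a third neighbour, which
  \<open>quad_piece_nb_q\<close> uses to keep \<open>q\<close> out of all pieces of this
  kind.\<close>

definition quad_piece :: "'a set \<Rightarrow> 'a set \<Rightarrow> 'a \<Rightarrow> 'a \<Rightarrow> 'a \<Rightarrow> 'a \<Rightarrow> bool" where
  "quad_piece W P s f p q \<longleftrightarrow> P = {f, p} \<and> {s, f, p, q} \<subseteq> W \<and> distinct [s, f, p, q] \<and>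
    nb E W f = {s, p} \<and> nb E W p = {f, q} \<and> adj E s q \<and> nb E W s \<noteq> {f, q}"

definition piece :: "'a set \<Rightarrow> 'a set \<Rightarrow> bool" where
  "piece W P \<longleftrightarrow> (\<exists>f. clique_piece W P f) \<or> (\<exists>a b c d e. pent_piece W P a b c d e) \<or>
    (\<exists>s f p q. quad_piece W P s f p q)"

text \<open>An end block \<open>B\<close> with attaching vertex \<open>c\<close>. By the last clause
  a \<open>c\<close> with neighbours outside \<open>B\<close> also has one inside; it supplies the
  third neighbour demanded by \<open>quad_piece\<close>.\<close>

definition terminal :: "'a set \<Rightarrow> 'a set \<Rightarrow> 'a set \<Rightarrow> 'a \<Rightarrow> bool" where
  "terminal W B D c \<longleftrightarrow> B \<subseteq> W \<and> D \<subseteq> B \<and> indep E D \<and> W \<inter> closed_nbhd E D = B \<and> c \<in> B \<and>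
    (\<forall>u\<in>B. u \<noteq> c \<longrightarrow> nb E W u \<subseteq> B) \<and> (\<forall>I\<subseteq>B. indep E I \<longrightarrow> card I \<le> card D) \<and>
    (nb E W c \<subseteq> B \<or> nb E W c \<inter> B \<noteq> {})"

text \<open>If \<open>I - B\<close> could be enlarged to some \<open>J\<close> off \<open>B\<close>,
  then \<open>J\<close> with \<open>D\<close> would be independent and larger than \<open>I\<close>,
  since \<open>I\<close> has at most \<open>card D\<close> vertices in \<open>B\<close>.\<close>

lemma maxindep_remove_terminal:
  assumes "well_covered E W" "terminal W B D c" "maxindep E W I"
  shows "maxindep E (W - B) (I - B)"
proof -
  have I: "I \<subseteq> W" "indep E I" using assms(3) by (auto simp: maxindep_def)
  obtain J where J: "maxindep E (W - B) J" "I - B \<subseteq> J"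
    using extend_maxindep[of "I - B" "W - B"] I indep_mono[of I "I - B"] by blast
  have "J = I - B"
  proof (rule ccontr)
    assume "J \<noteq> I - B"
    then have 1: "card (I - B) < card J" using J(2) by (intro psubset_card_mono) auto
    have B: "B \<subseteq> W" "D \<subseteq> B" "indep E D" "W \<inter> closed_nbhd E D = B" "card (I \<inter> B) \<le> card D"
      using assms(2) indep_mono[OF I(2), of "I \<inter> B"] by (auto simp: terminal_def)
    have JB: "J \<subseteq> W" "J \<inter> B = {}" "indep E J" using J(1) by (auto simp: maxindep_def)
    have "\<not> adj E u v" if "u \<in> J" "v \<in> D" for u v
    proof
      assume "adj E u v"
      then have "u \<in> closed_nbhd E D" using that adj_sym by (fastforce simp: closed_nbhd_def)
      then show False using that JB B(4) by blast
    qed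
    then have "indep E (J \<union> D)" using JB B by (auto simp: indep_Un)
    then have "card (J \<union> D) \<le> card I"
      using assms(1,3) JB B by (auto simp: well_covered_def)
    moreover have "card (J \<union> D) = card J + card D" using JB B(2) by (intro card_Un_disjoint) auto
    moreover have "card I = card (I \<inter> B) + card (I - B)"
      using card_Un_disjoint[of "I \<inter> B" "I - B"] by (auto simp: Int_Diff_Un)
    ultimately show False using 1 B(5) by simp
  qed
  then show ?thesis using J(1) by simp
qed

text \<open>Extend \<open>F\<close> and \<open>c\<close> to a maximal independent set of
  \<open>W\<close>, then delete \<open>B\<close>. The lifting lemmas choose \<open>F\<close> so that
  \<open>K\<close> would contain neither some vertex adjacent to \<open>c\<close> nor any neighbour
  of it in \<open>W - B\<close>, against maximality.\<close>

lemma terminal_extend: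
  assumes "well_covered E W" "terminal W B D c" "F \<subseteq> W - B" "indep E F" "\<forall>x\<in>F. \<not> adj E c x"
  obtains K where "maxindep E (W - B) K" "F \<subseteq> K" "\<forall>x\<in>K. \<not> adj E c x"
proof -
  have c: "c \<in> B" "c \<in> W" using assms(2) by (auto simp: terminal_def)
  have "indep E (insert c F)" using assms(4,5) by (auto simp: indep_insert dest: adj_sym)
  then obtain I where I: "maxindep E W I" "insert c F \<subseteq> I"
    using extend_maxindep[of "insert c F" W] assms(3) c by blast
  show ?thesis
  proof (rule that)
    show "maxindep E (W - B) (I - B)" by (rule maxindep_remove_terminal[OF assms(1,2) I(1)])
    show "F \<subseteq> I - B" using I assms(3) by auto
    show "\<forall>x\<in>I - B. \<not> adj E c x" using I by (auto simp: maxindep_def indep_def)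
  qed
qed

lemma nb_terminal:
  assumes "terminal W B D c" "u \<in> W - B"
  shows "nb E W u = nb E (W - B) u \<union> (if adj E c u then {c} else {})"
proof -
  have "b = c" if "b \<in> B" "adj E u b" for b
  proof (rule ccontr)
    assume "b \<noteq> c"
    then have "nb E W b \<subseteq> B" using assms(1) that by (auto simp: terminal_def)
    then show False using assms(2) that adj_sym by (fastforce simp: nb_def)
  qed
  moreover have "c \<in> W" using assms(1) by (auto simp: terminal_def)
  ultimately show ?thesis using adj_commute[of E c u] by (auto simp: nb_def)
qed

section \<open>Pieces survive the gluing of an end block\<close>

lemma clique_piece_meets:
  assumes "clique_piece W P f" "maxindep E W I"
  shows "I \<inter> P \<noteq> {}"
proof
  assume "I \<inter> P = {}"
  then have "f \<in> W - I" using assms by (auto simp: clique_piece_def)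
  then obtain u where "u \<in> I" "adj E u f" using assms(2) by (auto simp: maxindep_def)
  then have "u \<in> nb E W f" using assms(2) adj_sym by (fastforce simp: nb_def maxindep_def)
  then show False using assms(1) \<open>u \<in> I\<close> \<open>I \<inter> P = {}\<close> by (auto simp: clique_piece_def)
qed

text \<open>The only danger is that \<open>c\<close> is adjacent to all free vertices of the clique.
  Then one vertex, or three and more, are impossible, and an edge becomes a quad piece.\<close>

lemma lift_clique_piece:
  assumes "well_covered E W" "terminal W B D c" "clique_piece (W - B) P f"
  shows "piece W P"
proof (cases "\<exists>f. clique_piece (W - B) P f \<and> \<not> adj E c f")
  case True
  then obtain f where f: "clique_piece (W - B) P f" "\<not> adj E c f" by blast
  then have "nb E W f = P - {f}"
    using nb_terminal[OF assms(2), of f] by (auto simp: clique_piece_def)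
  then have "clique_piece W P f" using f(1) by (auto simp: clique_piece_def)
  then show ?thesis by (auto simp: piece_def)
next
  case False
  let ?W = "W - B"
  have cB: "c \<in> B" "c \<in> W" using assms(2) by (auto simp: terminal_def)
  have P: "P \<subseteq> ?W" "f \<in> P" "nb E ?W f = P - {f}" and cl: "\<And>u v. u \<in> P \<Longrightarrow> v \<in> P \<Longrightarrow> u \<noteq> v \<Longrightarrow> adj E u v"
    using assms(3) by (auto simp: clique_piece_def)
  have cf: "adj E c f" using False assms(3) by blast
  have cP: "c \<notin> P" using P cB by auto
  have outer: "\<exists>q\<in>?W. q \<notin> P \<and> adj E p q" if "p \<in> P" "\<not> adj E c p" for p
  proof (rule ccontr)
    assume "\<not> ?thesis"
    then have "nb E ?W p = P - {p}" using cl that P(1) by (auto simp: nb_def)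
    then have "clique_piece ?W P p" using that P(1) cl by (auto simp: clique_piece_def)
    then show False using False that by blast
  qed
  \<comment> \<open>Such an \<open>F\<close> would extend by \<open>terminal_extend\<close> to a
    maximal independent set of the rest that misses the clique.\<close>
  have hit: False if F: "F \<subseteq> ?W" "indep E F" "\<forall>x\<in>F. \<not> adj E c x" "\<forall>p\<in>P. adj E c p \<or> (\<exists>q\<in>F. adj E p q)" for F
  proof -
    obtain K where K: "maxindep E ?W K" "F \<subseteq> K" "\<forall>x\<in>K. \<not> adj E c x"
      using terminal_extend[OF assms(1,2) F(1-3)] by blast
    have "\<not> adj E x q" if "x \<in> K" "q \<in> F" for x q
      using K that by (auto simp: maxindep_def indep_def)
    then have "K \<inter> P = {}" using F(4) K(3) by blast
    then show False using clique_piece_meets[OF assms(3) K(1)] by blast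
  qed
  obtain p where p: "p \<in> P" "\<not> adj E c p"
    using hit[of "{}"] by auto
  then have "p \<noteq> f" using cf by blast
  obtain q where q: "q \<in> ?W" "q \<notin> P" "adj E p q" using outer[OF p] by blast
  have cq: "c \<noteq> q" using q cB by blast
  show ?thesis
  proof (cases "P = {f, p}")
    \<comment> \<open>Besides \<open>f\<close> there are \<open>p\<close> and \<open>r\<close> with
      outer neighbours \<open>q\<close> and \<open>q'\<close>; the absence of theta graphs makes
      \<open>{q, q'}\<close> a set forbidden by \<open>hit\<close>.\<close>
    case False
    then obtain r where r: "r \<in> P" "r \<noteq> f" "r \<noteq> p" using P(2) p(1) by blast
    have adjs: "adj E f p" "adj E p f" "adj E f r" "adj E r f" "adj E p r" "adj E r p"
      using cl P(2) p r \<open>p \<noteq> f\<close> by auto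
    have ne: "c \<noteq> f" "c \<noteq> p" "c \<noteq> r" using cP P(2) p r by auto
    have "\<not> adj E c r"
      using no_theta[of f r "[p]" "[c]" "[]"] adjs ne r \<open>p \<noteq> f\<close> cf adj_sym[OF cf] by auto
    then obtain q' where q': "q' \<in> ?W" "q' \<notin> P" "adj E r q'" using outer[OF r(1)] by blast
    have cq': "c \<noteq> q'" using q' cB by blast
    have nq: "q \<noteq> f" "q \<noteq> p" "q \<noteq> r" "q' \<noteq> f" "q' \<noteq> p" "q' \<noteq> r"
      using q q' P(2) p r by auto
    have P3: "P = {f, p, r}"
    proof (rule ccontr)
      assume "P \<noteq> {f, p, r}"
      then obtain x where "x \<in> P" "x \<notin> {f, p, r}" using P(2) p r by blast
      then show False
        using no_theta[of f p "[]" "[r]" "[x]"] adjs cl[of f x] cl[of x p] P(2) p r \<open>p \<noteq> f\<close> by auto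
    qed
    have 1: "\<not> adj E c q"
      using no_theta[of f p "[]" "[r]" "[c, q]"] adjs adj_sym[OF cf] adj_sym[OF q(3)] nq ne cq r \<open>p \<noteq> f\<close> by auto
    have 2: "\<not> adj E c q'"
      using no_theta[of f r "[]" "[p]" "[c, q']"] adjs adj_sym[OF cf] adj_sym[OF q'(3)] nq ne cq' r \<open>p \<noteq> f\<close> by auto
    have 3: "q \<noteq> q'"
      using no_theta[of p r "[]" "[f]" "[q]"] adjs q(3) adj_sym[OF q'(3)] nq r \<open>p \<noteq> f\<close> by auto
    have 4: "\<not> adj E q q'"
      using no_theta[of p r "[]" "[f]" "[q, q']"] adjs q(3) adj_sym[OF q'(3)] nq r \<open>p \<noteq> f\<close> 3 by auto
    have False
    proof (rule hit[of "{q, q'}"])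
      show "indep E {q, q'}" using 4 adj_sym[of E q' q] by (auto simp: indep_def)
      show "\<forall>p\<in>P. adj E c p \<or> (\<exists>q\<in>{q, q'}. adj E p q)" using P3 cf q q' by auto
    qed (use q q' 1 2 in auto)
    then show ?thesis ..
  next
    case True
    have fp: "adj E f p" "adj E p f" using cl P(2) p \<open>p \<noteq> f\<close> by auto
    \<comment> \<open>Otherwise \<open>{x}\<close> alone is forbidden by \<open>hit\<close>. So
      every outer neighbour of \<open>p\<close> closes a 4-cycle with \<open>c\<close>, and two of
      them would form a theta graph.\<close>
    have allc: "adj E c x" if "x \<in> ?W" "x \<notin> P" "adj E p x" for x
    proof (rule ccontr)
      assume "\<not> ?thesis"
      then show False using hit[of "{x}"] that True cf by (auto simp: indep_def)
    qed
    have ne: "c \<noteq> f" "c \<noteq> p" "q \<noteq> f" "q \<noteq> p" using cP P(2) p q by auto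
    have uniq: "x = q" if "x \<in> ?W" "x \<notin> P" "adj E p x" for x
    proof (rule ccontr)
      assume "x \<noteq> q"
      moreover have "x \<noteq> f" "x \<noteq> p" "x \<noteq> c" using that P(2) p cB by auto
      ultimately show False
        using no_theta[of c p "[f]" "[q]" "[x]"] cf fp allc[OF that] allc[OF q] adj_sym[OF q(3)] adj_sym[OF that(3)] ne \<open>p \<noteq> f\<close> cq by auto
    qed
    have "nb E ?W p = {f, q}"
    proof
      show "nb E ?W p \<subseteq> {f, q}"
      proof
        fix x assume "x \<in> nb E ?W p"
        then have x: "x \<in> ?W" "adj E p x" by (auto simp: nb_def)
        then have "x \<noteq> p" by auto
        then show "x \<in> {f, q}" using uniq[OF x(1) _ x(2)] True by blast
      qed
      show "{f, q} \<subseteq> nb E ?W p" using fp(2) q P(1,2) by (auto simp: nb_def)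
    qed
    then have "nb E W p = {f, q}"
      using nb_terminal[OF assms(2), of p] p P(1) by auto
    moreover have "nb E W f = {c, p}"
      using nb_terminal[OF assms(2), of f] P True cf \<open>p \<noteq> f\<close> by auto
    moreover have "nb E W c \<noteq> {f, q}"
    proof -
      have "f \<in> nb E W c" "f \<notin> B" using cf P by (auto simp: nb_def)
      then have "nb E W c \<inter> B \<noteq> {}" using assms(2) by (auto simp: terminal_def)
      then show ?thesis using P q by auto
    qed
    moreover have "distinct [c, f, p, q]" using ne \<open>p \<noteq> f\<close> cq by auto
    moreover have "{c, f, p, q} \<subseteq> W" using cB P p q by auto
    ultimately have "quad_piece W P c f p q"
      using True allc[OF q] by (simp add: quad_piece_def)
    then show ?thesis by (auto simp: piece_def)
  qed
qed

text \<open>If \<open>c\<close> were adjacent to \<open>f\<close> or \<open>p\<close>, take a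
  maximal independent set of the rest that avoids the neighbours of \<open>c\<close> and contains
  the opposite vertex of the 4-cycle. It contains neither the vertex adjacent to \<open>c\<close>
  nor its two neighbours there.\<close>

lemma lift_quad_piece:
  assumes "well_covered E W" "terminal W B D c" "quad_piece (W - B) P s f p q"
  shows "quad_piece W P s f p q"
proof -
  let ?W = "W - B"
  have P: "P = {f, p}" "{s, f, p, q} \<subseteq> ?W" "distinct [s, f, p, q]"
    "nb E ?W f = {s, p}" "nb E ?W p = {f, q}" "adj E s q" "nb E ?W s \<noteq> {f, q}"
    using assms(3) by (simp_all add: quad_piece_def)
  have cB: "c \<in> B" "c \<in> W" using assms(2) by (auto simp: terminal_def)
  have adjs: "adj E f s" "adj E f p" "adj E p f" "adj E p q"
    using P(4,5) by (auto simp: nb_def)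
  have ne: "c \<noteq> s" "c \<noteq> f" "c \<noteq> p" "c \<noteq> q" using P(2) cB by auto
  have key: "\<not> adj E c x"
    if "x \<in> ?W" "z \<in> ?W" "nb E ?W x = {w, y}" "w \<in> ?W" "adj E y z" "adj E w z" "distinct [w, x, y, z]"
      "c \<notin> {w, x, y, z}" "nb E ?W y = {x, z}" for w x y z
  proof
    note H = that
    assume cx: "adj E c x"
    have xw: "adj E x w" "adj E x y" using that(3) by (auto simp: nb_def)
    have "\<not> adj E c z"
      using no_theta[of x z "[c]" "[y]" "[w]"] that xw adj_sym[OF cx] by auto
    then obtain K where K: "maxindep E ?W K" "{z} \<subseteq> K" "\<forall>u\<in>K. \<not> adj E c u"
      using terminal_extend[OF assms(1,2), of "{z}" thesis] H(2) by (simp add: indep_def)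
    have KW: "K \<subseteq> ?W" "indep E K" using K(1) by (auto simp: maxindep_def)
    have "x \<notin> K" using K cx by auto
    then obtain u where "u \<in> K" "adj E u x" using K(1) H(1) by (auto simp: maxindep_def)
    then have "u \<in> {w, y}" using KW adj_sym[of E u x] unfolding that(3)[symmetric] by (auto simp: nb_def)
    then show False using KW K(2) \<open>u \<in> K\<close> that(5,6) by (auto simp: indep_def)
  qed
  have "\<not> adj E c f" by (rule key[of f q s p]) (use P ne adjs in auto)
  moreover have "\<not> adj E c p"
    by (rule key[of p s q f]) (use P ne adjs adj_sym[of E s q] in auto)
  ultimately have "nb E W f = {s, p}" "nb E W p = {f, q}"
    using nb_terminal[OF assms(2)] P by auto
  moreover have "nb E W s \<noteq> {f, q}"
  proof
    assume "nb E W s = {f, q}"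
    then have "nb E ?W s = {f, q}" using P(2) by (auto simp: nb_def)
    then show False using P by simp
  qed
  ultimately show ?thesis using P by (auto simp: quad_piece_def)
qed

end

context cactus
begin

lemma cycle_ear_False:
  assumes "distinct vs" "successively (adj E) vs" "adj E (last vs) (hd vs)" "length vs \<ge> 3"
    and "u \<in> set vs" "v \<in> set vs" "u \<noteq> v" "path_between E u Q v" "Q \<noteq> []" "distinct Q" "set Q \<inter> set vs = {}"
  shows False
proof -
  obtain X Y where XY: "path_between E u X v" "path_between E u Y v"
    "distinct (u # v # X @ Y)" "set (u # v # X @ Y) = set vs" "X \<noteq> [] \<or> Y \<noteq> []"
    using cycle_two_paths_vertices[OF assms(1-7)] by blast
  then have "set Q \<inter> set (u # v # X @ Y) = {}" using assms(11) by simp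
  then have "distinct (u # v # X @ Q @ Y)" using XY(3) assms(10) by auto
  then show False using no_theta[of u v X Q Y] XY assms(8,9) by auto
qed

text \<open>\<open>c\<close> is adjacent to at most one vertex of the 5-cycle. If that vertex had no
  outer neighbour before, \<open>kill\<close> shows that its neighbours on the cycle have none, and
  the cycle is relabelled to put it at position \<open>v1\<close> or \<open>v3\<close>.\<close>

lemma lift_pent_piece:
  assumes "well_covered E W" "terminal W B D c" "pent_piece (W - B) P v1 v2 v3 v4 v5"
  shows "piece W P"
proof -
  let ?W = "W - B"
  have P: "P = {v1, v2, v3, v4, v5}" "P \<subseteq> ?W" "distinct [v1, v2, v3, v4, v5]"
    "nb E ?W v2 = {v1, v3}" "nb E ?W v4 = {v3, v5}" "nb E ?W v5 = {v4, v1}"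
    using assms(3) unfolding pent_piece_def by blast+
  have a: "adj E v1 v2" "adj E v2 v3" "adj E v3 v4" "adj E v4 v5" "adj E v5 v1"
    using assms(3) unfolding pent_piece_def by blast+
  note a' = a[THEN adj_sym]
  have cB: "c \<in> B" "c \<in> W" using assms(2) by (auto simp: terminal_def)
  have cP: "c \<notin> P" using P(2) cB by auto
  have one: "x = y" if "x \<in> P" "y \<in> P" "adj E c x" "adj E c y" for x y
  proof (rule ccontr)
    assume "x \<noteq> y"
    show False
      by (rule cycle_ear_False[of "[v1, v2, v3, v4, v5]" x y "[c]"])
        (use P a that \<open>x \<noteq> y\<close> cP adj_sym[OF that(3)] in auto)
  qed
  \<comment> \<open>The independent set \<open>{q, t}\<close> blocks the two neighbours
    \<open>y\<close> and \<open>u\<close> of \<open>x\<close>, while \<open>x\<close> itself is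
    blocked by \<open>c\<close>.\<close>
  have kill: False
    if "adj E c x" "q \<in> ?W" "q \<notin> P" "adj E y q" "P = {x, y, s, t, u}" "distinct [x, y, s, t, u]"
      "adj E x y" "adj E y s" "adj E s t" "adj E t u" "adj E u x" "nb E ?W x = {y, u}" for x y s t u q
  proof -
    note H = that
    note H' = H(7-11)[THEN adj_sym]
    have ne: "c \<noteq> x" "c \<noteq> y" "c \<noteq> s" "c \<noteq> t" "c \<noteq> u" using cP H(5) by auto
    have nq: "q \<noteq> x" "q \<noteq> y" "q \<noteq> s" "q \<noteq> t" "q \<noteq> u" "q \<noteq> c" using H(2,3,5) cB by auto
    have ct: "\<not> adj E c t" using one[of x t] H by auto
    have cq: "\<not> adj E c q"
      using no_theta[of x y "[]" "[c, q]" "[u, t, s]"] H H' adj_sym[OF H(1)] adj_sym[OF H(4)] ne nq by auto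
    have qt: "\<not> adj E q t"
      using no_theta[of y t "[q]" "[s]" "[x, u]"] H H' ne nq by auto
    have "indep E {q, t}" using qt adj_sym[of E t q] by (auto simp: indep_def)
    moreover have "{q, t} \<subseteq> ?W" using H(2,5) P(2) by auto
    ultimately obtain K where K: "maxindep E ?W K" "{q, t} \<subseteq> K" "\<forall>w\<in>K. \<not> adj E c w"
      using terminal_extend[OF assms(1,2), of "{q, t}"] cq ct by blast
    have KW: "K \<subseteq> ?W" "indep E K" using K(1) by (auto simp: maxindep_def)
    have "x \<in> ?W - K" using K(3) H(1,5) P(2) by auto
    then obtain w where w: "w \<in> K" "adj E w x" using K(1) by (auto simp: maxindep_def)
    then have "w \<in> nb E ?W x" using KW(1) adj_sym[OF w(2)] by (auto simp: nb_def)
    then have "w = y \<or> w = u" using H(12) by simp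
    then show False using w(1) KW(2) K(2) H(4,10) by (auto simp: indep_def)
  qed
  have chord: "\<not> adj E v1 v3"
    using no_theta[of v1 v3 "[]" "[v2]" "[v5, v4]"] P(3) a a' by auto
  have nb_out: "nb E W x = nb E ?W x" if "x \<in> P" "\<not> adj E c x" for x
    using nb_terminal[OF assms(2), of x] that P(2) by auto
  have v24: "\<not> adj E v2 v4" "\<not> adj E v2 v5" "\<not> adj E v4 v1" "\<not> adj E v5 v3"
    using P(1-3) P(4)[THEN equalityD1] P(5)[THEN equalityD1] P(6)[THEN equalityD1]
    by (auto simp: nb_def)
  have nb3: "nb E ?W v3 = {v2, v4}" if "\<And>q. q \<in> ?W \<Longrightarrow> q \<notin> P \<Longrightarrow> \<not> adj E v3 q"
  proof
    show "{v2, v4} \<subseteq> nb E ?W v3" using a a' P(1,2) by (auto simp: nb_def)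
    show "nb E ?W v3 \<subseteq> {v2, v4}"
    proof
      fix q assume "q \<in> nb E ?W v3"
      then have q: "q \<in> ?W" "adj E v3 q" by (auto simp: nb_def)
      then have "q \<in> P" using that by blast
      moreover have "q \<noteq> v1" "q \<noteq> v3" "q \<noteq> v5"
        using q(2) chord v24 adj_sym[of E v3] by auto
      ultimately show "q \<in> {v2, v4}" using P(1) by auto
    qed
  qed
  have nb1: "nb E ?W v1 = {v5, v2}" if "\<And>q. q \<in> ?W \<Longrightarrow> q \<notin> P \<Longrightarrow> \<not> adj E v1 q"
  proof
    show "{v5, v2} \<subseteq> nb E ?W v1" using a a' P(1,2) by (auto simp: nb_def)
    show "nb E ?W v1 \<subseteq> {v5, v2}"
    proof
      fix q assume "q \<in> nb E ?W v1"
      then have q: "q \<in> ?W" "adj E v1 q" by (auto simp: nb_def)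
      then have "q \<in> P" using that by blast
      moreover have "q \<noteq> v1" "q \<noteq> v3" "q \<noteq> v4"
        using q(2) chord v24 adj_sym[of E v1] by auto
      ultimately show "q \<in> {v5, v2}" using P(1) by auto
    qed
  qed
  have inP: "v1 \<in> P" "v2 \<in> P" "v3 \<in> P" "v4 \<in> P" "v5 \<in> P" using P(1) by auto
  have ne: "v1 \<noteq> v2" "v1 \<noteq> v3" "v1 \<noteq> v4" "v1 \<noteq> v5" "v2 \<noteq> v3" "v2 \<noteq> v4" "v2 \<noteq> v5" "v3 \<noteq> v4" "v3 \<noteq> v5" "v4 \<noteq> v5"
    using P(3) by auto
  have PW: "P \<subseteq> W" using P(2) by auto
  consider "\<not> adj E c v2" "\<not> adj E c v4" "\<not> adj E c v5" | "adj E c v2" | "adj E c v4" | "adj E c v5" by blast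
  then show ?thesis
  proof cases
    case 1
    then have "pent_piece W P v1 v2 v3 v4 v5"
      unfolding pent_piece_def using nb_out inP P PW a by simp
    then show ?thesis unfolding piece_def by blast
  next
    case 2
    then have no: "\<not> adj E c v1" "\<not> adj E c v3" "\<not> adj E c v4" "\<not> adj E c v5"
      using one[of v2] inP ne by blast+
    have P2: "P = {v2, v3, v4, v5, v1}" "P = {v2, v1, v5, v4, v3}" using P(1) by auto
    have "nb E ?W v3 = {v2, v4}"
      by (rule nb3, rule notI, rule kill[OF 2 _ _ _ P2(1)]) (use ne P(4) a in \<open>auto\<close>)
    moreover have "nb E ?W v1 = {v5, v2}"
      by (rule nb1, rule notI, rule kill[OF 2 _ _ _ P2(2)]) (use ne P(4) a' in \<open>auto\<close>)
    ultimately have "pent_piece W P v2 v3 v4 v5 v1"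
      unfolding pent_piece_def using nb_out inP P(6) PW P2 ne a no by simp
    then show ?thesis unfolding piece_def by blast
  next
    case 3
    then have no: "\<not> adj E c v1" "\<not> adj E c v2" "\<not> adj E c v3" "\<not> adj E c v5"
      using one[of v4] inP ne by blast+
    have P2: "P = {v4, v3, v2, v1, v5}" "P = {v4, v5, v1, v2, v3}" using P(1) by auto
    have "nb E ?W v3 = {v2, v4}"
      by (rule nb3, rule notI, rule kill[OF 3 _ _ _ P2(1)]) (use ne P(5) a' in \<open>auto\<close>)
    then have "pent_piece W P v4 v5 v1 v2 v3"
      unfolding pent_piece_def using nb_out inP P(4,6) PW P2(2) ne a no by (simp add: insert_commute)
    then show ?thesis unfolding piece_def by blast
  next
    case 4
    then have no: "\<not> adj E c v1" "\<not> adj E c v2" "\<not> adj E c v3" "\<not> adj E c v4"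
      using one[of v5] inP ne by blast+
    have P2: "P = {v5, v1, v2, v3, v4}" "P = {v3, v4, v5, v1, v2}" using P(1) by auto
    have "nb E ?W v1 = {v5, v2}"
      by (rule nb1, rule notI, rule kill[OF 4 _ _ _ P2(1)]) (use ne P(6) a in \<open>auto\<close>)
    then have "pent_piece W P v3 v4 v5 v1 v2"
      unfolding pent_piece_def using nb_out inP P(4,5) PW P2(2) ne a no by (simp add: insert_commute)
    then show ?thesis unfolding piece_def by blast
  qed
qed

lemma lift_piece:
  assumes "well_covered E W" "terminal W B D c" "piece (W - B) P"
  shows "piece W P"
proof -
  consider f where "clique_piece (W - B) P f" | v1 v2 v3 v4 v5 where "pent_piece (W - B) P v1 v2 v3 v4 v5"
    | s f p q where "quad_piece (W - B) P s f p q"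
    using assms(3) unfolding piece_def by blast
  then show ?thesis
  proof cases
    case 1
    then show ?thesis by (rule lift_clique_piece[OF assms(1,2)])
  next
    case 2
    then show ?thesis by (rule lift_pent_piece[OF assms(1,2)])
  next
    case 3
    then show ?thesis using lift_quad_piece[OF assms(1,2)] unfolding piece_def by blast
  qed
qed

end

section \<open>End blocks\<close>

context cactus
begin

definition separated :: "'a set \<Rightarrow> 'a \<Rightarrow> 'a set \<Rightarrow> bool" where
  "separated W c A \<longleftrightarrow> c \<in> W \<and> A \<subseteq> W \<and> A \<noteq> {} \<and> c \<notin> A \<and> (\<forall>a\<in>A. nb E W a \<subseteq> insert c A)"

definition end_cycle :: "'a set \<Rightarrow> nat \<Rightarrow> (nat \<Rightarrow> 'a) \<Rightarrow> bool" where
  "end_cycle W n c \<longleftrightarrow> n \<ge> 3 \<and> induced_cycle E n c \<and> c ` {..<n} \<subseteq> W \<and>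
    (\<forall>i<n. i \<noteq> 0 \<longrightarrow> nb E W (c i) \<subseteq> c ` {..<n})"

text \<open>A chord and the two arcs between its ends would be a theta graph.\<close>

lemma induced_cycle_of_list:
  assumes "distinct vs" "successively (adj E) vs" "adj E (last vs) (hd vs)" "length vs \<ge> 3"
  shows "induced_cycle E (length vs) (\<lambda>i. vs ! i)"
proof -
  let ?n = "length vs"
  have main: "adj E (vs ! i) (vs ! j) \<longleftrightarrow> j = Suc i mod ?n \<or> i = Suc j mod ?n" if ij_less: "i < j" "j < ?n" for i j
  proof
    assume ij: "adj E (vs ! i) (vs ! j)"
    obtain X Y where XY: "path_between E (vs ! i) X (vs ! j)" "path_between E (vs ! i) Y (vs ! j)"
      "distinct (vs ! i # vs ! j # X @ Y)" "X = [] \<longleftrightarrow> j = Suc i" "Y = [] \<longleftrightarrow> i = 0 \<and> Suc j = ?n"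
      by (rule cycle_two_paths[OF assms(1-3) ij_less])
    have "X = [] \<or> Y = []"
      using no_theta[of "vs ! i" "vs ! j" X "[]" Y] XY ij by auto
    then show "j = Suc i mod ?n \<or> i = Suc j mod ?n" using XY(4,5) that by auto
  next
    assume "j = Suc i mod ?n \<or> i = Suc j mod ?n"
    then have "j = Suc i \<or> (i = 0 \<and> Suc j = ?n)" using that by (auto simp: mod_Suc split: if_splits)
    then show "adj E (vs ! i) (vs ! j)"
    proof
      assume "j = Suc i"
      then show ?thesis using successively_nth[OF assms(2)] that by simp
    next
      assume *: "i = 0 \<and> Suc j = ?n"
      have "vs \<noteq> []" using assms(4) by auto
      then have "vs ! i = hd vs" "vs ! j = last vs"
        using * by (auto simp: hd_conv_nth last_conv_nth dest!: arg_cong[of "Suc j" _ "\<lambda>k. k - 1"])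
      then show ?thesis using assms(3) adj_sym by fastforce
    qed
  qed
  have "adj E (vs ! i) (vs ! j) \<longleftrightarrow> j = Suc i mod ?n \<or> i = Suc j mod ?n" if "i < ?n" "j < ?n" for i j
  proof -
    consider "i < j" | "j < i" | "i = j" by linarith
    then show ?thesis
    proof cases
      case 1
      then show ?thesis using main that by blast
    next
      case 2
      then show ?thesis using main[of j i] that adj_commute[of E "vs ! i"] by blast
    next
      case 3
      then show ?thesis using assms(4) that by (auto simp: mod_Suc split: if_splits)
    qed
  qed
  then show ?thesis unfolding induced_cycle_def using assms(1) by (auto simp: inj_on_def nth_eq_iff_index_eq)
qed


text \<open>Choose a separated part \<open>A\<close> of least size, attached at \<open>c\<close>.
  Minimality gives \<open>c\<close> two neighbours in \<open>A\<close> and connects them inside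
  \<open>A\<close>, hence a cycle through \<open>c\<close>. A component \<open>R\<close> of
  \<open>A\<close> off this cycle is joined to two of its vertices, which is an ear, or to at most
  one, which is a smaller separated part.\<close>

lemma end_cycle_exists:
  assumes "w0 \<in> W" "\<And>w. w \<in> W \<Longrightarrow> nb E W w \<noteq> {}" "\<And>w u. w \<in> W \<Longrightarrow> nb E W w \<noteq> {u}"
  shows "\<exists>n c. end_cycle W n c"
proof -
  obtain w1 where "w1 \<in> nb E W w0" using assms(1,2) by blast
  then have "w1 \<in> W - {w0}" by (auto simp: nb_def)
  then have "separated W w0 (W - {w0})" using assms(1) by (auto simp: separated_def nb_def)
  then have ex: "\<exists>p. separated W (fst p) (snd p)" by (metis fst_conv snd_conv)
  then obtain p where p: "separated W (fst p) (snd p)"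
    "\<And>p'. separated W (fst p') (snd p') \<Longrightarrow> card (snd p) \<le> card (snd p')"
    using ex_has_least_nat[of "\<lambda>p. separated W (fst p) (snd p)" _ "\<lambda>p. card (snd p)"] by blast
  obtain c A where cA: "p = (c, A)" by (cases p)
  have sep: "separated W c A" using p(1) cA by simp
  have min: "\<not> A' \<subset> A" if "separated W c' A'" for c' A'
    using p(2)[of "(c', A')"] that cA psubset_card_mono[of A A'] by auto
  have A: "c \<in> W" "A \<subseteq> W" "A \<noteq> {}" "c \<notin> A" "\<And>a. a \<in> A \<Longrightarrow> nb E W a \<subseteq> insert c A"
    using sep by (auto simp: separated_def)
  have two: "A - {a} \<noteq> {}" if "a \<in> A" for a
  proof
    assume "A - {a} = {}"
    then have "nb E W a \<subseteq> {c}" using A(5)[OF that] that by (auto simp: nb_def)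
    then show False using assms(2,3)[of a] A(2) that by blast
  qed
  \<comment> \<open>If \<open>c\<close> had no neighbour in \<open>A\<close> except possibly
    \<open>a\<close>, then \<open>a\<close> would separate the nonempty rest of
    \<open>A\<close>.\<close>
  have adjA: "\<exists>a'\<in>A. a' \<noteq> a \<and> adj E c a'" if "a \<in> A" for a
  proof (rule ccontr)
    assume no: "\<not> ?thesis"
    have "separated W a (A - {a})"
      unfolding separated_def
    proof (intro conjI ballI)
      fix x assume x: "x \<in> A - {a}"
      then have "c \<notin> nb E W x" using no adj_sym[of E x c] by (auto simp: nb_def)
      then show "nb E W x \<subseteq> insert a (A - {a})" using A(5)[of x] x by auto
    qed (use A two that in auto)
    then show False using min that by blast
  qed
  obtain a where a: "a \<in> A" "adj E c a" using adjA A(3) by blast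
  obtain a' where a': "a' \<in> A" "a' \<noteq> a" "adj E c a'" using adjA[OF a(1)] by blast
  have "separated W c (reach_in E A a)"
    unfolding separated_def
  proof (intro conjI ballI)
    show "reach_in E A a \<subseteq> W" "c \<notin> reach_in E A a" using reach_in_subset[of E A a] A a by auto
    show "reach_in E A a \<noteq> {}" using reach_in_self by fast
    fix x assume x: "x \<in> reach_in E A a"
    then have "x \<in> A" using reach_in_subset[of E A a] a by auto
    then show "nb E W x \<subseteq> insert c (reach_in E A a)"
      using A(5)[of x] reach_in_step[OF x] by (auto simp: nb_def)
  qed (use A in auto)
  then have "\<not> reach_in E A a \<subset> A" by (rule min)
  then have "a' \<in> reach_in E A a" using reach_in_subset[of E A a] a a' by auto
  then obtain q where q: "q \<noteq> []" "hd q = a" "last q = a'" "distinct q" "set q \<subseteq> insert a A" "successively (adj E) q"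
    by (rule reach_in_path)
  have qA: "set q \<subseteq> A" using q(5) a by auto
  define vs where "vs = c # q"
  have len: "length q \<ge> 2" using q(1-3) a'(2) by (cases q; cases "tl q") auto
  have vs: "distinct vs" "successively (adj E) vs" "adj E (last vs) (hd vs)" "length vs \<ge> 3"
    using q qA A(4) a(2) adj_sym[OF a'(3)] len by (auto simp: vs_def successively_Cons)
  have "set q = A"
  proof (rule ccontr)
    assume "set q \<noteq> A"
    then obtain x where x: "x \<in> A - set q" using qA by blast
    define R where "R = reach_in E (A - set q) x"
    have R: "x \<in> R" "R \<subseteq> A - set q"
      using reach_in_self reach_in_subset[of E "A - set q" x] x by (auto simp: R_def)
    have nbR: "nb E W y \<subseteq> R \<union> set vs" if "y \<in> R" for y
    proof
      fix z assume "z \<in> nb E W y"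
      then have z: "z \<in> insert c A" "adj E y z" using A(5)[of y] R(2) that by (auto simp: nb_def)
      then show "z \<in> R \<union> set vs"
        using reach_in_step[of y E "A - set q" x z] that by (auto simp: R_def vs_def)
    qed
    have Rsub: "R \<subset> A" using R q(1) qA by (cases q) auto
    show False
    proof (cases "\<exists>u\<in>set vs. \<exists>v\<in>set vs. u \<noteq> v \<and> (\<exists>y\<in>R. adj E y u) \<and> (\<exists>z\<in>R. adj E z v)")
      case True
      then obtain u v y z where uv: "u \<in> set vs" "v \<in> set vs" "u \<noteq> v" "y \<in> R" "adj E y u" "z \<in> R" "adj E z v" by blast
      have "x \<in> reach_in E (A - set q) y" using uv(4) x by (auto simp: R_def intro: reach_in_sym)
      then have "z \<in> reach_in E (A - set q) y" using uv(6) reach_in_trans by (fastforce simp: R_def)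
      then obtain Q where Q: "Q \<noteq> []" "hd Q = y" "last Q = z" "distinct Q" "set Q \<subseteq> insert y (A - set q)" "successively (adj E) Q"
        by (rule reach_in_path)
      have "set Q \<subseteq> A - set q" using Q(5) uv(4) R(2) by auto
      then have "set Q \<inter> set vs = {}" using A(4) by (auto simp: vs_def)
      moreover have "path_between E u Q v"
        unfolding path_between_def using Q uv(7) adj_sym[OF uv(5)]
        by (auto simp: successively_Cons successively_append_iff)
      ultimately show False using cycle_ear_False[OF vs uv(1-3), of Q] Q by blast
    next
      case False
      \<comment> \<open>The default \<open>c\<close> covers the case that nothing in
        \<open>R\<close> is joined to the cycle.\<close>
      define u where "u = (if \<exists>u\<in>set vs. \<exists>y\<in>R. adj E y u then SOME u. u \<in> set vs \<and> (\<exists>y\<in>R. adj E y u) else c)"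
      have u: "u \<in> set vs" "\<And>v y. v \<in> set vs \<Longrightarrow> y \<in> R \<Longrightarrow> adj E y v \<Longrightarrow> v = u"
      proof -
        have *: "u \<in> set vs \<and> (\<exists>y\<in>R. adj E y u)" if "\<exists>u\<in>set vs. \<exists>y\<in>R. adj E y u"
          using someI_ex[of "\<lambda>u. u \<in> set vs \<and> (\<exists>y\<in>R. adj E y u)"] that unfolding u_def by auto
        then show "u \<in> set vs" by (cases "\<exists>u\<in>set vs. \<exists>y\<in>R. adj E y u") (auto simp: u_def vs_def)
        show "v = u" if "v \<in> set vs" "y \<in> R" "adj E y v" for v y
          using False * that by blast
      qed
      have "separated W u R"
        unfolding separated_def
      proof (intro conjI ballI)
        show "u \<in> W" "R \<subseteq> W" "u \<notin> R" using u(1) R A qA by (auto simp: vs_def)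
        show "R \<noteq> {}" using R by auto
        fix y assume y: "y \<in> R"
        show "nb E W y \<subseteq> insert u R"
          using nbR[OF y] u(2)[OF _ y] by (auto simp: nb_def)
      qed
      then show False using min Rsub by blast
    qed
  qed
  then have set_vs: "set vs = insert c A" by (simp add: vs_def)
  have img: "(\<lambda>i. vs ! i) ` {..<length vs} = set vs" by (auto simp: set_conv_nth)
  have "end_cycle W (length vs) (\<lambda>i. vs ! i)"
    unfolding end_cycle_def img
  proof (intro conjI allI impI)
    show "induced_cycle E (length vs) (\<lambda>i. vs ! i)" by (rule induced_cycle_of_list[OF vs])
    show "set vs \<subseteq> W" using set_vs A by auto
    fix i assume "i < length vs" "i \<noteq> 0"
    then have "vs ! i \<in> set q" by (cases i) (auto simp: vs_def)
    then show "nb E W (vs ! i) \<subseteq> set vs" using A(5) \<open>set q = A\<close> set_vs by auto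
  qed (rule vs(4))
  then show ?thesis by blast
qed

end

context cactus
begin

section \<open>Possible lengths of end cycles\<close>

lemma end_cycle_adj:
  assumes "end_cycle W n c" "i < n" "j < n"
  shows "adj E (c i) (c j) \<longleftrightarrow> j = Suc i mod n \<or> i = Suc j mod n"
  using assms by (auto simp: end_cycle_def induced_cycle_def)

lemma end_cycle_eq:
  assumes "end_cycle W n c" "i < n" "j < n"
  shows "c i = c j \<longleftrightarrow> i = j"
  using assms by (auto simp: end_cycle_def induced_cycle_def inj_on_def)

lemma end_cycle_nb:
  assumes "end_cycle W n c" "0 < i" "i < n"
  shows "nb E W (c i) = {c (i - 1), c (Suc i mod n)}"
proof
  have n: "n \<ge> 3" "c ` {..<n} \<subseteq> W" "nb E W (c i) \<subseteq> c ` {..<n}"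
    using assms by (auto simp: end_cycle_def)
  show "nb E W (c i) \<subseteq> {c (i - 1), c (Suc i mod n)}"
  proof
    fix x assume x: "x \<in> nb E W (c i)"
    then obtain j where j: "j < n" "x = c j" using n(3) by auto
    then have "j = Suc i mod n \<or> i = Suc j mod n"
      using x end_cycle_adj[OF assms(1) assms(3) j(1)] by (auto simp: nb_def)
    then show "x \<in> {c (i - 1), c (Suc i mod n)}"
      using j assms(2) by (auto simp: mod_Suc split: if_splits)
  qed
  have "adj E (c i) (c (i - 1))" "adj E (c i) (c (Suc i mod n))"
    using assms n(1) by (auto simp: end_cycle_adj[OF assms(1)])
  then show "{c (i - 1), c (Suc i mod n)} \<subseteq> nb E W (c i)"
    using n assms by (auto simp: nb_def)
qed

text \<open>Cycles of length 6 or at least 8: trade \<open>c 3\<close> for \<open>c 2\<close> and \<open>c 4\<close>.\<close>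

lemma end_cycle_length:
  assumes "well_covered E W" "end_cycle W n c"
  shows "n \<in> {3, 4, 5, 7}"
proof (rule ccontr)
  assume "n \<notin> {3, 4, 5, 7}"
  then have n: "n = 6 \<or> n \<ge> 8" using assms(2) by (auto simp: end_cycle_def)
  \<comment> \<open>\<open>c m\<close> must keep \<open>c 5\<close> out of \<open>I\<close>, as
    \<open>c 0\<close> does with \<open>c 1\<close>. For length 6 this is \<open>c 0\<close> itself,
    otherwise \<open>c 6\<close>; for length 7 the latter is adjacent to \<open>c 0\<close>, so that
    case escapes.\<close>
  define m where "m = (if n = 6 then 0 else 6 :: nat)"
  have m: "m < n" using n by (auto simp: m_def)
  have CW: "c ` {..<n} \<subseteq> W" using assms(2) by (simp add: end_cycle_def)
  note adj = end_cycle_adj[OF assms(2)] and eq = end_cycle_eq[OF assms(2)]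
  have "indep E {c 0, c 3, c m}"
    using n by (auto simp: indep_def m_def adj)
  moreover have "{c 0, c 3, c m} \<subseteq> W" using CW n m by auto
  ultimately obtain I where I: "maxindep E W I" "{c 0, c 3, c m} \<subseteq> I" using extend_maxindep by blast
  have IW: "I \<subseteq> W" "indep E I" using I(1) by (auto simp: maxindep_def)
  have no: "c i \<notin> I" if "i < n" "j < n" "c j \<in> I" "adj E (c i) (c j)" for i j
    using IW that by (auto simp: indep_def)
  have not: "c 1 \<notin> I" "c 2 \<notin> I" "c 4 \<notin> I" "c 5 \<notin> I"
    using no[of 1 0] no[of 2 3] no[of 4 3] no[of 5 m] I(2) n m by (auto simp: adj m_def)
  have nb2: "nb E W (c 2) = {c 1, c 3}" and nb4: "nb E W (c 4) = {c 3, c 5}"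
    using end_cycle_nb[OF assms(2), of 2] end_cycle_nb[OF assms(2), of 4] n by auto
  define J where "J = insert (c 2) (insert (c 4) (I - {c 3}))"
  have "indep E J"
  proof -
    have "\<not> adj E u (c 2)" "\<not> adj E u (c 4)" if "u \<in> I - {c 3}" for u
    proof -
      have "u \<notin> nb E W (c 2)" "u \<notin> nb E W (c 4)" using that not nb2 nb4 by auto
      then show "\<not> adj E u (c 2)" "\<not> adj E u (c 4)"
        using that IW adj_sym[of E u "c 2"] adj_sym[of E u "c 4"] by (auto simp: nb_def)
    qed
    moreover have "\<not> adj E (c 4) (c 2)" using n by (auto simp: adj)
    ultimately show ?thesis
      unfolding J_def using indep_mono[OF IW(2), of "I - {c 3}"] by (auto simp: indep_insert)
  qed
  moreover have "J \<subseteq> W" using IW CW n by (auto simp: J_def)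
  ultimately have "card J \<le> card I" using assms(1) I(1) by (auto simp: well_covered_def)
  moreover have "card J = card I + 1"
  proof -
    have "c 2 \<noteq> c 4" using n by (auto simp: eq)
    then have "card J = Suc (Suc (card (I - {c 3})))" using not by (auto simp: J_def)
    then show ?thesis using I(2) by (simp add: card_Suc_Diff1 del: card_Diff_insert)
  qed
  ultimately show False by simp
qed

text \<open>Let \<open>F\<close> be maximal independent off the cycle and off the neighbours of
  \<open>c 0\<close>. A vertex \<open>y\<close> off the cycle not dominated by \<open>F\<close> must
  be adjacent to \<open>c 0\<close>. Then \<open>F\<close> with \<open>S\<close> is maximal, while
  \<open>F\<close> with \<open>T\<close> and \<open>y\<close> is independent and larger by one. So
  exactly the cycle is left undominated.\<close>

lemma end_cycle_link:
  assumes "well_covered E W" "end_cycle W n c"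
    and ST: "S \<subseteq> {..<n}" "T \<subseteq> {..<n}" "0 \<in> S" "0 \<notin> T" "card S = card T" "indep E (c ` S)" "indep E (c ` T)"
    and dom: "\<And>i. i < n \<Longrightarrow> i \<notin> S \<Longrightarrow> \<exists>j\<in>S. adj E (c j) (c i)"
  shows "\<exists>F\<subseteq>W. indep E F \<and> W - closed_nbhd E F = c ` {..<n}"
proof -
  let ?B = "c ` {..<n}"
  have B: "?B \<subseteq> W" "\<And>i. i < n \<Longrightarrow> i \<noteq> 0 \<Longrightarrow> nb E W (c i) \<subseteq> ?B" "inj_on c {..<n}" "n \<ge> 3"
    using assms(2) by (auto simp: end_cycle_def induced_cycle_def)
  obtain F where F: "maxindep E (W - ?B - nb E W (c 0)) F"
    using extend_maxindep[of "{}"] by auto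
  have FW: "F \<subseteq> W" "F \<inter> ?B = {}" "indep E F" "\<And>x. x \<in> F \<Longrightarrow> \<not> adj E (c 0) x"
    using F by (auto simp: maxindep_def nb_def)
  have Fc: "\<not> adj E x (c i)" if "x \<in> F" "i < n" for x i
  proof (cases "i = 0")
    case True
    then show ?thesis using FW(4) that adj_sym[of E x "c 0"] by auto
  next
    case False
    then show ?thesis using B(2)[OF that(2)] FW that adj_sym[of E x "c i"] by (auto simp: nb_def)
  qed
  have "W - closed_nbhd E F = ?B"
  proof (rule ccontr)
    assume ne: "W - closed_nbhd E F \<noteq> ?B"
    have "?B \<subseteq> W - closed_nbhd E F" using B(1) FW(2) Fc by (auto simp: closed_nbhd_def)
    then obtain y where y: "y \<in> W" "y \<notin> closed_nbhd E F" "y \<notin> ?B" using ne by blast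
    have y0: "y \<notin> F" "\<And>x. x \<in> F \<Longrightarrow> \<not> adj E x y" using y(2) by (auto simp: closed_nbhd_def)
    have yT: "\<not> adj E (c i) y" if "i \<in> T" for i
    proof -
      have "i < n" "i \<noteq> 0" using ST(2,4) that by (blast, metis)
      then show ?thesis using B(2)[of i] y by (auto simp: nb_def)
    qed
    have SB: "c ` S \<subseteq> ?B" "c ` T \<subseteq> ?B" using ST(1,2) by auto
    have "maxindep E W (F \<union> c ` S)"
      unfolding maxindep_def
    proof (intro conjI ballI)
      show "F \<union> c ` S \<subseteq> W" using FW(1) B(1) SB(1) by blast
      show "indep E (F \<union> c ` S)" using FW(3) ST(1,6) Fc by (auto simp: indep_Un)
      fix v assume v: "v \<in> W - (F \<union> c ` S)"
      consider "v \<in> ?B" | "adj E (c 0) v" | "v \<in> W - ?B - nb E W (c 0) - F" using v by (auto simp: nb_def)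
      then show "\<exists>u\<in>F \<union> c ` S. adj E u v"
      proof cases
        case 1
        then obtain i where "i < n" "v = c i" by auto
        then show ?thesis using dom[of i] v by auto
      next
        case 2
        then show ?thesis using ST(3) by auto
      next
        case 3
        then show ?thesis using F by (auto simp: maxindep_def)
      qed
    qed
    moreover have "insert y (F \<union> c ` T) \<subseteq> W" using FW(1) B(1) SB(2) y(1) by blast
    moreover have "indep E (insert y (F \<union> c ` T))"
      using FW(3) ST(2,7) Fc y0(2) yT by (auto simp: indep_Un indep_insert)
    ultimately have "card (insert y (F \<union> c ` T)) \<le> card (F \<union> c ` S)"
      using assms(1) unfolding well_covered_def by blast
    moreover have "F \<inter> c ` S = {}" "F \<inter> c ` T = {}" using FW(2) SB by blast+
    then have "card (F \<union> c ` S) = card F + card S" "card (F \<union> c ` T) = card F + card T"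
      using card_Un_disjoint[of F "c ` S"] card_Un_disjoint[of F "c ` T"]
        card_image[OF inj_on_subset[OF B(3) ST(1)]] card_image[OF inj_on_subset[OF B(3) ST(2)]] by auto
    moreover have "y \<notin> F \<union> c ` T" using y0(1) y(3) SB(2) by blast
    ultimately show False using ST(5) by simp
  qed
  then show ?thesis using FW by blast
qed

lemma end_cycle_3_or_5:
  assumes "well_covered E W" "no_cycle_link E W" "end_cycle W n c"
  shows "n = 3 \<or> n = 5"
proof (rule ccontr)
  assume "\<not> ?thesis"
  then have n: "n = 4 \<or> n = 7" using end_cycle_length[OF assms(1,3)] by auto
  note adj = end_cycle_adj[OF assms(3)]
  have "\<exists>F\<subseteq>W. indep E F \<and> W - closed_nbhd E F = c ` {..<n}"
    using n
  proof
    assume n: "n = 4"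
    show ?thesis
    proof (rule end_cycle_link[OF assms(1,3), of "{0, 2}" "{1, 3}"])
      fix i assume "i < n" "i \<notin> {0, 2}"
      then have "i = 1 \<or> i = 3" using n by auto
      then show "\<exists>j\<in>{0, 2}. adj E (c j) (c i)" using n by (auto simp: adj)
    qed (use n in \<open>auto simp: indep_def adj\<close>)
  next
    assume n: "n = 7"
    show ?thesis
    proof (rule end_cycle_link[OF assms(1,3), of "{0, 2, 4}" "{1, 3, 5}"])
      fix i assume "i < n" "i \<notin> {0, 2, 4}"
      then have "i = 1 \<or> i = 3 \<or> i = 5 \<or> i = 6" using n by auto
      then show "\<exists>j\<in>{0, 2, 4}. adj E (c j) (c i)" using n by (auto simp: adj)
    qed (use n in \<open>auto simp: indep_def adj\<close>)
  qed
  then obtain F where F: "F \<subseteq> W" "indep E F" "W - closed_nbhd E F = c ` {..<n}" by blast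
  have "n \<in> {4, 7}" "induced_cycle E n c" using n assms(3) by (auto simp: end_cycle_def)
  then show False using assms(2) F unfolding no_cycle_link_def by (elim allE[of _ F] allE[of _ n] allE[of _ c]) simp
qed

lemma terminal_of_end_cycle:
  assumes "well_covered E W" "no_cycle_link E W" "end_cycle W n c"
  shows "\<exists>B D x. terminal W B D x \<and> piece W B"
  using end_cycle_3_or_5[OF assms]
proof
  note adj = end_cycle_adj[OF assms(3)] and eq = end_cycle_eq[OF assms(3)]
  have CW: "c ` {..<n} \<subseteq> W" using assms(3) by (simp add: end_cycle_def)
  {
    assume n: "n = 3"
    let ?B = "{c 0, c 1, c 2}"
    have BW: "?B \<subseteq> W" using CW n by auto
    have a: "adj E (c 0) (c 1)" "adj E (c 1) (c 0)" "adj E (c 0) (c 2)" "adj E (c 2) (c 0)" "adj E (c 1) (c 2)" "adj E (c 2) (c 1)"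
      using n by (auto simp: adj)
    have nb1: "nb E W (c 1) = {c 0, c 2}" and nb2: "nb E W (c 2) = {c 1, c 0}"
      using end_cycle_nb[OF assms(3), of 1] end_cycle_nb[OF assms(3), of 2] n
      by (simp_all add: numeral_2_eq_2)
    have ne: "c 0 \<noteq> c 1" "c 0 \<noteq> c 2" "c 1 \<noteq> c 2" using n by (auto simp: eq)
    have "clique_piece W ?B (c 1)"
      using BW a nb1 ne by (auto simp: clique_piece_def)
    moreover have "terminal W ?B {c 1} (c 0)"
      unfolding terminal_def
    proof (intro conjI)
      show "W \<inter> closed_nbhd E {c 1} = ?B"
        using nb1 BW by (auto simp: closed_nbhd_def nb_def)
      show "\<forall>I\<subseteq>?B. indep E I \<longrightarrow> card I \<le> card {c 1}"
      proof (intro allI impI)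
        fix I assume I: "I \<subseteq> ?B" "indep E I"
        have "u = v" if "u \<in> I" "v \<in> I" for u v
        proof -
          have "u \<in> ?B" "v \<in> ?B" "\<not> adj E u v" using I that by (auto simp: indep_def)
          then show ?thesis using a by auto
        qed
        then show "card I \<le> card {c 1}" by (simp add: card_le_Suc0_iff_eq)
      qed
      show "nb E W (c 0) \<subseteq> ?B \<or> nb E W (c 0) \<inter> ?B \<noteq> {}" using a BW by (auto simp: nb_def)
      show "\<forall>u\<in>?B. u \<noteq> c 0 \<longrightarrow> nb E W u \<subseteq> ?B" using nb1 nb2 by auto
    qed (use BW in \<open>auto simp: indep_def\<close>)
    ultimately show ?thesis unfolding piece_def by blast
  }
  {
    assume n: "n = 5"
    let ?B = "{c 0, c 1, c 2, c 3, c 4}"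
    have BW: "?B \<subseteq> W" using CW n by auto
    have a: "adj E (c 0) (c 1)" "adj E (c 1) (c 2)" "adj E (c 2) (c 3)" "adj E (c 3) (c 4)" "adj E (c 4) (c 0)"
      using n by (auto simp: adj)
    note a' = a[THEN adj_sym]
    have nbs: "nb E W (c 1) = {c 0, c 2}" "nb E W (c 2) = {c 1, c 3}" "nb E W (c 3) = {c 2, c 4}" "nb E W (c 4) = {c 3, c 0}"
      using end_cycle_nb[OF assms(3), of 1] end_cycle_nb[OF assms(3), of 2]
        end_cycle_nb[OF assms(3), of 3] end_cycle_nb[OF assms(3), of 4] n
      by (simp_all add: numeral_2_eq_2)
    have ne: "distinct [c 0, c 1, c 2, c 3, c 4]" using n by (auto simp: eq)
    have "pent_piece W ?B (c 0) (c 1) (c 2) (c 3) (c 4)"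
      unfolding pent_piece_def using BW a nbs ne by simp
    moreover have "terminal W ?B {c 1, c 3} (c 0)"
      unfolding terminal_def
    proof (intro conjI)
      show "W \<inter> closed_nbhd E {c 1, c 3} = ?B"
        using nbs(1,3) BW by (auto simp: closed_nbhd_def nb_def)
      show "\<forall>I\<subseteq>?B. indep E I \<longrightarrow> card I \<le> card {c 1, c 3}"
      proof (intro allI impI)
        fix I assume I: "I \<subseteq> ?B" "indep E I"
        have 1: "card (I \<inter> {u, v}) \<le> Suc 0" if "adj E u v" for u v
          using I(2) that adj_sym[OF that] by (subst card_le_Suc0_iff_eq) (auto simp: indep_def)
        have "card (I \<inter> {c 0, c 1}) + card (I \<inter> {c 2, c 3}) \<le> 2" using 1[OF a(1)] 1[OF a(3)] by simp
        show "card I \<le> card {c 1, c 3}"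
        \<comment> \<open>Without \<open>c 4\<close> the other vertices split into two edges; with
          it, \<open>c 0\<close> and \<open>c 3\<close> are excluded and one edge remains.\<close>
        proof (cases "c 4 \<in> I")
          case False
          then have "I = (I \<inter> {c 0, c 1}) \<union> (I \<inter> {c 2, c 3})" using I(1) by auto
          then have "card I \<le> card (I \<inter> {c 0, c 1}) + card (I \<inter> {c 2, c 3})" by (metis card_Un_le)
          then show ?thesis using 1[OF a(1)] 1[OF a(3)] ne by simp
        next
          case True
          then have "I \<subseteq> insert (c 4) (I \<inter> {c 1, c 2})" using I a a' by (auto simp: indep_def)
          then have "card I \<le> card (insert (c 4) (I \<inter> {c 1, c 2}))" by (intro card_mono) auto
          also have "\<dots> \<le> Suc (card (I \<inter> {c 1, c 2}))" by (rule card_insert_le_m1[THEN order_trans]) auto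
          finally show ?thesis using 1[OF a(2)] ne by simp
        qed
      qed
      show "indep E {c 1, c 3}" using n by (auto simp: indep_def adj)
      show "nb E W (c 0) \<subseteq> ?B \<or> nb E W (c 0) \<inter> ?B \<noteq> {}" using a BW by (auto simp: nb_def)
      show "\<forall>u\<in>?B. u \<noteq> c 0 \<longrightarrow> nb E W u \<subseteq> ?B" using nbs by auto
    qed (use BW in auto)
    ultimately show ?thesis unfolding piece_def by blast
  }
qed

text \<open>An isolated vertex, or a leaf with its neighbour, is an end block; otherwise all degrees
  are at least two and an end cycle exists.\<close>

lemma terminal_exists:
  assumes "W \<noteq> {}" "well_covered E W" "no_cycle_link E W"
  shows "\<exists>B D x. terminal W B D x \<and> piece W B"
proof -
  consider w where "w \<in> W" "nb E W w = {}" | w u where "w \<in> W" "nb E W w = {u}"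
    | "\<And>w. w \<in> W \<Longrightarrow> nb E W w \<noteq> {}" "\<And>w u. w \<in> W \<Longrightarrow> nb E W w \<noteq> {u}" by blast
  then show ?thesis
  proof cases
    case 1
    have "clique_piece W {w} w" using 1 by (auto simp: clique_piece_def)
    moreover have "terminal W {w} {w} w"
      using 1 card_mono[of "{w}"] by (auto simp: terminal_def indep_def closed_nbhd_def nb_def)
    ultimately show ?thesis unfolding piece_def by blast
  next
    case 2
    have "u \<in> nb E W w" using 2(2) by simp
    then have u: "adj E w u" "adj E u w" "u \<in> W" "u \<noteq> w"
      using adj_sym[of E w u] by (auto simp: nb_def)
    have "clique_piece W {w, u} w" using 2 u by (auto simp: clique_piece_def)
    moreover have "terminal W {w, u} {w} u"
      unfolding terminal_def
    proof (intro conjI)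
      show "W \<inter> closed_nbhd E {w} = {w, u}" using 2 by (auto simp: closed_nbhd_def nb_def)
      show "\<forall>I\<subseteq>{w, u}. indep E I \<longrightarrow> card I \<le> card {w}"
      proof (intro allI impI)
        fix I assume I: "I \<subseteq> {w, u}" "indep E I"
        have "x = y" if "x \<in> I" "y \<in> I" for x y using I that u by (auto simp: indep_def)
        then show "card I \<le> card {w}" by (simp add: card_le_Suc0_iff_eq)
      qed
      show "nb E W u \<subseteq> {w, u} \<or> nb E W u \<inter> {w, u} \<noteq> {}" using 2 u by (auto simp: nb_def)
    qed (use 2 u in \<open>auto simp: indep_def\<close>)
    ultimately show ?thesis unfolding piece_def by blast
  next
    case 3
    then show ?thesis using end_cycle_exists[of _ W] terminal_of_end_cycle[OF assms(2,3)] assms(1) by blast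
  qed
qed

theorem piece_partition:
  assumes "well_covered E W" "no_cycle_link E W"
  shows "\<exists>\<P>. \<Union>\<P> = W \<and> (\<forall>P\<in>\<P>. \<forall>Q\<in>\<P>. P \<noteq> Q \<longrightarrow> P \<inter> Q = {}) \<and> (\<forall>P\<in>\<P>. piece W P)"
  using assms
proof (induction "card W" arbitrary: W rule: less_induct)
  case less
  show ?case
  proof (cases "W = {}")
    case True
    then show ?thesis by (intro exI[of _ "{}"]) auto
  next
    case False
    then obtain B D x where B: "terminal W B D x" "piece W B"
      using terminal_exists less.prems by blast
    have D: "D \<subseteq> W" "indep E D" "W \<inter> closed_nbhd E D = B" "B \<subseteq> W" "x \<in> B" using B(1) by (auto simp: terminal_def)
    then have eq: "W - closed_nbhd E D = W - B" by auto
    have smaller: "card (W - B) < card W" using D by (intro psubset_card_mono) auto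
    have link: "well_covered E (W - B)" "no_cycle_link E (W - B)"
      using well_covered_link[OF less.prems(1) D(1,2)] no_cycle_link_link[OF less.prems(2) D(1,2)] eq by auto
    obtain \<P> where \<P>: "\<Union>\<P> = W - B" "\<forall>P\<in>\<P>. \<forall>Q\<in>\<P>. P \<noteq> Q \<longrightarrow> P \<inter> Q = {}" "\<forall>P\<in>\<P>. piece (W - B) P"
      using less.hyps[OF smaller link] by (elim exE conjE)
    have "\<forall>P\<in>\<P>. piece W P" using \<P>(3) by (intro ballI lift_piece[OF less.prems(1) B(1)]) simp
    moreover have "\<forall>P\<in>\<P>. P \<inter> B = {}" using \<P>(1) by blast
    moreover have "\<Union>(insert B \<P>) = W" using \<P>(1) D(4) by auto
    ultimately show ?thesis using \<P>(2) B(2) by (intro exI[of _ "insert B \<P>"]) auto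
  qed
qed

end

section \<open>Exchanges between independent sets\<close>

text \<open>If the \<open>I i\<close> are the complements of \<open>k\<close> covers, then the exponent of \<open>v\<close> in the product of these
  covers is \<open>k - incidence k I v\<close>.\<close>

definition incidence :: "nat \<Rightarrow> (nat \<Rightarrow> 'a set) \<Rightarrow> 'a \<Rightarrow> nat" where
  "incidence k I v = (\<Sum>i<k. of_bool (v \<in> I i))"

lemma sum_of_bool_pos:
  assumes "(\<Sum>i<k. of_bool (R i) :: nat) > 0"
  shows "\<exists>i<k. R i"
proof (rule ccontr)
  assume "\<not> ?thesis"
  then have "(\<Sum>i<k. of_bool (R i) :: nat) = 0" by (intro sum.neutral) auto
  then show False using assms by linarith
qed

lemma incidence_pos: "incidence k I v > 0 \<Longrightarrow> \<exists>i<k. v \<in> I i"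
  unfolding incidence_def by (rule sum_of_bool_pos)

context cactus
begin

text \<open>On exponents: multiply the product of covers by the variable \<open>t\<close> and divide
  by the variable \<open>j\<close>. Independence of the new sets suffices because every vertex
  cover, minimal or not, gives a member of the cover ideal.\<close>

definition exchangeable :: "nat \<Rightarrow> (nat \<Rightarrow> 'a set) \<Rightarrow> 'a \<Rightarrow> 'a \<Rightarrow> bool" where
  "exchangeable k I t j \<longleftrightarrow> (\<exists>I'. (\<forall>i<k. indep E (I' i)) \<and>
     (\<forall>v. incidence k I' v + of_bool (v = t) = incidence k I v + of_bool (v = j)))"

lemma exchangeable_single:
  assumes "\<And>i. i < k \<Longrightarrow> indep E (I i)" "m < k" "t \<in> I m" "j \<notin> I m" "indep E (insert j (I m - {t}))"
  shows "exchangeable k I t j"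
  unfolding exchangeable_def
proof (intro exI[of _ "I(m := insert j (I m - {t}))"] conjI allI impI)
  fix i assume "i < k"
  then show "indep E ((I(m := insert j (I m - {t}))) i)" using assms by simp
next
  fix v
  let ?I' = "I(m := insert j (I m - {t}))"
  have split: "incidence k X v = of_bool (v \<in> X m) + (\<Sum>i\<in>{..<k} - {m}. of_bool (v \<in> X i))" for X :: "nat \<Rightarrow> 'a set"
    unfolding incidence_def using assms(2) by (subst sum.remove[of _ m]) auto
  have "(\<Sum>i\<in>{..<k} - {m}. of_bool (v \<in> ?I' i)) = (\<Sum>i\<in>{..<k} - {m}. of_bool (v \<in> I i) :: nat)"
    by (intro sum.cong) auto
  then show "incidence k ?I' v + of_bool (v = t) = incidence k I v + of_bool (v = j)"
    unfolding split[of ?I'] split[of I] using assms(3,4) by auto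
qed

lemma exchangeable_double:
  assumes "\<And>i. i < k \<Longrightarrow> indep E (I i)" "m < k" "n < k" "m \<noteq> n" "indep E X" "indep E Y"
    and "\<And>v. of_bool (v \<in> X) + of_bool (v \<in> Y) + of_bool (v = t) =
      (of_bool (v \<in> I m) + of_bool (v \<in> I n) + of_bool (v = j) :: nat)"
  shows "exchangeable k I t j"
  unfolding exchangeable_def
proof (intro exI[of _ "I(m := X, n := Y)"] conjI allI impI)
  fix i assume "i < k"
  then show "indep E ((I(m := X, n := Y)) i)" using assms by simp
next
  fix v
  let ?I' = "I(m := X, n := Y)"
  have split: "incidence k Z v = of_bool (v \<in> Z m) + (of_bool (v \<in> Z n) + (\<Sum>i\<in>{..<k} - {m} - {n}. of_bool (v \<in> Z i)))" for Z :: "nat \<Rightarrow> 'a set"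
    unfolding incidence_def using assms(2-4) by (subst sum.remove[of _ m], simp, simp, subst sum.remove[of _ n]) auto
  have "(\<Sum>i\<in>{..<k} - {m} - {n}. of_bool (v \<in> ?I' i)) = (\<Sum>i\<in>{..<k} - {m} - {n}. of_bool (v \<in> I i) :: nat)"
    by (intro sum.cong) auto
  then show "incidence k ?I' v + of_bool (v = t) = incidence k I v + of_bool (v = j)"
    unfolding split[of ?I'] split[of I] using assms(4) assms(7)[of v] by simp
qed

section \<open>Exchanges within each kind of piece\<close>

lemma maxindep_mem_iff:
  assumes "maxindep E UNIV K" "nb E UNIV x = N"
  shows "x \<in> K \<longleftrightarrow> N \<inter> K = {}"
proof
  show "N \<inter> K = {}" if "x \<in> K" using assms that by (auto simp: maxindep_def indep_def nb_def)
  show "x \<in> K" if "N \<inter> K = {}"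
  proof (rule ccontr)
    assume "x \<notin> K"
    then obtain u where "u \<in> K" "adj E u x" using assms(1) by (auto simp: maxindep_def)
    then have "u \<in> N \<inter> K" using assms(2) adj_sym[of E u x] by (auto simp: nb_def)
    then show False using that by blast
  qed
qed

lemma indep_swap:
  assumes "indep E K" "nb E UNIV j \<inter> (K - {t}) = {}"
  shows "indep E (insert j (K - {t}))"
proof -
  have "\<not> adj E u j" if "u \<in> K - {t}" for u
    using assms(2) that adj_sym[of E u j] by (auto simp: nb_def)
  then show ?thesis using indep_mono[OF assms(1), of "K - {t}"] by (auto simp: indep_insert)
qed

text \<open>An independent set containing \<open>t\<close> meets the clique nowhere else, and all
  neighbours of \<open>f\<close> lie in the clique.\<close>

lemma clique_piece_exchange:
  assumes "clique_piece UNIV P f" "\<forall>i<k. maxindep E UNIV (I i)" "t \<in> P" "t \<noteq> f" "incidence k I t > 0"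
  shows "exchangeable k I t f"
proof -
  obtain m where m: "m < k" "t \<in> I m" using incidence_pos[OF assms(5)] by blast
  have P: "f \<in> P" "nb E UNIV f = P - {f}" "\<And>u v. u \<in> P \<Longrightarrow> v \<in> P \<Longrightarrow> u \<noteq> v \<Longrightarrow> adj E u v"
    using assms(1) by (auto simp: clique_piece_def)
  have K: "indep E (I m)" using assms(2)[rule_format, OF m(1)] by (simp add: maxindep_def)
  have IP: "I m \<inter> P = {t}" using K m(2) assms(3) P(3) by (auto simp: indep_def)
  then have "f \<notin> I m" using P(1) assms(4) by auto
  moreover have "nb E UNIV f \<inter> (I m - {t}) = {}" using IP P(2) by auto
  ultimately show ?thesis
    using assms(2) K m by (intro exchangeable_single[of k I m] indep_swap) (auto simp: maxindep_def)
qed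

text \<open>Fixed totals of this sort show that the last vertex of a piece is never the first place
  where two products differ.\<close>

lemma clique_piece_sum:
  assumes "clique_piece UNIV P f" "\<forall>i<k. maxindep E UNIV (I i)"
  shows "(\<Sum>v\<in>P. incidence k I v) = k"
proof -
  have "(\<Sum>v\<in>P. of_bool (v \<in> I i)) = (1::nat)" if "i < k" for i
  proof -
    note K = assms(2)[rule_format, OF that]
    obtain x where x: "x \<in> I i \<inter> P" using clique_piece_meets[OF assms(1) K] by blast
    have "y = x" if "y \<in> I i \<inter> P" for y
    proof (rule ccontr)
      assume "y \<noteq> x"
      then have "adj E y x" using assms(1) that x by (auto simp: clique_piece_def)
      then show False using K that x by (auto simp: maxindep_def indep_def)
    qed
    then have "I i \<inter> P = {x}" using x by blast
    then have "(\<Sum>v\<in>P. of_bool (v \<in> I i)) = card {x}" by (simp add: of_bool_def sum.If_cases Int_commute)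
    then show ?thesis by simp
  qed
  then show ?thesis unfolding incidence_def by (subst sum.swap) simp
qed

text \<open>A maximal independent set with \<open>q\<close> omits \<open>s\<close> and
  \<open>p\<close> and hence contains \<open>f\<close>. So with \<open>q\<close> counted equally, a
  surplus of \<open>f\<close> yields a set with \<open>f\<close> but not \<open>q\<close>, where
  \<open>p\<close> can replace \<open>f\<close>.\<close>

lemma quad_piece_exchange:
  assumes "quad_piece UNIV P s f p q" "\<forall>i<k. maxindep E UNIV (I i)" "\<forall>i<k. maxindep E UNIV (A i)"
    and "incidence k A q = incidence k I q" "incidence k A f < incidence k I f"
  shows "exchangeable k I f p"
proof -
  have P: "nb E UNIV f = {s, p}" "nb E UNIV p = {f, q}" "adj E s q" "distinct [s, f, p, q]"
    using assms(1) by (simp_all add: quad_piece_def)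
  have id: "incidence k X f = incidence k X q + (\<Sum>i<k. of_bool (f \<in> X i \<and> q \<notin> X i))"
    if "\<forall>i<k. maxindep E UNIV (X i)" for X
  proof -
    have "of_bool (f \<in> X i) = of_bool (q \<in> X i) + (of_bool (f \<in> X i \<and> q \<notin> X i) :: nat)" if "i < k" for i
    proof -
      note K = \<open>\<forall>i<k. maxindep E UNIV (X i)\<close>[rule_format, OF that]
      have "q \<in> X i \<Longrightarrow> s \<notin> X i" using K P(3) by (auto simp: maxindep_def indep_def)
      then show ?thesis
        using maxindep_mem_iff[OF K P(1)] maxindep_mem_iff[OF K P(2)] by auto
    qed
    then have "(\<Sum>i<k. of_bool (f \<in> X i)) = (\<Sum>i<k. of_bool (q \<in> X i) + (of_bool (f \<in> X i \<and> q \<notin> X i) :: nat))"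
      by (intro sum.cong) auto
    then show ?thesis unfolding incidence_def sum.distrib .
  qed
  have "(\<Sum>i<k. of_bool (f \<in> I i \<and> q \<notin> I i) :: nat) > 0"
    using id[OF assms(2)] id[OF assms(3)] assms(4,5) by linarith
  from sum_of_bool_pos[OF this] obtain m where m: "m < k" "f \<in> I m" "q \<notin> I m" by blast
  have K: "indep E (I m)" using assms(2)[rule_format, OF m(1)] by (simp add: maxindep_def)
  have "p \<notin> I m" using K m P(2) by (auto simp: nb_def indep_def)
  then show ?thesis
    using assms(2) P(2) K m by (intro exchangeable_single[of k I m] indep_swap) (auto simp: maxindep_def)
qed

lemma quad_piece_sum:
  assumes "quad_piece UNIV P s f p q" "\<forall>i<k. maxindep E UNIV (I i)"
  shows "incidence k I f + incidence k I p = k"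
proof -
  have P: "nb E UNIV f = {s, p}" "nb E UNIV p = {f, q}" "adj E s q"
    using assms(1) by (simp_all add: quad_piece_def)
  have "of_bool (f \<in> I i) + of_bool (p \<in> I i) = (1::nat)" if "i < k" for i
  proof -
    note K = assms(2)[rule_format, OF that]
    have "\<not> (s \<in> I i \<and> q \<in> I i)" using K P(3) by (auto simp: maxindep_def indep_def)
    then show ?thesis
      using maxindep_mem_iff[OF K P(1)] maxindep_mem_iff[OF K P(2)] by auto
  qed
  then have "(\<Sum>i<k. of_bool (f \<in> I i) + (of_bool (p \<in> I i) :: nat)) = (\<Sum>i<k. 1)"
    by (intro sum.cong) auto
  then show ?thesis unfolding incidence_def sum.distrib by simp
qed

context
  fixes P v1 v2 v3 v4 v5
  assumes pent: "pent_piece UNIV P v1 v2 v3 v4 v5"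
begin

lemma pent_nb: "nb E UNIV v2 = {v1, v3}" "nb E UNIV v4 = {v3, v5}" "nb E UNIV v5 = {v4, v1}"
  and pent_distinct: "distinct [v1, v2, v3, v4, v5]" and pent_set: "P = {v1, v2, v3, v4, v5}"
  using pent unfolding pent_piece_def by blast+

lemma pent_adj: "adj E v1 v2" "adj E v2 v3" "adj E v3 v4" "adj E v4 v5" "adj E v5 v1"
  using pent unfolding pent_piece_def by blast+

lemma pent_mem:
  assumes "maxindep E UNIV K"
  shows "v2 \<in> K \<longleftrightarrow> v1 \<notin> K \<and> v3 \<notin> K" "v4 \<in> K \<longleftrightarrow> v3 \<notin> K \<and> v5 \<notin> K" "v5 \<in> K \<longleftrightarrow> v4 \<notin> K \<and> v1 \<notin> K"
  using maxindep_mem_iff[OF assms pent_nb(1)] maxindep_mem_iff[OF assms pent_nb(2)]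
    maxindep_mem_iff[OF assms pent_nb(3)] by auto

text \<open>The trace of a maximal independent set on the 5-cycle is \<open>{v1, v3}\<close>,
  \<open>{v1, v4}\<close>, \<open>{v3, v5}\<close>, \<open>{v2, v4}\<close> or
  \<open>{v2, v5}\<close>; each identity holds trace by trace.\<close>

lemma pent_mults:
  assumes "\<forall>i<k. maxindep E UNIV (I i)"
  shows "incidence k I v2 + incidence k I v1 + incidence k I v3 = k + (\<Sum>i<k. of_bool (v1 \<in> I i \<and> v3 \<in> I i))"
    and "incidence k I v4 + (\<Sum>i<k. of_bool (v1 \<in> I i \<and> v3 \<in> I i)) =
      incidence k I v1 + (\<Sum>i<k. of_bool (v2 \<in> I i \<and> v4 \<in> I i))"
    and "incidence k I v1 + incidence k I v2 + incidence k I v3 + incidence k I v4 + incidence k I v5 = 2 * k"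
proof -
  have 1: "of_bool (v2 \<in> I i) + of_bool (v1 \<in> I i) + of_bool (v3 \<in> I i) = 1 + (of_bool (v1 \<in> I i \<and> v3 \<in> I i) :: nat)"
    and 2: "of_bool (v4 \<in> I i) + of_bool (v1 \<in> I i \<and> v3 \<in> I i) = of_bool (v1 \<in> I i) + (of_bool (v2 \<in> I i \<and> v4 \<in> I i) :: nat)"
    and 3: "of_bool (v1 \<in> I i) + of_bool (v2 \<in> I i) + of_bool (v3 \<in> I i) + of_bool (v4 \<in> I i) + of_bool (v5 \<in> I i) = (2 :: nat)"
    if "i < k" for i
    using pent_mem[OF assms[rule_format, OF that]] by auto
  have "(\<Sum>i<k. of_bool (v2 \<in> I i) + of_bool (v1 \<in> I i) + of_bool (v3 \<in> I i)) =
      (\<Sum>i<k. 1 + (of_bool (v1 \<in> I i \<and> v3 \<in> I i) :: nat))" using 1 by (intro sum.cong) auto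
  then show "incidence k I v2 + incidence k I v1 + incidence k I v3 = k + (\<Sum>i<k. of_bool (v1 \<in> I i \<and> v3 \<in> I i))"
    unfolding incidence_def sum.distrib by simp
  have "(\<Sum>i<k. of_bool (v4 \<in> I i) + of_bool (v1 \<in> I i \<and> v3 \<in> I i)) =
      (\<Sum>i<k. of_bool (v1 \<in> I i) + (of_bool (v2 \<in> I i \<and> v4 \<in> I i) :: nat))" using 2 by (intro sum.cong) auto
  then show "incidence k I v4 + (\<Sum>i<k. of_bool (v1 \<in> I i \<and> v3 \<in> I i)) =
      incidence k I v1 + (\<Sum>i<k. of_bool (v2 \<in> I i \<and> v4 \<in> I i))"
    unfolding incidence_def sum.distrib by simp
  have "(\<Sum>i<k. of_bool (v1 \<in> I i) + of_bool (v2 \<in> I i) + of_bool (v3 \<in> I i) + of_bool (v4 \<in> I i) + of_bool (v5 \<in> I i)) =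
      (\<Sum>i<k. 2 :: nat)" using 3 by (intro sum.cong) auto
  then show "incidence k I v1 + incidence k I v2 + incidence k I v3 + incidence k I v4 + incidence k I v5 = 2 * k"
    unfolding incidence_def sum.distrib by simp
qed

lemma pent_exchange_v1:
  assumes "\<forall>i<k. maxindep E UNIV (I i)" "incidence k I v1 > 0"
  shows "exchangeable k I v1 v2 \<or> exchangeable k I v1 v5"
proof -
  obtain m where m: "m < k" "v1 \<in> I m" using incidence_pos[OF assms(2)] by blast
  note K = assms(1)[rule_format, OF m(1)] and mem = pent_mem[OF assms(1)[rule_format, OF m(1)]]
  have ind: "indep E (I i)" if "i < k" for i using assms(1)[rule_format, OF that] by (simp add: maxindep_def)
  show ?thesis
  \<comment> \<open>The trace \<open>{v1, v3}\<close> becomes \<open>{v3, v5}\<close>, and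
    \<open>{v1, v4}\<close> becomes \<open>{v2, v4}\<close>.\<close>
  proof (cases "v3 \<in> I m")
    case True
    then have "exchangeable k I v1 v5"
      using mem m ind pent_nb by (intro exchangeable_single[of k I m] indep_swap) auto
    then show ?thesis ..
  next
    case False
    then have "exchangeable k I v1 v2"
      using mem m ind pent_nb by (intro exchangeable_single[of k I m] indep_swap) auto
    then show ?thesis ..
  qed
qed

lemma pent_exchange_v3:
  assumes "\<forall>i<k. maxindep E UNIV (I i)" "incidence k I v3 > 0"
  shows "exchangeable k I v3 v2 \<or> exchangeable k I v3 v4"
proof -
  obtain m where m: "m < k" "v3 \<in> I m" using incidence_pos[OF assms(2)] by blast
  note K = assms(1)[rule_format, OF m(1)] and mem = pent_mem[OF assms(1)[rule_format, OF m(1)]]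
  have ind: "indep E (I i)" if "i < k" for i using assms(1)[rule_format, OF that] by (simp add: maxindep_def)
  show ?thesis
  proof (cases "v1 \<in> I m")
    case True
    then have "exchangeable k I v3 v4"
      using mem m ind pent_nb by (intro exchangeable_single[of k I m] indep_swap) auto
    then show ?thesis ..
  next
    case False
    then have "exchangeable k I v3 v2"
      using mem m ind pent_nb by (intro exchangeable_single[of k I m] indep_swap) auto
    then show ?thesis ..
  qed
qed

text \<open>The counts of \<open>v1\<close>, \<open>v2\<close>, \<open>v3\<close> fix the number of
  traces \<open>{v1, v3}\<close>, so a surplus of \<open>v4\<close> is one of traces
  \<open>{v2, v4}\<close>; one of these is changed to \<open>{v2, v5}\<close>.\<close>

lemma pent_exchange_v4:
  assumes "\<forall>i<k. maxindep E UNIV (I i)" "\<forall>i<k. maxindep E UNIV (A i)"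
    and "incidence k A v1 = incidence k I v1" "incidence k A v2 = incidence k I v2" "incidence k A v3 = incidence k I v3"
    and "incidence k A v4 < incidence k I v4"
  shows "exchangeable k I v4 v5"
proof -
  have "(\<Sum>i<k. of_bool (v2 \<in> I i \<and> v4 \<in> I i) :: nat) > 0"
    using pent_mults(1,2)[OF assms(1)] pent_mults(1,2)[OF assms(2)] assms(3-6) by linarith
  from sum_of_bool_pos[OF this] obtain m where m: "m < k" "v2 \<in> I m" "v4 \<in> I m" by blast
  note K = assms(1)[rule_format, OF m(1)] and mem = pent_mem[OF assms(1)[rule_format, OF m(1)]]
  have ind: "indep E (I i)" if "i < k" for i using assms(1)[rule_format, OF that] by (simp add: maxindep_def)
  show ?thesis using mem m ind pent_nb by (intro exchangeable_single[of k I m] indep_swap) auto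
qed

text \<open>The only exchange touching two covers at once. One independent set contains \<open>v1, v3\<close>, the other
  \<open>v2\<close>; interchanging them on the part of the graph hanging off \<open>v1\<close> makes room for \<open>v1, v4\<close> in one and
  \<open>v3, v5\<close> in the other. In a cactus the parts hanging off \<open>v1\<close> and \<open>v3\<close> are not connected
  outside the cycle.\<close>

lemma pent_exchange_v2:
  assumes "\<forall>i<k. maxindep E UNIV (I i)" "\<forall>i<k. maxindep E UNIV (A i)"
    and "incidence k A v1 = incidence k I v1" "incidence k A v3 = incidence k I v3" "incidence k A v2 < incidence k I v2"
  shows "exchangeable k I v2 v4 \<or> exchangeable k I v2 v5"
proof -
  \<comment> \<open>With \<open>v1\<close> and \<open>v3\<close> counted equally, a surplus of
    \<open>v2\<close> is a surplus of traces \<open>{v1, v3}\<close>.\<close>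
  have "(\<Sum>i<k. of_bool (v1 \<in> I i \<and> v3 \<in> I i) :: nat) > 0"
    using pent_mults(1)[OF assms(1)] pent_mults(1)[OF assms(2)] assms(3-5) by linarith
  from sum_of_bool_pos[OF this] obtain m where m: "m < k" "v1 \<in> I m" "v3 \<in> I m" by blast
  have "incidence k I v2 > 0" using assms(5) by simp
  from incidence_pos[OF this] obtain n where n: "n < k" "v2 \<in> I n" by blast
  note memm = pent_mem[OF assms(1)[rule_format, OF m(1)]] and memn = pent_mem[OF assms(1)[rule_format, OF n(1)]]
  have mn: "m \<noteq> n" using m n memm by auto
  have ind: "indep E (I i)" if "i < k" for i using assms(1)[rule_format, OF that] by (simp add: maxindep_def)
  have ne: "v1 \<noteq> v2" "v1 \<noteq> v3" "v1 \<noteq> v4" "v1 \<noteq> v5" "v2 \<noteq> v3" "v2 \<noteq> v4" "v2 \<noteq> v5" "v3 \<noteq> v4" "v3 \<noteq> v5" "v4 \<noteq> v5"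
    using pent_distinct by auto
  \<comment> \<open>The part hanging off \<open>v1\<close>. A path through it to \<open>v3\<close>
    would be an ear of the 5-cycle.\<close>
  define R where "R = reach_in E (- P) v1 - {v1}"
  have RP: "R \<inter> P = {}" using reach_in_subset[of E "- P" v1] by (auto simp: R_def)
  have Rclosed: "y \<in> R" if "x \<in> R \<or> x = v1" "adj E x y" "y \<notin> P" for x y
  proof -
    have "x \<in> reach_in E (- P) v1" using that(1) reach_in_self by (auto simp: R_def)
    then have "y \<in> reach_in E (- P) v1" using that by (auto intro: reach_in_step)
    then show ?thesis using that(3) pent_set by (auto simp: R_def)
  qed
  have Rv3: "\<not> adj E x v3" if "x \<in> R" for x
  proof
    assume x3: "adj E x v3"
    have "x \<in> reach_in E (- P) v1" using that by (simp add: R_def)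
    then obtain p where p: "p \<noteq> []" "hd p = v1" "last p = x" "distinct p" "set p \<subseteq> insert v1 (- P)" "successively (adj E) p"
      by (rule reach_in_path)
    obtain p' where p': "p = v1 # p'" using p(1,2) by (cases p) auto
    have "p' \<noteq> []" using p(3) p' that by (auto simp: R_def)
    have pP: "set p' \<inter> P = {}" using p(4,5) p' by auto
    have "path_between E v1 p' v3"
      unfolding path_between_def using p(3,6) p' \<open>p' \<noteq> []\<close> x3
        successively_append_iff[of "adj E" p "[v3]"] by simp
    then show False
      using cycle_ear_False[of "[v1, v2, v3, v4, v5]" v1 v3 p'] pent_adj pent_distinct
        \<open>p' \<noteq> []\<close> p(4) p' pP pent_set by auto
  qed
  define X where "X = (I m \<inter> R) \<union> (I n - R - P) \<union> {v1, v4}"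
  define Y where "Y = (I n \<inter> R) \<union> (I m - R - P) \<union> {v3, v5}"
  have outR: "\<not> adj E x y" if "x \<in> R" "y \<notin> R" "y \<notin> P" for x y using Rclosed that by blast
  have indX: "indep E X"
  proof -
    have "indep E ((I m \<inter> R) \<union> (I n - R - P))"
      using ind[OF m(1)] ind[OF n(1)] outR by (auto simp: indep_Un intro: indep_mono)
    moreover have "\<not> adj E u v1" if "u \<in> (I m \<inter> R) \<union> (I n - R - P)" for u
    proof
      assume a: "adj E u v1"
      show False
      proof (cases "u \<in> R")
        case True
        then show False using ind[OF m(1)] m(2) that a by (auto simp: indep_def)
      next
        case False
        then show False using Rclosed[of v1 u] adj_sym[OF a] that RP by auto
      qed
    qed
    moreover have "\<not> adj E u v4" if "u \<in> (I m \<inter> R) \<union> (I n - R - P)" for u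
    proof
      assume "adj E u v4"
      then have "u \<in> nb E UNIV v4" using adj_sym by (auto simp: nb_def)
      then show False using that RP pent_set unfolding pent_nb by auto
    qed
    moreover have "v1 \<notin> nb E UNIV v4" unfolding pent_nb using ne by simp
    then have "\<not> adj E v4 v1" by (simp add: nb_def)
    ultimately show ?thesis unfolding X_def by (auto simp: indep_insert)
  qed
  have indY: "indep E Y"
  proof -
    have "indep E ((I n \<inter> R) \<union> (I m - R - P))"
      using ind[OF m(1)] ind[OF n(1)] outR by (auto simp: indep_Un intro: indep_mono)
    moreover have "\<not> adj E u v3" if "u \<in> (I n \<inter> R) \<union> (I m - R - P)" for u
      using ind[OF m(1)] m(3) that Rv3 by (auto simp: indep_def)
    moreover have "\<not> adj E u v5" if "u \<in> (I n \<inter> R) \<union> (I m - R - P)" for u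
    proof
      assume "adj E u v5"
      then have "u \<in> nb E UNIV v5" using adj_sym by (auto simp: nb_def)
      then show False using that RP pent_set unfolding pent_nb by auto
    qed
    moreover have "v3 \<notin> nb E UNIV v5" unfolding pent_nb using ne by simp
    then have "\<not> adj E v5 v3" by (simp add: nb_def)
    ultimately show ?thesis unfolding Y_def by (auto simp: indep_insert)
  qed
  \<comment> \<open>\<open>{v1, v3}\<close> and \<open>{v2, v4}\<close> turn into
    \<open>{v1, v4}\<close> and \<open>{v3, v5}\<close>, trading \<open>v2\<close> for
    \<open>v5\<close>; starting from \<open>{v2, v5}\<close> instead trades it for
    \<open>v4\<close>.\<close>
  have count: "of_bool (v \<in> X) + of_bool (v \<in> Y) + of_bool (v = v2) =
      (of_bool (v \<in> I m) + of_bool (v \<in> I n) + of_bool (v = (if v4 \<in> I n then v5 else v4)) :: nat)" for v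
  proof (cases "v \<in> P")
    case True
    then have "v = v1 \<or> v = v2 \<or> v = v3 \<or> v = v4 \<or> v = v5" using pent_set by blast
    moreover have "v1 \<notin> R" "v2 \<notin> R" "v3 \<notin> R" "v4 \<notin> R" "v5 \<notin> R" using RP pent_set by auto
    moreover have "v1 \<in> P" "v2 \<in> P" "v3 \<in> P" "v4 \<in> P" "v5 \<in> P" using pent_set by auto
    ultimately show ?thesis using ne memm memn m n
      by (elim disjE) (simp_all add: X_def Y_def)
  next
    case False
    then have "v \<noteq> v1" "v \<noteq> v2" "v \<noteq> v3" "v \<noteq> v4" "v \<noteq> v5" using pent_set by auto
    then show ?thesis using False by (auto simp: X_def Y_def)
  qed
  have "exchangeable k I v2 (if v4 \<in> I n then v5 else v4)"
    by (rule exchangeable_double[OF ind m(1) n(1) mn indX indY count])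
  then show ?thesis by (auto split: if_splits)
qed

end

end

section \<open>Powers of the cover ideal\<close>

context cactus
begin

lemma vertex_cover_iff: "vertex_cover E C \<longleftrightarrow> indep E (- C)"
proof
  assume C: "vertex_cover E C"
  show "indep E (- C)"
    using C by (auto simp: indep_def adj_def vertex_cover_def)
next
  assume C: "indep E (- C)"
  show "vertex_cover E C"
    unfolding vertex_cover_def
  proof
    fix e assume e: "e \<in> E"
    then have "card e = 2" using simple by (simp add: simple_graph_def)
    then obtain u v where "e = {u, v}" by (meson card_2_iff)
    then show "e \<inter> C \<noteq> {}" using C e by (auto simp: indep_def adj_def)
  qed
qed

lemma minimal_vertex_cover_maxindep:
  assumes "minimal_vertex_cover E C"
  shows "maxindep E UNIV (- C)"
  unfolding maxindep_def
proof (intro conjI ballI)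
  show ind: "indep E (- C)" using assms by (simp add: minimal_vertex_cover_def vertex_cover_iff)
  fix v assume "v \<in> UNIV - - C"
  then have "C - {v} \<subset> C" by auto
  then have "\<not> indep E (- (C - {v}))" using assms by (auto simp: minimal_vertex_cover_def vertex_cover_iff)
  moreover have "- (C - {v}) = insert v (- C)" by auto
  ultimately show "\<exists>u\<in>- C. adj E u v" using ind by (auto simp: indep_insert)
qed simp

lemma vertex_cover_contains_minimal:
  assumes "vertex_cover E C"
  obtains D where "D \<subseteq> C" "minimal_vertex_cover E D"
proof -
  obtain D where D: "D \<subseteq> C \<and> vertex_cover E D" "\<And>D'. D' \<subseteq> C \<and> vertex_cover E D' \<Longrightarrow> card D \<le> card D'"
    using ex_has_least_nat[of "\<lambda>D. D \<subseteq> C \<and> vertex_cover E D" C card] assms by blast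
  have "\<not> vertex_cover E D'" if "D' \<subset> D" for D'
    using D(2)[of D'] D(1) that psubset_card_mono[OF _ that] by fastforce
  then show ?thesis using that D(1) by (auto simp: minimal_vertex_cover_def)
qed

end

lemma lookup_sqfree_exp: "lookup (sqfree_exp C) v = of_bool (v \<in> C)"
  unfolding sqfree_exp_def by (simp add: lookup_sum lookup_single when_def of_bool_def)

lemma monom_add: "monom (a + b) = (monom a * monom b :: ('a, 'k::comm_ring_1) mpoly)"
  by (simp add: monom_def mult_single)

lemma (in cactus) monom_mem_cover_ideal:
  assumes "vertex_cover E C"
  shows "monom (sqfree_exp C) \<in> (cover_ideal E :: ('a, 'k::comm_ring_1) mpoly set)"
proof -
  obtain D where D: "D \<subseteq> C" "minimal_vertex_cover E D" using vertex_cover_contains_minimal[OF assms] by blast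
  have "sqfree_exp C = sqfree_exp (C - D) + sqfree_exp D"
    using D(1) by (intro poly_mapping_eqI) (auto simp: lookup_add lookup_sqfree_exp)
  then have "monom (sqfree_exp C) = monom (sqfree_exp (C - D)) * (monom (sqfree_exp D) :: ('a, 'k) mpoly)"
    by (simp add: monom_add)
  moreover have "monom (sqfree_exp D) \<in> (cover_ideal E :: ('a, 'k) mpoly set)"
    unfolding cover_ideal_def using D(2) by (intro subsetD[OF subset_ideal_of]) blast
  ultimately show ?thesis
    unfolding cover_ideal_def by (simp add: is_idealD(3)[OF is_ideal_ideal_of])
qed

lemma (in cactus) monom_mem_ideal_pow:
  assumes "\<forall>i<k. vertex_cover E (C i)"
  shows "monom (\<Sum>i<k. sqfree_exp (C i)) \<in> ideal_pow (cover_ideal E :: ('a, 'k::comm_ring_1) mpoly set) k"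
  using assms
proof (induction k)
  case (Suc k)
  have "monom (\<Sum>i<k. sqfree_exp (C i)) \<in> ideal_pow (cover_ideal E :: ('a, 'k) mpoly set) k"
    using Suc by simp
  moreover have "monom (sqfree_exp (C k)) \<in> (cover_ideal E :: ('a, 'k) mpoly set)"
    using Suc.prems by (intro monom_mem_cover_ideal) simp
  ultimately have "monom (\<Sum>i<k. sqfree_exp (C i)) * monom (sqfree_exp (C k)) \<in>
      ideal_pow (cover_ideal E :: ('a, 'k) mpoly set) (Suc k)"
    unfolding ideal_pow.simps by (intro subsetD[OF subset_ideal_of]) blast
  then show ?case by (simp add: monom_add)
qed simp

lemma ideal_pow_cover_ideal_keys:
  fixes E :: "'a::finite set set"
  shows "ideal_pow (cover_ideal E :: ('a, 'k::comm_ring_1) mpoly set) k \<subseteq>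
    {p. keys p \<subseteq> {m. \<exists>C c. (\<forall>i<k. minimal_vertex_cover E (C i)) \<and> m = (\<Sum>i<k. sqfree_exp (C i)) + c}}"
proof (induction k)
  case (Suc k)
  let ?U = "\<lambda>k. {m :: 'a \<Rightarrow>\<^sub>0 nat. \<exists>C c. (\<forall>i<k. minimal_vertex_cover E (C i)) \<and> m = (\<Sum>i<k. sqfree_exp (C i)) + c}"
  have up: "a + b \<in> ?U k" if "a \<in> ?U k" for a b k
    using that by (auto simp: add.assoc)
  let ?V = "{m :: 'a \<Rightarrow>\<^sub>0 nat. \<exists>C c. minimal_vertex_cover E C \<and> m = sqfree_exp C + c}"
  have J: "cover_ideal E \<subseteq> {p :: ('a, 'k) mpoly. keys p \<subseteq> ?V}"
    unfolding cover_ideal_def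
  proof (rule ideal_of_least[OF is_ideal_keys_upward])
    show "a + b \<in> ?V" if "a \<in> ?V" for a b using that by (auto simp: add.assoc)
    show "{monom (sqfree_exp C) |C. minimal_vertex_cover E C} \<subseteq> {p :: ('a, 'k) mpoly. keys p \<subseteq> ?V}"
    proof clarsimp
      fix C m assume C: "minimal_vertex_cover E C" "m \<in> keys (monom (sqfree_exp C) :: ('a, 'k) mpoly)"
      then have "m = sqfree_exp C + 0" by (simp add: monom_def)
      then show "\<exists>C. minimal_vertex_cover E C \<and> (\<exists>c. m = sqfree_exp C + c)" using C(1) by blast
    qed
  qed
  show ?case
    unfolding ideal_pow.simps
  proof (rule ideal_of_least[OF is_ideal_keys_upward])
    show "a + b \<in> ?U (Suc k)" if "a \<in> ?U (Suc k)" for a b by (rule up[OF that])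
    show "{a * b |a b. a \<in> ideal_pow (cover_ideal E) k \<and> b \<in> cover_ideal E} \<subseteq>
        {p :: ('a, 'k) mpoly. keys p \<subseteq> ?U (Suc k)}"
    proof (rule subsetI, rule CollectI, rule subsetI)
      fix p :: "('a, 'k) mpoly" and m
      assume "p \<in> {a * b |a b. a \<in> ideal_pow (cover_ideal E) k \<and> b \<in> cover_ideal E}" and m: "m \<in> keys p"
      then obtain a b where ab: "p = a * b" "keys a \<subseteq> ?U k" "keys b \<subseteq> ?V" using Suc.IH J by blast
      obtain x y where "m = x + y" "x \<in> keys a" "y \<in> keys b"
        using m keys_mult[of a b] unfolding ab(1) by blast
      then have xy: "m = x + y" "x \<in> ?U k" "y \<in> ?V" using ab(2,3) by (simp_all only: subsetD)
      obtain C c where C: "\<forall>i<k. minimal_vertex_cover E (C i)" "x = (\<Sum>i<k. sqfree_exp (C i)) + c"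
        using xy(2) by blast
      obtain D d where D: "minimal_vertex_cover E D" "y = sqfree_exp D + d" using xy(3) by blast
      have "m = (\<Sum>i<Suc k. sqfree_exp ((C(k := D)) i)) + (c + d)"
        using xy(1) C(2) D(2) by (simp add: ac_simps)
      moreover have "\<forall>i<Suc k. minimal_vertex_cover E ((C(k := D)) i)" using C(1) D(1) by auto
      ultimately show "m \<in> ?U (Suc k)" by blast
    qed
  qed
qed simp

lemma (in cactus) min_mon_gens_ideal_pow:
  assumes "a \<in> min_mon_gens (ideal_pow (cover_ideal E :: ('a, 'k::field) mpoly set) k)"
  obtains C where "\<forall>i<k. minimal_vertex_cover E (C i)" "a = (\<Sum>i<k. sqfree_exp (C i))"
proof -
  have a: "monom a \<in> ideal_pow (cover_ideal E :: ('a, 'k) mpoly set) k"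
    "\<And>b c. monom b \<in> ideal_pow (cover_ideal E :: ('a, 'k) mpoly set) k \<Longrightarrow> a = b + c \<Longrightarrow> c = 0"
    using assms by (auto simp: min_mon_gens_def)
  have "a \<in> keys (monom a :: ('a, 'k) mpoly)" by (simp add: monom_def)
  then obtain C c where C: "\<forall>i<k. minimal_vertex_cover E (C i)" "a = (\<Sum>i<k. sqfree_exp (C i)) + c"
    using subsetD[OF ideal_pow_cover_ideal_keys a(1)] by blast
  have "monom (\<Sum>i<k. sqfree_exp (C i)) \<in> ideal_pow (cover_ideal E :: ('a, 'k) mpoly set) k"
    using C(1) by (intro monom_mem_ideal_pow) (auto simp: minimal_vertex_cover_def)
  then have "c = 0" using a(2) C(2) by blast
  then show ?thesis using that C by simp
qed

lemma lookup_sum_sqfree_exp: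
  "lookup (\<Sum>i<k. sqfree_exp (C i)) v + incidence k (\<lambda>i. - C i) v = k"
proof -
  have "lookup (\<Sum>i<k. sqfree_exp (C i)) v + incidence k (\<lambda>i. - C i) v =
      (\<Sum>i<k. of_bool (v \<in> C i) + of_bool (v \<in> - C i))"
    by (simp only: lookup_sum lookup_sqfree_exp incidence_def sum.distrib)
  also have "\<dots> = (\<Sum>i<k. 1)" by (intro sum.cong) auto
  finally show ?thesis by simp
qed

context cactus
begin

text \<open>Ranks 4 and 5 exceed all others, which puts the pieces of the last kind at the end. Ties
  may be broken arbitrarily, since the exchanges assume agreement only at smaller ranks.\<close>

definition local_rank :: "'a set \<Rightarrow> ('a \<Rightarrow> nat) \<Rightarrow> bool" where
  "local_rank P r \<longleftrightarrow>
    (\<exists>f. clique_piece UNIV P f \<and> r = (\<lambda>v. of_bool (v = f))) \<or>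
    (\<exists>v1 v2 v3 v4 v5. pent_piece UNIV P v1 v2 v3 v4 v5 \<and>
      r = (\<lambda>v. if v = v2 then 1 else if v = v4 then 2 else if v = v5 then 3 else 0)) \<or>
    (\<exists>s f p q. quad_piece UNIV P s f p q \<and> r = (\<lambda>v. if v = f then 4 else 5))"

lemma local_rank_exists:
  assumes "piece UNIV P"
  shows "\<exists>r. local_rank P r"
proof -
  consider f where "clique_piece UNIV P f" | v1 v2 v3 v4 v5 where "pent_piece UNIV P v1 v2 v3 v4 v5"
    | s f p q where "quad_piece UNIV P s f p q"
    using assms unfolding piece_def by blast
  then show ?thesis by cases (simp add: local_rank_def; metis)+
qed

text \<open>Inside another such piece \<open>q\<close> would have only the neighbours
  \<open>p\<close> and \<open>s\<close>, so \<open>s\<close> would be the second vertex of that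
  piece and have only the neighbours \<open>f\<close> and \<open>q\<close>, against the last clause
  of \<open>quad_piece\<close>.\<close>

lemma quad_piece_nb_q:
  assumes "quad_piece UNIV P s f p q" "quad_piece UNIV P' s' f' p' q'" "q \<in> P'"
    and disj: "P \<noteq> P' \<Longrightarrow> P \<inter> P' = {}"
  shows False
proof -
  have P: "P = {f, p}" "nb E UNIV f = {s, p}" "nb E UNIV p = {f, q}" "adj E s q" "nb E UNIV s \<noteq> {f, q}" "distinct [s, f, p, q]"
    using assms(1) unfolding quad_piece_def by blast+
  have P': "P' = {f', p'}" "nb E UNIV f' = {s', p'}" "nb E UNIV p' = {f', q'}" "distinct [s', f', p', q']"
    using assms(2) unfolding quad_piece_def by blast+
  have "q \<notin> P" using P by auto
  then have "P \<inter> P' = {}" using disj assms(3) by blast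
  then have pP': "p \<notin> P'" "f \<notin> P'" using P(1) by auto
  have "q \<in> nb E UNIV p" "s \<in> nb E UNIV f" using P(2,3) by auto
  then have nbq: "p \<in> nb E UNIV q" "s \<in> nb E UNIV q" "f \<in> nb E UNIV s" "q \<in> nb E UNIV s"
    using P(4) adj_sym[OF P(4)] adj_sym[of E p q] adj_sym[of E f s] by (auto simp: nb_def)
  have "p \<noteq> s" "f \<noteq> q" using P(6) by auto
  obtain x y where x: "nb E UNIV q = {x, y}" "x \<in> P'" using assms(3) P' by auto
  have "x = s" using x nbq(1,2) pP' \<open>p \<noteq> s\<close> by auto
  then have "s \<in> P'" using x by simp
  then obtain z w where z: "nb E UNIV s = {z, w}" using P' by auto
  then have "nb E UNIV s = {f, q}" using nbq(3,4) \<open>f \<noteq> q\<close> by auto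
  then show False using P(5) by simp
qed

text \<open>\<open>A\<close> belongs to the generator with the larger exponent at \<open>t\<close>:
  incidence counts the covers that miss a vertex, hence the reversed inequality.\<close>

lemma rank_exists:
  assumes "well_covered E UNIV" "no_cycle_link E UNIV"
  obtains rank :: "'a \<Rightarrow> nat" where
    "\<And>k I A t. \<forall>i<k. maxindep E UNIV (I i) \<Longrightarrow> \<forall>i<k. maxindep E UNIV (A i) \<Longrightarrow>
      \<forall>v. rank v < rank t \<longrightarrow> incidence k A v = incidence k I v \<Longrightarrow> incidence k A t < incidence k I t \<Longrightarrow>
      \<exists>j. rank t < rank j \<and> exchangeable k I t j"
proof -
  obtain \<P> where \<P>: "\<Union>\<P> = UNIV" "\<forall>P\<in>\<P>. \<forall>Q\<in>\<P>. P \<noteq> Q \<longrightarrow> P \<inter> Q = {}" "\<forall>P\<in>\<P>. piece UNIV P"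
    using piece_partition[OF assms] by (elim exE conjE)
  obtain \<rho> where \<rho>: "\<And>P. P \<in> \<P> \<Longrightarrow> local_rank P (\<rho> P)"
    using \<P>(3) local_rank_exists by metis
  have "\<forall>v. \<exists>P. P \<in> \<P> \<and> v \<in> P" using \<P>(1) by blast
  then obtain part where part: "\<And>v. part v \<in> \<P>" "\<And>v. v \<in> part v" by metis
  define rank where "rank v = \<rho> (part v) v" for v
  have rank: "rank v = \<rho> P v" if "P \<in> \<P>" "v \<in> P" for v P
  proof -
    have "part v \<inter> P \<noteq> {}" using part(2)[of v] that(2) by blast
    then have "part v = P" using \<P>(2) part(1)[of v] that(1) by blast
    then show ?thesis by (simp add: rank_def)
  qed
  show ?thesis
  proof (rule that[of rank])
    fix k I A t
    assume I: "\<forall>i<k. maxindep E UNIV (I i)" and A: "\<forall>i<k. maxindep E UNIV (A i)"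
      and same: "\<forall>v. rank v < rank t \<longrightarrow> incidence k A v = incidence k I v"
      and less: "incidence k A t < incidence k I t"
    define P where "P = part t"
    have P: "P \<in> \<P>" "t \<in> P" using part by (auto simp: P_def)
    consider f where "clique_piece UNIV P f" "\<rho> P = (\<lambda>v. of_bool (v = f))"
      | v1 v2 v3 v4 v5 where "pent_piece UNIV P v1 v2 v3 v4 v5"
        "\<rho> P = (\<lambda>v. if v = v2 then 1 else if v = v4 then 2 else if v = v5 then 3 else 0)"
      | s f p q where "quad_piece UNIV P s f p q" "\<rho> P = (\<lambda>v. if v = f then 4 else 5)"
      using \<rho>[OF P(1)] unfolding local_rank_def by blast
    then show "\<exists>j. rank t < rank j \<and> exchangeable k I t j"
    proof cases
      case 1
      have r: "rank v = of_bool (v = f)" if "v \<in> P" for v using rank[OF P(1) that] 1(2) by simp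
      have f: "f \<in> P" using 1(1) by (simp add: clique_piece_def)
      show ?thesis
      proof (cases "t = f")
        case False
        then have "exchangeable k I t f"
          using clique_piece_exchange[OF 1(1) I P(2)] less by simp
        then show ?thesis using r f P(2) False by (intro exI[of _ f]) simp
      next
        case True
        have "incidence k A v = incidence k I v" if "v \<in> P - {f}" for v
          using same r[of v] r[of t] True that P(2) by simp
        then have "(\<Sum>v\<in>P - {f}. incidence k A v) = (\<Sum>v\<in>P - {f}. incidence k I v)" by simp
        moreover have "(\<Sum>v\<in>P. incidence k X v) = incidence k X f + (\<Sum>v\<in>P - {f}. incidence k X v)" for X :: "nat \<Rightarrow> 'a set"
          using f by (simp add: sum.remove)
        ultimately show ?thesis
          using clique_piece_sum[OF 1(1) I] clique_piece_sum[OF 1(1) A] less True by simp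
      qed
    next
      case 2
      note pent = 2(1)
      have d: "v1 \<noteq> v2" "v1 \<noteq> v3" "v1 \<noteq> v4" "v1 \<noteq> v5" "v2 \<noteq> v3" "v2 \<noteq> v4" "v2 \<noteq> v5" "v3 \<noteq> v4" "v3 \<noteq> v5" "v4 \<noteq> v5"
        using pent_distinct[OF pent] by auto
      have in_P: "v1 \<in> P" "v2 \<in> P" "v3 \<in> P" "v4 \<in> P" "v5 \<in> P" using pent_set[OF pent] by auto
      have r: "rank v1 = 0" "rank v3 = 0" "rank v2 = 1" "rank v4 = 2" "rank v5 = 3"
        using in_P[THEN rank[OF P(1)]] 2(2) d by simp_all
      then have lts: "rank v1 < rank v2" "rank v1 < rank v5" "rank v3 < rank v2" "rank v3 < rank v4"
        "rank v2 < rank v4" "rank v2 < rank v5" "rank v4 < rank v5" by simp_all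
      have pos: "incidence k I t > 0" using less by simp
      consider "t = v1" | "t = v2" | "t = v3" | "t = v4" | "t = v5" using P(2) pent_set[OF pent] by blast
      then show ?thesis
      proof cases
        case 1
        then have "exchangeable k I v1 v2 \<or> exchangeable k I v1 v5"
          using pent_exchange_v1[OF pent I] pos by simp
        then show ?thesis using 1 lts by blast
      next
        case 2
        then have "exchangeable k I v2 v4 \<or> exchangeable k I v2 v5"
          using same less r by (intro pent_exchange_v2[OF pent I A]) auto
        then show ?thesis using 2 lts by blast
      next
        case 3
        then have "exchangeable k I v3 v2 \<or> exchangeable k I v3 v4"
          using pent_exchange_v3[OF pent I] pos by simp
        then show ?thesis using 3 lts by blast
      next
        case 4
        then have "exchangeable k I v4 v5"
          using same less r by (intro pent_exchange_v4[OF pent I A]) auto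
        then show ?thesis using 4 lts by blast
      next
        case 5
        then have "incidence k A v1 = incidence k I v1" "incidence k A v2 = incidence k I v2"
          "incidence k A v3 = incidence k I v3" "incidence k A v4 = incidence k I v4"
          using same r by auto
        then have False using pent_mults(3)[OF pent I] pent_mults(3)[OF pent A] less 5 by simp
        then show ?thesis ..
      qed
    next
      case 3
      note quad = 3(1)
      have PP: "P = {f, p}" "f \<noteq> p" using quad by (auto simp: quad_piece_def)
      have r: "rank f = 4" "rank p = 5"
        using rank[OF P(1), of f] rank[OF P(1), of p] PP 3(2) by auto
      \<comment> \<open>\<open>q\<close> lies in no piece of the last kind, so it is compared before
        \<open>f\<close>.\<close>
      have "rank q < 4"
      proof -
        note lr = \<rho>[OF part(1)[of q]]
        have "\<not> quad_piece UNIV (part q) s' f' p' q'" for s' f' p' q'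
          using quad_piece_nb_q[OF quad _ part(2)[of q]] \<P>(2) P(1) part(1)[of q] by blast
        then show ?thesis using lr unfolding local_rank_def rank_def by auto
      qed
      then have q: "incidence k A q = incidence k I q" using same r P(2) PP by auto
      show ?thesis
      proof (cases "t = f")
        case True
        then have "exchangeable k I f p" using quad_piece_exchange[OF quad I A q] less by simp
        moreover have "rank f < rank p" using r by simp
        ultimately show ?thesis using True by blast
      next
        case False
        then have "t = p" using P(2) PP by auto
        moreover from this have "incidence k A f = incidence k I f" using same r by auto
        ultimately have False
          using quad_piece_sum[OF quad I] quad_piece_sum[OF quad A] less by simp
        then show ?thesis ..
      qed
    qed
  qed
qed

end

lemma cohen_macaulay_well_covered:
  fixes E :: "'a::finite set set"
  assumes "simple_graph E" "cohen_macaulay_quot (edge_ideal E :: ('a, 'k::field) mpoly set)"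
  shows "well_covered E UNIV"
  unfolding well_covered_def
proof (intro allI impI)
  fix I J assume I: "maxindep E UNIV I" and J: "indep E J"
  show "card J \<le> card I"
  proof (rule cohen_macaulay_unmixed[OF assms _ _ J])
    show "indep E I" using I by (simp add: maxindep_def)
    fix v assume "v \<notin> I"
    then obtain u where "u \<in> I" "adj E u v" using I by (auto simp: maxindep_def)
    then show "\<not> indep E (insert v I)" by (auto simp: indep_def)
  qed
qed

lemma cohen_macaulay_no_cycle_link:
  fixes E :: "'a::finite set set"
  assumes "simple_graph E" "cohen_macaulay_quot (edge_ideal E :: ('a, 'k::field) mpoly set)"
  shows "no_cycle_link E UNIV"
  unfolding no_cycle_link_def
proof (intro allI impI notI)
  fix F n c
  assume n: "n \<in> {4, 7}" and F: "indep E F" and c: "induced_cycle E n c" "UNIV - closed_nbhd E F = c ` {..<n}"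
  have "- closed_nbhd E F = c ` {..<n}" using c(2) by (simp add: Compl_eq_Diff_UNIV)
  then show False
    using n c(1) cohen_macaulay_no_link_C4[OF assms F, of c] cohen_macaulay_no_link_C7[OF assms F, of c] by auto
qed

theorem theorem1:
  fixes E :: "'a::finite set set" and k :: nat
  assumes "simple_graph E"
    and "cactus_graph E"
    and "cohen_macaulay_quot (edge_ideal E :: ('a, 'f::field) mpoly set)"
    and "k \<ge> 1"
  shows "weakly_polymatroidal (ideal_pow (cover_ideal E :: ('a, 'f) mpoly set) k)"
proof -
  interpret cactus E using assms(1,2) by unfold_locales
  let ?J = "ideal_pow (cover_ideal E :: ('a, 'f) mpoly set) k"
  note wc = cohen_macaulay_well_covered[OF assms(1,3)]
  obtain rank where rank: "\<And>k I A t. \<forall>i<k. maxindep E UNIV (I i) \<Longrightarrow> \<forall>i<k. maxindep E UNIV (A i) \<Longrightarrow>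
      \<forall>v. rank v < rank t \<longrightarrow> incidence k A v = incidence k I v \<Longrightarrow> incidence k A t < incidence k I t \<Longrightarrow>
      \<exists>j. (rank t :: nat) < rank j \<and> exchangeable k I t j"
    using rank_exists[OF wc cohen_macaulay_no_cycle_link[OF assms(1,3)]] by metis
  obtain ys :: "'a list" where ys: "set ys = UNIV" "distinct ys" using finite_distinct_list[of "UNIV :: 'a set"] by auto
  \<comment> \<open>Agreement before position \<open>t\<close> then includes all vertices of smaller
    rank, however ties are broken.\<close>
  define xs where "xs = sort_key rank ys"
  have xs: "set xs = UNIV" "distinct xs" "sorted (map rank xs)" using ys by (simp_all add: xs_def)
  have mono: "rank (xs ! i) \<le> rank (xs ! j)" if "i \<le> j" "j < length xs" for i j
    using sorted_nth_mono[OF xs(3), of i j] that by simp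
  have "weakly_polymatroidal_wrt ?J xs"
    unfolding weakly_polymatroidal_wrt_def
  proof (intro conjI ballI allI impI)
    \<comment> \<open>A reference set: by well-coveredness the complements of all minimal covers
      have its size, so all products of \<open>k\<close> of them have the same degree.\<close>
    obtain I0 where I0: "maxindep E UNIV I0" using extend_maxindep[of "{}" UNIV] by auto
    have size: "card (- C) = card I0" if "minimal_vertex_cover E C" for C
      using minimal_vertex_cover_maxindep[OF that] I0 wc
      by (intro antisym) (auto simp: well_covered_def maxindep_def)
    show "\<exists>d. \<forall>a\<in>min_mon_gens ?J. mdeg a = d"
    proof (intro exI ballI)
      fix a assume "a \<in> min_mon_gens ?J"
      then obtain C where C: "\<forall>i<k. minimal_vertex_cover E (C i)" "a = (\<Sum>i<k. sqfree_exp (C i))"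
        by (rule min_mon_gens_ideal_pow)
      have "mdeg a = (\<Sum>i<k. \<Sum>v\<in>UNIV. of_bool (v \<in> C i))"
        unfolding mdeg_def C(2) lookup_sum lookup_sqfree_exp by (rule sum.swap)
      also have "\<dots> = (\<Sum>i<k. card (UNIV :: 'a set) - card I0)"
      proof (intro sum.cong refl)
        fix i assume "i \<in> {..<k}"
        then have "card (- C i) = card I0" using C(1) size by simp
        moreover have "card (C i) + card (- C i) = card (UNIV :: 'a set)"
          using card_Un_disjoint[of "C i" "- C i"] by (simp add: Compl_partition)
        moreover have "(\<Sum>v\<in>UNIV. of_bool (v \<in> C i)) = card (C i)"
          by (simp add: of_bool_def sum.If_cases)
        ultimately show "(\<Sum>v\<in>UNIV. of_bool (v \<in> C i)) = card (UNIV :: 'a set) - card I0" by simp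
      qed
      finally show "mdeg a = k * (card (UNIV :: 'a set) - card I0)" by simp
    qed
  next
    fix a b t
    assume "a \<in> min_mon_gens ?J" "b \<in> min_mon_gens ?J" and t: "t < length xs"
      and ab: "(\<forall>i<t. lookup a (xs ! i) = lookup b (xs ! i)) \<and> lookup b (xs ! t) < lookup a (xs ! t)"
    then obtain C D where C: "\<forall>i<k. minimal_vertex_cover E (C i)" "a = (\<Sum>i<k. sqfree_exp (C i))"
      and D: "\<forall>i<k. minimal_vertex_cover E (D i)" "b = (\<Sum>i<k. sqfree_exp (D i))"
      by (metis min_mon_gens_ideal_pow)
    have la: "lookup a v + incidence k (\<lambda>i. - C i) v = k" for v using lookup_sum_sqfree_exp C(2) by metis
    have lb: "lookup b v + incidence k (\<lambda>i. - D i) v = k" for v using lookup_sum_sqfree_exp D(2) by metis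
    have "\<exists>j. rank (xs ! t) < rank j \<and> exchangeable k (\<lambda>i. - D i) (xs ! t) j"
    proof (rule rank[of k "\<lambda>i. - D i" "\<lambda>i. - C i"])
      show "\<forall>v. rank v < rank (xs ! t) \<longrightarrow> incidence k (\<lambda>i. - C i) v = incidence k (\<lambda>i. - D i) v"
      proof (intro allI impI)
        fix v assume v: "rank v < rank (xs ! t)"
        obtain i where i: "i < length xs" "v = xs ! i" using xs(1) by (metis UNIV_I in_set_conv_nth)
        then have "i < t" using mono[of t i] v by (meson not_le)
        then have "lookup a v = lookup b v" using ab i by simp
        then show "incidence k (\<lambda>i. - C i) v = incidence k (\<lambda>i. - D i) v" using la[of v] lb[of v] by linarith
      qed
      show "incidence k (\<lambda>i. - C i) (xs ! t) < incidence k (\<lambda>i. - D i) (xs ! t)"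
        using ab la[of "xs ! t"] lb[of "xs ! t"] by linarith
    qed (use C D minimal_vertex_cover_maxindep in auto)
    then obtain x where x: "rank (xs ! t) < rank x" "exchangeable k (\<lambda>i. - D i) (xs ! t) x" by blast
    obtain j where j: "j < length xs" "x = xs ! j" using xs(1) by (metis UNIV_I in_set_conv_nth)
    then have "t < j" using mono[of j t] x(1) t by (meson not_le)
    obtain I where I: "\<forall>i<k. indep E (I i)"
      "\<And>v. incidence k I v + of_bool (v = xs ! t) = incidence k (\<lambda>i. - D i) v + of_bool (v = x)"
      using x(2) unfolding exchangeable_def by blast
    define w where "w = (\<Sum>i<k. sqfree_exp (- I i))"
    have lw: "lookup w v + incidence k I v = k" for v
      using lookup_sum_sqfree_exp[where C = "\<lambda>i. - I i"] by (simp add: w_def)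
    have "monom w \<in> ?J"
      unfolding w_def using I(1) by (intro monom_mem_ideal_pow) (simp add: vertex_cover_iff)
    moreover have "b + Poly_Mapping.single (xs ! t) 1 = w + Poly_Mapping.single (xs ! j) 1"
    proof (rule poly_mapping_eqI)
      fix v
      have "lookup b v + of_bool (v = xs ! t) = lookup w v + of_bool (v = x)"
        using lb[of v] lw[of v] I(2)[of v] by linarith
      then show "lookup (b + Poly_Mapping.single (xs ! t) 1) v = lookup (w + Poly_Mapping.single (xs ! j) 1) v"
        using j(2) by (auto simp: lookup_add lookup_single when_def split: if_splits)
    qed
    ultimately show "\<exists>j>t. j < length xs \<and> (\<exists>w. b + Poly_Mapping.single (xs ! t) 1 = w + Poly_Mapping.single (xs ! j) 1 \<and> monom w \<in> ?J)"
      using j \<open>t < j\<close> by blast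
  qed
  then show ?thesis unfolding weakly_polymatroidal_def using xs(1,2) by blast
qed

end
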